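(* Let $T$ be a Sylow $t$-subgroup of $G\cong\mathrm{SL}_2(t^a)$ (where $t$ is a prime and $t^a\geq 4$) and, for a given odd prime divisor $r$ of $t^{2a}-1$, let $R$ be a Sylow $r$-subgroup of $G$. Assuming that $V$ is a finite $t$-group such that $G$ acts by automorphisms (not necessarily faithfully) on $V$ and $\mathbf{C}_V(G)=1$, consider the sets $$V_I=\{v\in V\mid \text{there exists } x\in G \text{ such that } R^x\trianglelefteq \mathbf{C}_G(v)\},$$ $$V_{II}=\{v\in V\mid \text{there exists } x\in G \text{ such that } T^x\trianglelefteq \mathbf{C}_G(v)\}.$$ Then the following conditions are equivalent. (a) $V_I$ and $V_{II}$ are both non-empty and $V-\{1\}=V_I\cup V_{II}$. (b) $G\cong\mathrm{SL}_2(4)$, and $V$ is an irreducible $G$-module of dimension $4$ over $\mathbb{F}_2$. More precisely, $V$ is the restriction to $G$, embedded as $\Omega_4^-(2)$ into $\mathrm{SL}_4(2)$, of the standard module of $\mathrm{SL}_4(2)$.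
   Context: $\mathbf{C}_V(G)$ is the subgroup of elements of $V$ fixed by $G$; $\mathbf{C}_G(v)$ is the stabilizer of $v$ in $G$; $X^x=x^{-1}Xx$. $\mathbb{F}_2$ is the field with two elements. $\Omega_4^-(2)\cong\mathrm{SL}_2(4)$ is the commutator subgroup of the orthogonal group of minus type in dimension $4$ over $\mathbb{F}_2$.
   Formalization: Condition (b) is supplemented by "and r = 3", because for t^a = 4 and r = 5 the stated equivalence fails: the nontrivial vectors of the module have stabilizers A_4 and S_3, so V_I is empty and (b) holds while (a) fails. *)

theory Defs
  imports
    "HOL-Analysis.Determinants"
    "HOL-Algebra.Algebra"
    "HOL-Library.Z2"
begin

section \<open>Matrix groups\<close>

definition GL :: "('f::field ^ 'n ^ 'n) monoid"
  where "GL = \<lparr>carrier = {A. invertible A}, mult = (**), one = mat 1\<rparr>"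

definition SL :: "('f::field ^ 'n ^ 'n) monoid"
  where "SL = \<lparr>carrier = {A. det A = 1}, mult = (**), one = mat 1\<rparr>"

definition vec_group :: "('f::field ^ 'n) monoid"
  where "vec_group = \<lparr>carrier = UNIV, mult = (+), one = 0\<rparr>"


section \<open>The fields with two and four elements\<close>

text \<open>The field with two elements is the type \<^typ>\<open>bit\<close>.\<close>

instance bit :: finite
proof
  have "(UNIV :: bit set) = {0, 1}"
    by (auto intro: bit.exhaust)
  then show "finite (UNIV :: bit set)"
    by (metis finite.emptyI finite.insertI)
qed

text \<open>
  \<open>GF4 a b\<close> stands for \<open>a + b * w\<close> where \<open>w\<close> is a root of \<open>X^2 + X + 1\<close> over the field
  with two elements; every nonzero \<open>x\<close> satisfies \<open>x^3 = 1\<close>, so its inverse is \<open>x^2\<close>.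
\<close>

datatype gf4 = GF4 bit bit

lemma UNIV_gf4: "(UNIV :: gf4 set) = {GF4 0 0, GF4 0 1, GF4 1 0, GF4 1 1}"
proof -
  have "x \<in> {GF4 0 0, GF4 0 1, GF4 1 0, GF4 1 1}" for x
  proof (cases x)
    case (GF4 a b)
    then show ?thesis by (cases a; cases b) simp_all
  qed
  then show ?thesis by blast
qed

instance gf4 :: finite
  by standard (simp add: UNIV_gf4)

lemma card_gf4: "CARD(gf4) = 4"
  by (simp add: UNIV_gf4)

instantiation gf4 :: field
begin

definition zero_gf4 :: gf4 where "0 = GF4 0 0"

definition one_gf4 :: gf4 where "1 = GF4 1 0"

fun plus_gf4 :: "gf4 \<Rightarrow> gf4 \<Rightarrow> gf4"
  where "GF4 a b + GF4 c d = GF4 (a + c) (b + d)"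

definition uminus_gf4 :: "gf4 \<Rightarrow> gf4" where "- (x :: gf4) = x"

definition minus_gf4 :: "gf4 \<Rightarrow> gf4 \<Rightarrow> gf4" where "x - y = x + (y :: gf4)"

fun times_gf4 :: "gf4 \<Rightarrow> gf4 \<Rightarrow> gf4"
  where "GF4 a b * GF4 c d = GF4 (a * c + b * d) (a * d + b * c + b * d)"

definition inverse_gf4 :: "gf4 \<Rightarrow> gf4" where "inverse x = x * (x :: gf4)"

definition divide_gf4 :: "gf4 \<Rightarrow> gf4 \<Rightarrow> gf4" where "x div y = x * inverse (y :: gf4)"

instance
proof
  fix x y z :: gf4
  obtain a b where x: "x = GF4 a b" by (cases x)
  obtain c d where y: "y = GF4 c d" by (cases y)
  obtain e f where z: "z = GF4 e f" by (cases z)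
  note defs = zero_gf4_def one_gf4_def uminus_gf4_def minus_gf4_def inverse_gf4_def
    divide_gf4_def x y z
  show "x + y + z = x + (y + z)"
    by (cases a; cases b; cases c; cases d; cases e; cases f) (simp_all add: defs)
  show "x + y = y + x" by (cases a; cases b; cases c; cases d) (simp_all add: defs)
  show "0 + x = x" by (simp add: defs)
  show "- x + x = 0" by (cases a; cases b) (simp_all add: defs)
  show "x - y = x + - y" by (simp add: defs)
  show "x * y * z = x * (y * z)"
    by (cases a; cases b; cases c; cases d; cases e; cases f) (simp_all add: defs)
  show "x * y = y * x" by (cases a; cases b; cases c; cases d) (simp_all add: defs)
  show "1 * x = x" by (simp add: defs)
  show "(x + y) * z = x * z + y * z"
    by (cases a; cases b; cases c; cases d; cases e; cases f) (simp_all add: defs)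
  show "(0::gf4) \<noteq> 1" by (simp add: defs)
  show "x \<noteq> 0 \<Longrightarrow> inverse x * x = 1" by (cases a; cases b) (simp_all add: defs)
  show "x div y = x * inverse y" by (simp add: defs)
  show "inverse (0::gf4) = 0" by (simp add: defs)
qed

end


section \<open>The group Omega of minus type in dimension four over the field with two elements\<close>

text \<open>
  The form is the orthogonal sum of a hyperbolic plane and the anisotropic plane
  \<open>c^2 + c d + d^2\<close>. Up to equivalence it is the only nondegenerate quadratic form of minus
  type in dimension four; the lemmas below record its nondegeneracy and Witt index one.
\<close>

definition Q_minus :: "bit ^ 4 \<Rightarrow> bit"
  where "Q_minus x = x $ 1 * x $ 2 + (x $ 3 * x $ 3 + x $ 3 * x $ 4 + x $ 4 * x $ 4)"

definition polar_minus :: "bit ^ 4 \<Rightarrow> bit ^ 4 \<Rightarrow> bit"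
  where "polar_minus x y = Q_minus (x + y) - Q_minus x - Q_minus y"

lemma polar_minus_eq:
  "polar_minus x y = x $ 1 * y $ 2 + x $ 2 * y $ 1 + x $ 3 * y $ 4 + x $ 4 * y $ 3"
proof -
  have "(a + a') * (b + b') + ((c + c') * (c + c') + (c + c') * (d + d') + (d + d') * (d + d'))
      - (a * b + (c * c + c * d + d * d)) - (a' * b' + (c' * c' + c' * d' + d' * d'))
      = a * b' + b * a' + c * d' + d * c'" for a b c d a' b' c' d' :: bit
    by (cases a; cases b; cases c; cases d; cases a'; cases b'; cases c'; cases d') simp_all
  then show ?thesis by (simp only: polar_minus_def Q_minus_def vector_add_component)
qed

lemma polar_minus_nondegenerate:
  assumes "\<And>y. polar_minus x y = 0"
  shows "x = 0"
proof -
  have "polar_minus x (axis 2 1) = x $ 1" "polar_minus x (axis 1 1) = x $ 2"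
    "polar_minus x (axis 4 1) = x $ 3" "polar_minus x (axis 3 1) = x $ 4"
    by (simp_all add: polar_minus_eq axis_def)
  with assms show ?thesis by (simp add: vec_eq_iff forall_4)
qed

lemma Q_minus_Witt_index:
  shows "\<exists>x. x \<noteq> 0 \<and> Q_minus x = 0"
    and "\<lbrakk>x \<noteq> 0; y \<noteq> 0; x \<noteq> y; Q_minus x = 0; Q_minus y = 0\<rbrakk> \<Longrightarrow> Q_minus (x + y) \<noteq> 0"
proof -
  have "Q_minus (axis 1 1) = 0" by (simp add: Q_minus_def axis_def)
  moreover have "axis 1 1 \<noteq> (0 :: bit ^ 4)" by (simp add: axis_eq_0_iff)
  ultimately show "\<exists>x. x \<noteq> 0 \<and> Q_minus x = 0" by blast
next
  have "\<lbrakk>\<not> (a = 0 \<and> b = 0 \<and> c = 0 \<and> d = 0); \<not> (a' = 0 \<and> b' = 0 \<and> c' = 0 \<and> d' = 0);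
      \<not> (a = a' \<and> b = b' \<and> c = c' \<and> d = d');
      a * b + (c * c + c * d + d * d) = 0; a' * b' + (c' * c' + c' * d' + d' * d') = 0\<rbrakk>
    \<Longrightarrow> (a + a') * (b + b') + ((c + c') * (c + c') + (c + c') * (d + d') + (d + d') * (d + d')) \<noteq> 0"
    for a b c d a' b' c' d' :: bit
    by (cases a; cases b; cases c; cases d; cases a'; cases b'; cases c'; cases d') simp_all
  from this[of "x $ 1" "x $ 2" "x $ 3" "x $ 4" "y $ 1" "y $ 2" "y $ 3" "y $ 4"]
  show "\<lbrakk>x \<noteq> 0; y \<noteq> 0; x \<noteq> y; Q_minus x = 0; Q_minus y = 0\<rbrakk> \<Longrightarrow> Q_minus (x + y) \<noteq> 0"
    by (simp only: Q_minus_def vec_eq_iff forall_4 vector_add_component zero_index) blast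
qed

definition O4_minus :: "(bit ^ 4 ^ 4) set"
  where "O4_minus = {A. invertible A \<and> (\<forall>x. Q_minus (A *v x) = Q_minus x)}"

definition Omega4_minus :: "(bit ^ 4 ^ 4) set"
  where "Omega4_minus = derived GL O4_minus"


section \<open>Groups acting on groups\<close>

definition sylow_subgroup :: "('g, 'x) monoid_scheme \<Rightarrow> nat \<Rightarrow> 'g set \<Rightarrow> bool"
  where "sylow_subgroup G p P \<longleftrightarrow>
    subgroup P G \<and> card P = p ^ multiplicity p (Coset.order G)"

definition conj_subgroup :: "('g, 'x) monoid_scheme \<Rightarrow> 'g set \<Rightarrow> 'g \<Rightarrow> 'g set"
  where "conj_subgroup G P x = inv\<^bsub>G\<^esub> x <#\<^bsub>G\<^esub> P #>\<^bsub>G\<^esub> x"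

text \<open>
  An action of \<open>G\<close> by automorphisms on \<open>V\<close> is a homomorphism
  \<open>\<phi> \<in> hom G (AutoGroup V)\<close>; it need not be injective.
\<close>

definition fixed_points ::
  "('g, 'x) monoid_scheme \<Rightarrow> ('v, 'y) monoid_scheme \<Rightarrow> ('g \<Rightarrow> 'v \<Rightarrow> 'v) \<Rightarrow> 'v set"
  where "fixed_points G V \<phi> = {v \<in> carrier V. \<forall>g \<in> carrier G. \<phi> g v = v}"

definition pts_with_normal_conjugate ::
  "('g, 'x) monoid_scheme \<Rightarrow> ('v, 'y) monoid_scheme \<Rightarrow> ('g \<Rightarrow> 'v \<Rightarrow> 'v) \<Rightarrow> 'g set \<Rightarrow> 'v set"
  where "pts_with_normal_conjugate G V \<phi> P =
    {v \<in> carrier V. \<exists>x \<in> carrier G.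
      conj_subgroup G P x \<lhd> G\<lparr>carrier := stabilizer G \<phi> v\<rparr>}"

text \<open>
  Scalars from the field with two elements act trivially, so the submodules of a module over
  this field are exactly the \<open>G\<close>-invariant subgroups.
\<close>

definition irreducible_action ::
  "('g, 'x) monoid_scheme \<Rightarrow> ('v, 'y) monoid_scheme \<Rightarrow> ('g \<Rightarrow> 'v \<Rightarrow> 'v) \<Rightarrow> bool"
  where "irreducible_action G V \<phi> \<longleftrightarrow>
    carrier V \<noteq> {\<one>\<^bsub>V\<^esub>} \<and>
    (\<forall>W. subgroup W V \<longrightarrow> (\<forall>g \<in> carrier G. \<phi> g ` W \<subseteq> W) \<longrightarrow>
      W = {\<one>\<^bsub>V\<^esub>} \<or> W = carrier V)"

definition irreducible_F2_module_dim4 ::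
  "('g, 'x) monoid_scheme \<Rightarrow> ('v, 'y) monoid_scheme \<Rightarrow> ('g \<Rightarrow> 'v \<Rightarrow> 'v) \<Rightarrow> bool"
  where "irreducible_F2_module_dim4 G V \<phi> \<longleftrightarrow>
    V \<cong> (vec_group :: (bit ^ 4) monoid) \<and> irreducible_action G V \<phi>"

text \<open>
  \<open>\<psi>\<close> embeds \<open>G\<close> into the special linear group with image \<^const>\<open>Omega4_minus\<close>, and \<open>f\<close> is
  an isomorphism of \<open>G\<close>-modules from \<open>V\<close> to the standard module restricted along \<open>\<psi>\<close>.
\<close>

definition Omega4_minus_standard_module ::
  "('g, 'x) monoid_scheme \<Rightarrow> ('v, 'y) monoid_scheme \<Rightarrow> ('g \<Rightarrow> 'v \<Rightarrow> 'v) \<Rightarrow> bool"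
  where "Omega4_minus_standard_module G V \<phi> \<longleftrightarrow>
    (\<exists>\<psi> f. \<psi> \<in> hom G (SL :: (bit ^ 4 ^ 4) monoid) \<and> inj_on \<psi> (carrier G) \<and>
      \<psi> ` carrier G = Omega4_minus \<and>
      f \<in> iso V (vec_group :: (bit ^ 4) monoid) \<and>
      (\<forall>g \<in> carrier G. \<forall>v \<in> carrier V. f (\<phi> g v) = \<psi> g *v f v))"

end

theory Submission
  imports Defs "HOL-Combinatorics.Permutations"
begin

text \<open>
  Let \<open>q = t^a\<close>, let \<open>U_e\<close> be the stabilizer in \<open>SL\<^sub>2\<close>
      of a nonzero vector \<open>e\<close> and
  \<open>F_e\<close> the subgroup of points of \<open>V\<close> fixed by \<open>U_e\<close>. The
      Sylow \<open>t\<close>-subgroups are the \<open>U_e\<close>,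
  so the points of the second kind are those \<open>v\<close> with \<open>U_e \<le> C(v) \<le>
      N(U_e)\<close> for some \<open>e\<close>.
  Choose \<open>g \<noteq> 1\<close> in the centre of \<open>R\<close>, with trace
      \<open>s\<close>. All elements of trace \<open>s\<close> in \<open>SL\<^sub>2\<close>
  are conjugate, and the stabilizer of a point of the first kind contains exactly two of them, a
  conjugate of \<open>g\<close> and its inverse. Counting the pairs \<open>(e, v)\<close> with
      \<open>v \<in> F_e\<close> and
  the pairs \<open>(h, v)\<close> with \<open>h\<close> of trace \<open>s\<close> fixing
      \<open>v\<close> expresses \<open>|V|\<close> through powers of \<open>t\<close>,
  and divisibility by powers of \<open>t\<close> forces \<open>r\<close> to divide \<open>q -
      1\<close>, \<open>t = 2\<close>, \<open>|F_e| = q/2\<close>, and every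
  such \<open>h\<close> to fix exactly one point of the first kind. A nontrivial element of the
      diagonal torus fixes
  \<open>2 m\<close> points of \<open>V\<close>, where \<open>m\<close> is the number of its fixed
      points in \<open>F_e\<close>; as two opposite
  subgroups \<open>F_e\<close> meet trivially, \<open>m^2 \<le> 2 m\<close>. Since
      \<open>F_e\<close> is too small for a regular orbit of the
  torus, this gives \<open>|F_e| = 2\<close> and \<open>q = 4\<close>. The five points of the
      second kind are then
  commuting involutions with product \<open>1\<close>, and they correspond to the five singular
      vectors of the
  quadratic form of minus type.

  Conversely, \<open>SL\<^sub>2(4)\<close> acts faithfully on the five singular vectors, and each
      \<open>U_e\<close> fixes exactly
  one of them; this identifies the singular vectors with the five lines, and a nonsingular vector,
      being
  the sum of two singular vectors in a unique way, with a pair of lines.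
\<close>


section \<open>Two by two matrices\<close>

text \<open>\<open>V\<close> is not assumed abelian and the action may have a kernel, so no module
  theory is at hand at the start; all information comes from subgroups of fixed points, whose orders
  are powers of \<open>t\<close>. To count, membership in V_I is weakened to a statement about a
  single trace. This is possible because away from trace square 4 the trace determines the conjugacy
  class in SL2 over a finite field, and it is why \<open>g\<close> is taken in the centre of
  \<open>R\<close>: normality of a conjugate of \<open>R\<close> then leaves only \<open>g\<close>
  and its inverse. The price is an exponential equation with several free exponents, to be settled
  by valuations and parity alone; \<open>t = 2\<close> and \<open>t = 3\<close> need separate care.
  That the image is Omega follows without determining the orthogonal group: permuting five singular
  vectors bounds its order by 120, and a perfect subgroup of order 60 must then be the commutator
  subgroup.\<close>

definition mat2 :: "'a::field \<Rightarrow> 'a \<Rightarrow> 'a \<Rightarrow> 'a \<Rightarrow> 'a ^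
    2 ^ 2"
  where "mat2 a b c d = vector [vector [a, b], vector [c, d]]"

definition vec2 :: "'a::field \<Rightarrow> 'a \<Rightarrow> 'a ^ 2"
  where "vec2 x y = vector [x, y]"

lemma mat2_nth [simp]:
  "mat2 a b c d $ 1 $ 1 = a" "mat2 a b c d $ 1 $ 2 = b"
  "mat2 a b c d $ 2 $ 1 = c" "mat2 a b c d $ 2 $ 2 = d"
  by (simp_all add: mat2_def)

lemma vec2_nth [simp]: "vec2 x y $ 1 = x" "vec2 x y $ 2 = y"
  by (simp_all add: vec2_def)

lemma mat2_cases: obtains a b c d where "A = mat2 a b c d"
proof
  show "A = mat2 (A $ 1 $ 1) (A $ 1 $ 2) (A $ 2 $ 1) (A $ 2 $ 2)"
    by (simp add: vec_eq_iff forall_2)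
qed

lemma vec2_cases: obtains x y where "v = vec2 x y"
proof
  show "v = vec2 (v $ 1) (v $ 2)"
    by (simp add: vec_eq_iff forall_2)
qed

lemma mat2_eq_iff [simp]: "mat2 a b c d = mat2 a' b' c' d' \<longleftrightarrow> a = a' \<and> b =
    b' \<and> c = c' \<and> d = d'"
  by (auto simp: vec_eq_iff forall_2)

lemma vec2_eq_iff [simp]: "vec2 x y = vec2 x' y' \<longleftrightarrow> x = x' \<and> y = y'"
  by (auto simp: vec_eq_iff forall_2)

lemma vec2_eq_0_iff [simp]: "vec2 x y = 0 \<longleftrightarrow> x = 0 \<and> y = 0"
  by (auto simp: vec_eq_iff forall_2)

lemma smult_vec2 [simp]: "c *s vec2 x y = vec2 (c * x) (c * y)"
  by (simp add: vec_eq_iff forall_2)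

lemma mat2_mult [simp]:
  "mat2 a b c d ** mat2 a' b' c' d' =
    mat2 (a * a' + b * c') (a * b' + b * d') (c * a' + d * c') (c * b' + d * d')"
  by (simp add: vec_eq_iff forall_2 matrix_matrix_mult_def sum_2)

lemma mat2_vec2 [simp]: "mat2 a b c d *v vec2 x y = vec2 (a * x + b * y) (c * x + d * y)"
  by (simp add: vec_eq_iff forall_2 matrix_vector_mult_def sum_2)

lemma det_mat2 [simp]: "det (mat2 a b c d) = a * d - b * c"
  by (simp add: det_2)

lemma trace_mat2 [simp]: "trace (mat2 a b c d) = a + d"
  by (simp add: trace_def sum_2)

lemma mat_1_eq: "(mat 1 :: 'a::field ^ 2 ^ 2) = mat2 1 0 0 1"
  by (simp add: vec_eq_iff forall_2 mat_def)

text \<open>The adjugate serves as the inverse on determinant 1. Being polynomial in the entries, it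
  turns identities between conjugates into ring identities without division.\<close>

definition adj2 :: "'a::field ^ 2 ^ 2 \<Rightarrow> 'a ^ 2 ^ 2"
  where "adj2 A = mat2 (A $ 2 $ 2) (- A $ 1 $ 2) (- A $ 2 $ 1) (A $ 1 $ 1)"

lemma adj2_mat2 [simp]: "adj2 (mat2 a b c d) = mat2 d (- b) (- c) a"
  by (simp add: adj2_def)

lemma det_adj2 [simp]: "det (adj2 A) = det A"
  by (cases A rule: mat2_cases) (simp add: algebra_simps)

lemma trace_adj2 [simp]: "trace (adj2 A) = trace A"
  by (cases A rule: mat2_cases) (simp add: algebra_simps)

lemma adj2_inverse:
  assumes "det A = 1"
  shows "A ** adj2 A = mat 1" "adj2 A ** A = mat 1"
  using assms by (cases A rule: mat2_cases; simp add: mat_1_eq algebra_simps)+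

lemma adj2_adj2 [simp]: "adj2 (adj2 A) = A"
  by (cases A rule: mat2_cases) simp

text \<open>The alternating area form, invariant under determinant 1. It vanishes when two vectors
  lie on one line, so \<open>cross e (A *v e) = 0\<close> will express that \<open>A\<close>
  preserves the line of \<open>e\<close>.\<close>

definition cross :: "'a::field ^ 2 \<Rightarrow> 'a ^ 2 \<Rightarrow> 'a"
  where "cross x y = x $ 1 * y $ 2 - x $ 2 * y $ 1"

lemma cross_vec2 [simp]: "cross (vec2 a b) (vec2 c d) = a * d - b * c"
  by (simp add: cross_def)

lemma cross_mult: "cross (A *v x) (A *v y) = det A * cross x y"
  by (cases A rule: mat2_cases; cases x rule: vec2_cases; cases y rule: vec2_cases)
     (simp add: algebra_simps)

lemma cross_self [simp]: "cross x x = 0"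
  by (simp add: cross_def)

lemma cross_0 [simp]: "cross x 0 = 0" "cross 0 x = 0"
  by (simp_all add: cross_def)

lemma cross_commute: "cross x y = - cross y x"
  by (simp add: cross_def algebra_simps)

lemma cross_smult [simp]: "cross (c *s x) y = c * cross x y" "cross x (c *s y) = c * cross x y"
  by (simp_all add: cross_def algebra_simps)

lemma cross_eq_0_iff:
  assumes "e \<noteq> 0"
  shows "cross e x = 0 \<longleftrightarrow> (\<exists>c. x = c *s e)"
proof -
  obtain a b where e: "e = vec2 a b" by (rule vec2_cases)
  obtain c d where x: "x = vec2 c d" by (rule vec2_cases)
  have "\<exists>k. x = k *s e" if "cross e x = 0"
  proof (cases "a = 0")
    case True
    then have "x = (d / b) *s e" using that assms by (auto simp: e x)
    then show ?thesis ..
  next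
    case False
    then have "x = (c / a) *s e" using that by (auto simp: e x field_simps)
    then show ?thesis ..
  qed
  then show ?thesis by auto
qed

lemma cross_trans:
  assumes "e \<noteq> 0" "cross e x = 0" "cross e y = 0"
  shows "cross x y = 0"
  using assms(2,3) unfolding cross_eq_0_iff[OF assms(1)] by auto

text \<open>Rescaling the second vector by the inverse area is the price for determinant 1. Hence
  SL2 is transitive on ordered pairs of distinct lines.\<close>

lemma obtain_basis_change:
  assumes "cross e e' \<noteq> 0"
  obtains P where "det P = 1" "P *v vec2 1 0 = e" "P *v vec2 0 1 = inverse (cross e e') *s e'"
proof -
  obtain a b where e: "e = vec2 a b" by (rule vec2_cases)
  obtain c d where e': "e' = vec2 c d" by (rule vec2_cases)
  let ?k = "inverse (cross e e')"
  show ?thesis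
  proof
    show "det (mat2 a (?k * c) b (?k * d)) = 1"
    proof -
      have "?k * (a * d - b * c) = 1" using assms by (simp add: e e')
      then show ?thesis by (simp add: algebra_simps)
    qed
  qed (simp_all add: e e')
qed

lemma obtain_sl2_image:
  assumes "e \<noteq> 0"
  obtains P where "det P = 1" "P *v vec2 1 0 = e"
proof -
  obtain a b where e: "e = vec2 a b" by (rule vec2_cases)
  have "cross e (vec2 (- b) a) \<noteq> 0 \<or> cross e (vec2 0 1) \<noteq> 0 \<or> cross e (vec2 1
      0) \<noteq> 0"
    using assms by (auto simp: e)
  then show ?thesis using obtain_basis_change that by metis
qed

section \<open>Conjugacy by trace, through companion matrices\<close>

definition comp2 :: "'a::field \<Rightarrow> 'a ^ 2 ^ 2"
  where "comp2 s = mat2 0 (- 1) 1 s"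

text \<open>The basis \<open>v, h v\<close> turns \<open>h\<close> into its companion matrix.\<close>

lemma conjugate_comp2_if_unit_area:
  assumes "det h = 1" "cross v (h *v v) = 1"
  shows "\<exists>P. det P = 1 \<and> h ** P = P ** comp2 (trace h)"
proof -
  obtain a b c d where h: "h = mat2 a b c d" by (rule mat2_cases)
  obtain x y where v: "v = vec2 x y" by (rule vec2_cases)
  have det: "a * d - b * c = 1" using assms(1) by (simp add: h)
  have area: "x * (c * x + d * y) - y * (a * x + b * y) = 1" using assms(2) by (simp add: h v)
  define P where "P = mat2 x (a * x + b * y) y (c * x + d * y)"
  have "det P = 1" using area by (simp add: P_def algebra_simps)
  moreover have "h ** P = P ** comp2 (trace h)"
    using det by (simp add: h P_def comp2_def) (intro conjI; Groebner_Basis.algebra)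
  ultimately show ?thesis by blast
qed

lemma finite_field_char_2_square:
  fixes x :: "'f::{field,finite}"
  assumes "(2::'f) = 0"
  obtains y where "y * y = x"
proof -
  have "inj (\<lambda>y::'f. y * y)"
  proof (rule injI)
    fix y z :: 'f assume "y * y = z * z"
    then have "(y - z) * (y - z) = 2 * (z * z - y * z)" by Groebner_Basis.algebra
    then show "y = z" using assms by simp
  qed
  then have "surj (\<lambda>y::'f. y * y)" by (simp add: finite_UNIV_inj_surj)
  then show ?thesis using that by (metis surjD)
qed

text \<open>A nonzero square has at most two roots and zero has one, so squares make up more than
  half of the field.\<close>

lemma card_squares:
  "CARD('f) < 2 * card (range (\<lambda>y::'f::{field,finite}. y * y))"
proof -
  let ?S = "range (\<lambda>y::'f. y * y)"
  have roots: "card {y::'f. y * y = s} \<le> 2" for s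
  proof (cases "\<exists>z. z * z = s")
    case True
    then obtain z where "z * z = s" by blast
    then have "{y. y * y = s} \<subseteq> {z, - z}" by (auto simp: square_eq_iff)
    then have "card {y. y * y = s} \<le> card {z, - z}" by (intro card_mono) auto
    also have "\<dots> \<le> 2" by (simp add: card_insert_if)
    finally show ?thesis .
  next
    case False
    then have "{y. y * y = s} = {}" by blast
    then show ?thesis by simp
  qed
  have "(UNIV::'f set) = {y. y * y = 0} \<union> (\<Union>s\<in>?S - {0}. {y. y * y = s})" by auto
  then have "CARD('f) = card ({y::'f. y * y = 0} \<union> (\<Union>s\<in>?S - {0}. {y. y * y = s}))"
    by (rule arg_cong)
  also have "\<dots> \<le> card {y::'f. y * y = 0} + card (\<Union>s\<in>?S - {0}. {y. y * y = s})"
    by (rule card_Un_le)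
  also have "card {y::'f. y * y = 0} = 1" by simp
  also have "card (\<Union>s\<in>?S - {0}. {y::'f. y * y = s}) \<le> (\<Sum>s\<in>?S - {0}. card
      {y. y * y = s})"
    by (rule card_UN_le) simp
  also have "\<dots> \<le> (\<Sum>s\<in>?S - {0}. 2)" by (rule sum_mono) (rule roots)
  also have "\<dots> = 2 * (card ?S - 1)"
  proof -
    have "0 \<in> ?S" by (rule image_eqI[of _ _ 0]) auto
    then show ?thesis by (simp add: card_Diff_singleton)
  qed
  finally have "CARD('f) \<le> 1 + 2 * (card ?S - 1)" by simp
  moreover have "card ?S > 0" by (simp add: card_gt_0_iff)
  ultimately show ?thesis by linarith
qed

text \<open>Pigeonhole in odd characteristic: completing the square turns the equation into
  \<open>u * u = 4 * A + D * (y * y)\<close>, and each side takes more than half of the values in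
  the field. In characteristic 2 with \<open>A \<noteq> 0\<close> one term suffices, since every
  element is a square.\<close>

lemma nondegenerate_binary_form_universal:
  fixes A B C :: "'f::{field,finite}"
  assumes "B * B - 4 * A * C \<noteq> 0"
  obtains x y where "A * x * x + B * x * y + C * y * y = 1"
proof (cases "A = 0")
  case True
  then have "B \<noteq> 0" using assms by auto
  then have "A * ((1 - C) / B) * ((1 - C) / B) + B * ((1 - C) / B) * 1 + C * 1 * 1 = 1"
    using True by simp
  then show ?thesis by (rule that)
next
  case A: False
  show ?thesis
  proof (cases "(2::'f) = 0")
    case True
    obtain x where "x * x = inverse A" using finite_field_char_2_square[OF True] .
    then have "A * x * x + B * x * 0 + C * 0 * 0 = 1" using A by (simp add: mult.assoc)
    then show ?thesis by (rule that)
  next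
    case two: False
    define D where "D = B * B - 4 * A * C"
    let ?S = "range (\<lambda>y::'f. y * y)"
    let ?T = "(\<lambda>s. 4 * A + D * s) ` ?S"
    have "D \<noteq> 0" using assms by (simp add: D_def)
    then have "card ?T = card ?S" by (intro card_image) (auto simp: inj_on_def)
    moreover have "card (?S \<union> ?T) \<le> CARD('f)" by (intro card_mono) auto
    moreover have "card (?S \<union> ?T) + card (?S \<inter> ?T) = card ?S + card ?T"
      by (intro card_Un_Int[symmetric]) auto
    ultimately have "card (?S \<inter> ?T) > 0" using card_squares[where 'f='f] by linarith
    then have "?S \<inter> ?T \<noteq> {}" by (metis card.empty less_irrefl)
    then obtain u y where uy: "u * u = 4 * A + D * (y * y)" by auto
    have four: "(4::'f) \<noteq> 0" using two by (metis mult_eq_0_iff numeral_Bit0 one_add_one mult_2)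
    define x where "x = (u - B * y) / (2 * A)"
    have u: "u = 2 * A * x + B * y" using A two by (simp add: x_def)
    have "4 * A * (A * x * x + B * x * y + C * y * y) = 4 * A * 1"
      using uy unfolding u D_def by Groebner_Basis.algebra
    then have "A * x * x + B * x * y + C * y * y = 1" using A four by simp
    then show ?thesis by (rule that)
  qed
qed

text \<open>The area of \<open>v\<close> and \<open>h *v v\<close> is a binary quadratic form in
  \<open>v\<close> with discriminant \<open>trace h * trace h - 4\<close>, so it takes the value 1.
  This gives conjugacy by a matrix of determinant 1, not merely by an invertible one.\<close>

lemma conjugate_comp2:
  fixes h :: "'f::{field,finite} ^ 2 ^ 2"
  assumes "det h = 1" "trace h * trace h \<noteq> 4"
  obtains P where "det P = 1" "h ** P = P ** comp2 (trace h)"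
proof -
  obtain a b c d where h: "h = mat2 a b c d" by (rule mat2_cases)
  have "(d - a) * (d - a) - 4 * c * (- b) = trace h * trace h - 4 * det h"
    by (simp add: h algebra_simps)
  then have "(d - a) * (d - a) - 4 * c * (- b) \<noteq> 0" using assms by simp
  then obtain x y where xy: "c * x * x + (d - a) * x * y + (- b) * y * y = 1"
    by (rule nondegenerate_binary_form_universal)
  have "cross (vec2 x y) (h *v vec2 x y) = 1" using xy by (simp add: h algebra_simps)
  from conjugate_comp2_if_unit_area[OF assms(1) this] show ?thesis using that by blast
qed

text \<open>A matrix commuting with \<open>h = comp2 s\<close> has the form
  \<open>a + c * h\<close>. Prescribing determinant and trace leaves only \<open>h\<close> and
  \<open>s - h\<close>, the latter being the adjugate.\<close>

lemma commute_comp2_same_trace: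
  fixes k :: "'f::field ^ 2 ^ 2"
  assumes "det k = 1" "trace k = s" "k ** comp2 s = comp2 s ** k" "s * s \<noteq> 4"
  shows "k = comp2 s \<or> k = adj2 (comp2 s)"
proof -
  obtain a b c d where k: "k = mat2 a b c d" by (rule mat2_cases)
  have "a * 0 + b * 1 = 0 * a + - 1 * c" "c * 0 + d * 1 = 1 * a + s * c"
    using assms(3) unfolding k comp2_def mat2_mult mat2_eq_iff by blast+
  then have b: "b = - c" and d: "d = a + c * s" by (simp_all add: mult.commute)
  have tr: "2 * a + c * s = s" using assms(2) by (simp add: k d algebra_simps)
  have det: "a * (a + c * s) + c * c = 1" using assms(1) by (simp add: k b d)
  have "a * (s - a) = a * (2 * a + c * s - a)" by (simp only: tr)
  also have "\<dots> = 1 - c * c" using det by (simp add: algebra_simps eq_diff_eq)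
  finally have as: "a * (s - a) = 1 - c * c" .
  \<comment> \<open>The trace gives \<open>2 * a = s * (1 - c)\<close>; inserting this into four
    times the determinant equation eliminates \<open>a\<close> without dividing by 2.\<close>
  have "(s * s - 4) * (1 - c * c) = 0"
  proof -
    have a: "2 * a = s * (1 - c)" using tr by (simp add: algebra_simps eq_diff_eq)
    have "4 * (1 - c * c) = 4 * (a * (s - a))" by (simp only: as)
    also have "\<dots> = 2 * a * (2 * s - 2 * a)" by (simp add: algebra_simps)
    also have "\<dots> = s * (1 - c) * (2 * s - s * (1 - c))" by (simp only: a)
    also have "\<dots> = s * s * (1 - c * c)" by (simp add: algebra_simps)
    finally show ?thesis by (simp add: algebra_simps)
  qed
  then have c: "c * c = 1" and "a * (s - a) = 0" using as assms(4) by auto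
  then consider "a = 0" | "a = s" by auto
  then show ?thesis
  proof cases
    case 1
    then have "s * (c - 1) = 0" using tr by (simp add: algebra_simps)
    then have "c = 1 \<or> s = 0" by auto
    moreover have "c = 1 \<or> c = - 1" using c by (metis square_eq_1_iff)
    ultimately show ?thesis using 1 by (auto simp: k b d comp2_def)
  next
    case 2
    then have "s * (c + 1) = 0" using tr by (simp add: algebra_simps mult_2)
    then have "c = - 1 \<or> s = 0" by (auto simp: eq_neg_iff_add_eq_0)
    moreover have "c = 1 \<or> c = - 1" using c by (metis square_eq_1_iff)
    ultimately show ?thesis using 2 by (auto simp: k b d comp2_def)
  qed
qed

lemma commute_same_trace:
  fixes g k :: "'f::{field,finite} ^ 2 ^ 2"
  assumes "det g = 1" "det k = 1" "trace k = trace g" "k ** g = g ** k"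
    and "trace g * trace g \<noteq> 4"
  shows "k = g \<or> k = adj2 g"
proof -
  obtain P where P: "det P = 1" "g ** P = P ** comp2 (trace g)"
    using conjugate_comp2 assms(1,5) by blast
  let ?k = "adj2 P ** k ** P"
  have g: "adj2 P ** g ** P = comp2 (trace g)"
    by (metis P adj2_inverse(2) matrix_mul_assoc matrix_mul_lid)
  have "?k ** (adj2 P ** g ** P) = (adj2 P ** g ** P) ** ?k"
    by (metis (no_types) assms(4) P(1) adj2_inverse(1) matrix_mul_assoc matrix_mul_rid)
  then have "?k ** comp2 (trace g) = comp2 (trace g) ** ?k" unfolding g .
  moreover have "det ?k = 1" by (simp add: det_mul assms P)
  moreover have "trace ?k = trace g"
    by (metis P(1) adj2_inverse(1) assms(3) matrix_mul_assoc matrix_mul_lid trace_mul_sym)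
  ultimately have "?k = comp2 (trace g) \<or> ?k = adj2 (comp2 (trace g))"
    using commute_comp2_same_trace assms(5) by blast
  moreover have "adj2 (adj2 P ** g ** P) = adj2 P ** adj2 g ** P"
    by (cases P rule: mat2_cases; cases g rule: mat2_cases) (simp add: algebra_simps)
  ultimately have "?k = adj2 P ** g ** P \<or> ?k = adj2 P ** adj2 g ** P" using g by simp
  moreover have "P ** (adj2 P ** m ** P) ** adj2 P = m" for m :: "'f ^ 2 ^ 2"
    by (metis P(1) adj2_inverse(1) matrix_mul_assoc matrix_mul_lid matrix_mul_rid)
  ultimately show ?thesis by metis
qed

section \<open>Counting in the special linear group\<close>

definition unip :: "'a::field ^ 2 \<Rightarrow> ('a ^ 2 ^ 2) set"
  where "unip e = {A. det A = 1 \<and> A *v e = e}"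

lemma unip_det: "A \<in> unip e \<Longrightarrow> det A = 1"
  by (simp add: unip_def)

lemma adj2_mult_vec:
  assumes "det P = 1"
  shows "adj2 P *v (P *v x) = x" "P *v (adj2 P *v x) = x"
  using adj2_inverse[OF assms] by (simp_all add: matrix_vector_mul_assoc)

lemma sl2_mult_vec_eq_0_iff: "det P = 1 \<Longrightarrow> P *v x = 0 \<longleftrightarrow> x = (0
    :: 'a::field ^ 2)"
  by (metis adj2_mult_vec(1) matrix_vector_mult_0_right)

lemma conj_cancel:
  assumes "det P = 1"
  shows "adj2 P ** (P ** A ** adj2 P) ** P = A" "P ** (adj2 P ** A ** P) ** adj2 P = A"
  by (metis assms adj2_inverse matrix_mul_assoc matrix_mul_lid matrix_mul_rid)+

lemma det_conj: "det P = 1 \<Longrightarrow> det (adj2 P ** A ** P) = det A" "det P = 1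
    \<Longrightarrow> det (P ** A ** adj2 P) = det A"
  by (simp_all add: det_mul)

lemma trace_conj:
  assumes "det P = 1"
  shows "trace (adj2 P ** A ** P) = trace A" "trace (P ** A ** adj2 P) = trace A"
  using adj2_inverse[OF assms]
  by (metis matrix_mul_assoc matrix_mul_lid trace_mul_sym)+

lemma adj2_mult: "adj2 (A ** B) = adj2 B ** adj2 A"
  by (cases A rule: mat2_cases; cases B rule: mat2_cases) (simp add: algebra_simps)

lemma unip_smult: "c \<noteq> 0 \<Longrightarrow> unip (c *s e) = unip e"
  by (simp add: unip_def matrix_vector_mult_scaleR matrix_vector_mult_def vec_eq_iff forall_2 sum_2
      mult.left_commute distrib_left[symmetric])

lemma unip_mult_vec:
  assumes "det P = 1"
  shows "A \<in> unip (P *v e) \<longleftrightarrow> adj2 P ** A ** P \<in> unip e"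
proof -
  have "A *v (P *v e) = P *v e \<longleftrightarrow> adj2 P *v (A *v (P *v e)) = e"
    by (metis adj2_mult_vec assms)
  then show ?thesis
    by (simp add: unip_def det_conj assms matrix_vector_mul_assoc matrix_mul_assoc)
qed

lemma unip_std: "unip (vec2 1 0) = range (\<lambda>x. mat2 1 x 0 1)"
proof -
  have "A \<in> unip (vec2 1 0) \<longleftrightarrow> (\<exists>x. A = mat2 1 x 0 1)" for A ::
      "'a::field ^ 2 ^ 2"
    by (cases A rule: mat2_cases) (auto simp: unip_def)
  then show ?thesis by auto
qed

lemma card_fibre:
  assumes "det P = 1"
  shows "card {A. det A = 1 \<and> A *v e = P *v e} = card (unip e)"
proof -
  have "bij_betw (\<lambda>A. P ** A) (unip e) {A. det A = 1 \<and> A *v e = P *v e}"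
    by (rule bij_betw_byWitness[where f' = "\<lambda>A. adj2 P ** A"])
       (use assms in \<open>auto simp: unip_def det_mul adj2_inverse matrix_mul_assoc adj2_mult_vec
         matrix_vector_mul_assoc[symmetric]\<close>)
  then show ?thesis by (simp add: bij_betw_same_card)
qed

lemma card_unip:
  fixes e :: "'f::{field,finite} ^ 2"
  assumes "e \<noteq> 0"
  shows "card (unip e) = CARD('f)"
proof -
  obtain P where P: "det P = 1" "P *v vec2 1 0 = e" using obtain_sl2_image assms by blast
  have "bij_betw (\<lambda>A. adj2 P ** A ** P) (unip e) (unip (vec2 1 0))"
    by (rule bij_betw_byWitness[where f' = "\<lambda>A. P ** A ** adj2 P"])
       (use P in \<open>auto simp: conj_cancel unip_mult_vec[OF P(1), unfolded P(2)]\<close>)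
  then have "card (unip e) = card (unip (vec2 1 0 :: 'f ^ 2))" by (rule bij_betw_same_card)
  also have "\<dots> = CARD('f)" unfolding unip_std by (subst card_image) (auto simp: inj_on_def)
  finally show ?thesis .
qed

lemma card_nonzero_vectors:
  "card {e :: 'f::{field,finite} ^ 2. e \<noteq> 0} = CARD('f) * CARD('f) - 1"
proof -
  have "{e :: 'f ^ 2. e \<noteq> 0} = UNIV - {0}" by auto
  then show ?thesis by (simp add: card_Diff_singleton power2_eq_square)
qed

lemma card_sl2:
  "card {A :: 'f::{field,finite} ^ 2 ^ 2. det A = 1} = CARD('f) * (CARD('f) * CARD('f) - 1)"
proof -
  let ?S = "{A :: 'f ^ 2 ^ 2. det A = 1}" and ?E = "{e :: 'f ^ 2. e \<noteq> 0}"
  let ?R = "\<lambda>A e. A *v vec2 1 0 = e"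
  have "(\<Sum>A\<in>?S. card {e\<in>?E. ?R A e}) = CARD('f) * card ?E"
  proof (rule sum_multicount)
    show "\<forall>e\<in>?E. card {A\<in>?S. ?R A e} = CARD('f)"
    proof
      fix e assume "e \<in> ?E"
      then obtain P where P: "det P = 1" "P *v vec2 1 0 = e" using obtain_sl2_image by auto
      show "card {A\<in>?S. ?R A e} = CARD('f)"
        using card_fibre[OF P(1), of "vec2 1 0"] card_unip[of "vec2 1 0 :: 'f ^ 2"] P(2) by simp
    qed
  qed simp_all
  moreover have "card {e\<in>?E. ?R A e} = 1" if "A \<in> ?S" for A
  proof -
    have "A *v vec2 1 0 \<noteq> 0" using that by (simp add: sl2_mult_vec_eq_0_iff)
    then have "{e\<in>?E. ?R A e} = {A *v vec2 1 0}" by auto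
    then show ?thesis by simp
  qed
  ultimately show ?thesis by (simp add: card_nonzero_vectors)
qed

section \<open>Counting the matrices of a given trace\<close>

lemma card_product_fibre:
  "card {(y, z). y * z = (c :: 'f::{field,finite})} = (if c = 0 then 2 * CARD('f) - 1 else CARD('f)
      - 1)"
proof (cases "c = 0")
  case True
  have "{(y, z). y * z = c} = range (\<lambda>z::'f. (0::'f, z)) \<union> (\<lambda>y. (y, 0::'f))
      ` (UNIV - {0})"
    using True by auto
  moreover have "card (range (\<lambda>z::'f. (0::'f, z)) \<union> (\<lambda>y. (y, 0::'f)) ` (UNIV
      - {0})) =
      card (range (\<lambda>z::'f. (0::'f, z))) + card ((\<lambda>y. (y, 0::'f)) ` (UNIV - {0::'f}))"
    by (rule card_Un_disjoint) auto
  moreover have "card (range (\<lambda>z::'f. (0::'f, z))) = CARD('f)"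
    by (rule card_image) (simp add: inj_on_def)
  moreover have "card ((\<lambda>y. (y, 0::'f)) ` (UNIV - {0::'f})) = CARD('f) - 1"
    by (subst card_image) (simp_all add: inj_on_def card_Diff_singleton)
  moreover have "CARD('f) > 0" by simp
  ultimately show ?thesis using True by simp
next
  case False
  have "{(y, z). y * z = c} = (\<lambda>y. (y, c / y)) ` (UNIV - {0})"
    using False by (auto simp: image_iff field_simps)
  moreover have "card ((\<lambda>y. (y, c / y)) ` (UNIV - {0})) = CARD('f) - 1"
    by (subst card_image) (simp_all add: inj_on_def card_Diff_singleton)
  ultimately show ?thesis using False by simp
qed

text \<open>With upper left entry \<open>x\<close>, the other diagonal entry is \<open>s - x\<close>
  and the off-diagonal entries have product \<open>x * (s - x) - 1\<close>. Each \<open>x\<close>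
  contributes \<open>q - 1\<close> pairs, and \<open>q\<close> more if it is a root of
  \<open>x * (s - x) = 1\<close>, that is, an eigenvalue. There are two roots or none because
  \<open>s * s \<noteq> 4\<close>.\<close>

lemma card_trace_class:
  fixes s :: "'f::{field,finite}"
  assumes "s * s \<noteq> 4"
  shows "card {A :: 'f ^ 2 ^ 2. det A = 1 \<and> trace A = s} =
    (if \<exists>x. x * (s - x) = 1 then CARD('f) * (CARD('f) + 1) else CARD('f) * (CARD('f) - 1))"
proof -
  let ?q = "CARD('f)"
  let ?p = "\<lambda>x. x * (s - x) - 1"
  have "bij_betw (\<lambda>(x, y, z). mat2 x y z (s - x)) (SIGMA x:UNIV. {(y, z). y * z = ?p x})
      {A :: 'f ^ 2 ^ 2. det A = 1 \<and> trace A = s}"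
  proof (rule bij_betw_byWitness[where f' = "\<lambda>A. (A $ 1 $ 1, A $ 1 $ 2, A $ 2 $ 1)"])
    show "\<forall>A\<in>{A. det A = 1 \<and> trace A = s}. (case (A $ 1 $ 1, A $ 1 $ 2, A $ 2 $ 1) of
        (x, y, z) \<Rightarrow> mat2 x y z (s - x)) = A"
    proof
      fix A :: "'f ^ 2 ^ 2" assume "A \<in> {A. det A = 1 \<and> trace A = s}"
      then show "(case (A $ 1 $ 1, A $ 1 $ 2, A $ 2 $ 1) of (x, y, z) \<Rightarrow> mat2 x y z (s -
          x)) = A"
        by (cases A rule: mat2_cases) auto
    qed
    show "(\<lambda>A. (A $ 1 $ 1, A $ 1 $ 2, A $ 2 $ 1)) ` {A :: 'f ^ 2 ^ 2. det A = 1 \<and>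
        trace A = s}
        \<subseteq> (SIGMA x:UNIV. {(y, z). y * z = ?p x})"
    proof (rule image_subsetI)
      fix A :: "'f ^ 2 ^ 2" assume "A \<in> {A. det A = 1 \<and> trace A = s}"
      then show "(A $ 1 $ 1, A $ 1 $ 2, A $ 2 $ 1) \<in> (SIGMA x:UNIV. {(y, z). y * z = ?p x})"
        by (cases A rule: mat2_cases) (auto simp: algebra_simps)
    qed
  qed auto
  then have "card {A :: 'f ^ 2 ^ 2. det A = 1 \<and> trace A = s} =
      card (SIGMA x:UNIV. {(y, z). y * z = ?p x})" by (simp add: bij_betw_same_card)
  also have "\<dots> = (\<Sum>x\<in>UNIV. card {(y, z). y * z = ?p x})" by (rule card_SigmaI) auto
  also have "\<dots> = (\<Sum>x\<in>UNIV. (?q - 1) + (if ?p x = 0 then ?q else 0))"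
  proof (rule sum.cong[OF refl])
    fix x
    have "?q > 0" by simp
    then show "card {(y, z). y * z = ?p x} = (?q - 1) + (if ?p x = 0 then ?q else 0)"
      unfolding card_product_fibre by (simp add: mult_2)
  qed
  also have "\<dots> = ?q * (?q - 1) + ?q * card {x. ?p x = 0}"
    unfolding sum.distrib by (simp add: sum.If_cases)
  finally have *: "card {A :: 'f ^ 2 ^ 2. det A = 1 \<and> trace A = s} =
    ?q * (?q - 1) + ?q * card {x. ?p x = 0}" .
  show ?thesis
  proof (cases "\<exists>x. x * (s - x) = 1")
    case True
    then obtain l where l: "l * (s - l) = 1" by blast
    \<comment> \<open>A double root \<open>l = s - l\<close> would make the discriminant vanish;
      this form of it is valid in characteristic 2 as well.\<close>
    have disc: "s * s - 4 = (s - 2 * l) * (s - 2 * l) + 4 * (l * (s - l) - 1)"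
      by (simp add: algebra_simps)
    have "l \<noteq> s - l"
    proof
      assume "l = s - l"
      then have "l + l = s" by (rule eq_diff_eq[THEN iffD1])
      then have "s - 2 * l = 0" by (simp only: mult_2 diff_self)
      then have "s * s - 4 = 0" using disc l by (simp only: mult_zero_right diff_self add_0)
      then show False using assms by simp
    qed
    have "?p x = 0 \<longleftrightarrow> x = l \<or> x = s - l" for x
    proof -
      have "?p x - (l * (s - l) - 1) = - ((x - l) * (x - (s - l)))" by (simp add: algebra_simps)
      then have "?p x = - ((x - l) * (x - (s - l)))" using l by simp
      then show ?thesis by auto
    qed
    then have "{x. ?p x = 0} = {l, s - l}" by auto
    then have "card {x. ?p x = 0} = 2" using \<open>l \<noteq> s - l\<close> by simp
    then have "card {A :: 'f ^ 2 ^ 2. det A = 1 \<and> trace A = s} = ?q * ((?q - 1) + 2)"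
      using * by (simp only: distrib_left)
    moreover have "?q > 0" by simp
    then have "?q - 1 + 2 = ?q + 1" by linarith
    ultimately show ?thesis using True by simp
  next
    case False
    then have "{x. ?p x = 0} = {}" by auto
    then show ?thesis using * False by simp
  qed
qed

section \<open>Actions of the special linear group\<close>

text \<open>Concrete matrices stand in for the abstract group so that traces and vectors are at
  hand; \<open>act\<close> is constrained only on determinant 1.\<close>

locale sl2_action = group V for V :: "('v, 'y) monoid_scheme" (structure) +
  fixes act :: "'f::{field,finite} ^ 2 ^ 2 \<Rightarrow> 'v \<Rightarrow> 'v"
  assumes finite_carrier: "finite (carrier V)"
    and act_closed [simp]: "det A = 1 \<Longrightarrow> v \<in> carrier V \<Longrightarrow> act A v
        \<in> carrier V"
    and act_mult: "det A = 1 \<Longrightarrow> det B = 1 \<Longrightarrow> v \<in> carrier V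
        \<Longrightarrow> act (A ** B) v = act A (act B v)"
    and act_1 [simp]: "v \<in> carrier V \<Longrightarrow> act (mat 1) v = v"
    and act_hom: "det A = 1 \<Longrightarrow> u \<in> carrier V \<Longrightarrow> v \<in> carrier V
        \<Longrightarrow>
      act A (u \<otimes> v) = act A u \<otimes> act A v"
begin

definition Stab :: "'v \<Rightarrow> ('f ^ 2 ^ 2) set"
  where "Stab v = {A. det A = 1 \<and> act A v = v}"

definition Fix :: "('f ^ 2 ^ 2) set \<Rightarrow> 'v set"
  where "Fix S = {v \<in> carrier V. \<forall>A \<in> S. act A v = v}"

text \<open>A consequence of membership in V_I when \<open>s\<close> is the trace of a nontrivial
  central element of \<open>R\<close> (see \<open>V_I_typeI\<close>); it retains just what the
  counting uses.\<close>

definition typeI :: "'f \<Rightarrow> 'v \<Rightarrow> bool"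
  where "typeI s v \<longleftrightarrow> v \<in> carrier V \<and>
    (\<exists>g \<in> Stab v. trace g = s \<and> (\<forall>h \<in> Stab v. trace h = s
        \<longrightarrow> h = g \<or> h = adj2 g))"

text \<open>Preserving the line of \<open>e\<close> amounts to normalizing \<open>unip e\<close>, so
  a Sylow \<open>t\<close>-subgroup is normal in the stabilizer; \<open>V_II_iff_typeII\<close>
  makes this exact.\<close>

definition typeII :: "'v \<Rightarrow> bool"
  where "typeII v \<longleftrightarrow> v \<in> carrier V \<and>
    (\<exists>e. e \<noteq> 0 \<and> unip e \<subseteq> Stab v \<and> (\<forall>A \<in> Stab v.
        cross e (A *v e) = 0))"

lemma act_one [simp]: "det A = 1 \<Longrightarrow> act A \<one> = \<one>"
  by (metis act_closed act_hom one_closed r_cancel_one' r_one)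

lemma act_adj2 [simp]:
  assumes "det A = 1" "v \<in> carrier V"
  shows "act (adj2 A) (act A v) = v" "act A (act (adj2 A) v) = v"
  using assms by (metis act_1 act_mult adj2_inverse det_adj2)+

lemma act_inj: "det A = 1 \<Longrightarrow> u \<in> carrier V \<Longrightarrow> v \<in> carrier V
    \<Longrightarrow> act A u = act A v \<longleftrightarrow> u = v"
  by (metis act_adj2(1))

lemma Stab_det: "A \<in> Stab v \<Longrightarrow> det A = 1"
  by (simp add: Stab_def)

lemma act_inv: "det A = 1 \<Longrightarrow> v \<in> carrier V \<Longrightarrow> act A (inv v) = inv
    (act A v)"
  by (metis act_closed act_hom act_one inv_closed inv_equality l_inv)

lemma subgroup_Fix:
  assumes "\<And>A. A \<in> S \<Longrightarrow> det A = 1"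
  shows "subgroup (Fix S) V"
  by (rule subgroupI) (use assms in \<open>auto simp: Fix_def act_hom act_inv\<close>)

lemma subgroup_Fix_unip: "subgroup (Fix (unip e)) V"
  by (rule subgroup_Fix) (rule unip_det)

lemma one_in_Fix: "(\<And>A. A \<in> S \<Longrightarrow> det A = 1) \<Longrightarrow> \<one> \<in>
    Fix S"
  by (simp add: Fix_def)

lemma Stab_act:
  assumes "det P = 1" "v \<in> carrier V"
  shows "A \<in> Stab (act P v) \<longleftrightarrow> adj2 P ** A ** P \<in> Stab v"
proof -
  have "act A (act P v) = act P v \<longleftrightarrow> act (adj2 P ** A ** P) v = v" if "det A = 1"
  proof -
    have "act (adj2 P ** A ** P) v = act (adj2 P) (act A (act P v))"
      using assms that by (simp add: act_mult det_mul)
    then show ?thesis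
      by (metis assms that act_adj2 act_closed)
  qed
  then show ?thesis using det_conj[OF assms(1)] by (auto simp: Stab_def)
qed

lemma Stab_subgroup:
  assumes "v \<in> carrier V" "A \<in> Stab v" "B \<in> Stab v"
  shows "A ** B \<in> Stab v" "adj2 A \<in> Stab v"
  using assms by (auto simp: Stab_def det_mul act_mult) (metis act_adj2(1))

lemma typeI_act:
  assumes "det P = 1" "typeI s v"
  shows "typeI s (act P v)"
proof -
  from assms obtain g where v: "v \<in> carrier V" and g: "g \<in> Stab v" "trace g = s"
    "\<And>h. h \<in> Stab v \<Longrightarrow> trace h = s \<Longrightarrow> h = g \<or> h = adj2
        g" by (auto simp: typeI_def)
  let ?g = "P ** g ** adj2 P"
  have "?g \<in> Stab (act P v)" using g(1) by (simp add: Stab_act assms v conj_cancel)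
  moreover have "trace ?g = s" using g(2) by (simp add: trace_conj assms)
  moreover have "h = ?g \<or> h = adj2 ?g" if "h \<in> Stab (act P v)" "trace h = s" for h
  proof -
    have "adj2 P ** h ** P = g \<or> adj2 P ** h ** P = adj2 g"
      using g(3) that by (simp add: Stab_act assms v trace_conj)
    then have "h = ?g \<or> h = P ** adj2 g ** adj2 P" by (metis assms(1) conj_cancel(2))
    then show ?thesis by (simp add: adj2_mult matrix_mul_assoc)
  qed
  ultimately show ?thesis using v assms by (auto simp: typeI_def)
qed

lemma typeII_act:
  assumes "det P = 1" "typeII v"
  shows "typeII (act P v)"
proof -
  from assms obtain e where v: "v \<in> carrier V" and e: "e \<noteq> 0" "unip e \<subseteq> Stab v"
    "\<And>A. A \<in> Stab v \<Longrightarrow> cross e (A *v e) = 0" by (auto simp: typeII_def)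
  have "P *v e \<noteq> 0" using e(1) assms by (simp add: sl2_mult_vec_eq_0_iff)
  moreover have "unip (P *v e) \<subseteq> Stab (act P v)"
    using e(2) by (auto simp: Stab_act assms v unip_mult_vec)
  moreover have "cross (P *v e) (A *v (P *v e)) = 0" if "A \<in> Stab (act P v)" for A
  proof -
    have "cross e ((adj2 P ** A ** P) *v e) = 0" using that e(3) by (simp add: Stab_act assms v)
    then have "cross (P *v e) (P *v ((adj2 P ** A ** P) *v e)) = 0"
      by (simp add: cross_mult assms)
    then show ?thesis
      by (simp add: matrix_vector_mul_assoc[symmetric] adj2_mult_vec assms)
  qed
  ultimately show ?thesis using v assms by (auto simp: typeII_def)
qed

lemma Fix_unip_act:
  assumes "det P = 1" "v \<in> carrier V"
  shows "act P v \<in> Fix (unip (P *v e)) \<longleftrightarrow> v \<in> Fix (unip e)"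
proof -
  have "act P v \<in> Fix (unip (P *v e)) \<longleftrightarrow> unip (P *v e) \<subseteq> Stab (act
      P v)"
    using assms unip_det by (fastforce simp: Fix_def Stab_def)
  also have "\<dots> \<longleftrightarrow> unip e \<subseteq> Stab v"
  proof
    assume *: "unip (P *v e) \<subseteq> Stab (act P v)"
    show "unip e \<subseteq> Stab v"
    proof
      fix A assume "A \<in> unip e"
      then have "P ** A ** adj2 P \<in> unip (P *v e)" by (simp add: unip_mult_vec assms conj_cancel)
      then have "P ** A ** adj2 P \<in> Stab (act P v)" using * by blast
      then show "A \<in> Stab v" by (simp add: Stab_act assms conj_cancel)
    qed
  qed (use assms in \<open>auto simp: unip_mult_vec Stab_act\<close>)
  also have "\<dots> \<longleftrightarrow> v \<in> Fix (unip e)"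
    using assms unip_det by (fastforce simp: Fix_def Stab_def)
  finally show ?thesis .
qed

lemma card_act_image:
  assumes "det P = 1" "S \<subseteq> carrier V" "T \<subseteq> carrier V"
    and *: "\<And>v. v \<in> carrier V \<Longrightarrow> act P v \<in> T \<longleftrightarrow> v
        \<in> S"
  shows "card S = card T"
proof -
  have "act (adj2 P) v \<in> S" if "v \<in> T" for v
    using *[of "act (adj2 P) v"] that assms(1,3) by auto
  then have "bij_betw (act P) S T"
    by (intro bij_betw_byWitness[where f' = "act (adj2 P)"])
       (use assms in \<open>auto simp: subset_iff\<close>)
  then show ?thesis by (rule bij_betw_same_card)
qed

lemma card_Fix_unip:
  assumes "e \<noteq> 0"
  shows "card (Fix (unip e)) = card (Fix (unip (vec2 1 0)))"
proof -
  obtain P where P: "det P = 1" "P *v vec2 1 0 = e" using obtain_sl2_image assms by blast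
  show ?thesis
    by (rule card_act_image[OF P(1), symmetric])
       (use Fix_unip_act[OF P(1), of _ "vec2 1 0"] P(2) in \<open>auto simp: Fix_def\<close>)
qed

end

section \<open>Two exponential equations\<close>

text \<open>If \<open>a > b\<close>, the right-hand side has \<open>t\<close>-adic valuation exactly
  \<open>b\<close>, while the left-hand side is divisible by \<open>t ^ (b + 1)\<close>.\<close>

lemma prime_power_valuation_eq:
  fixes t :: nat and A B C :: int
  assumes "Factorial_Ring.prime t" "n > b" "\<not> int t dvd A"
    and "C * int t ^ n = A * int t ^ b + int t ^ a * B"
  shows "a \<le> b"
proof (rule ccontr)
  assume "\<not> a \<le> b"
  then have "int t ^ a = int t ^ b * int t ^ (a - b)" "int t ^ n = int t ^ b * int t ^ (n - b)"
    using assms(2) by (simp_all add: power_add[symmetric])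
  then have "int t ^ b * (C * int t ^ (n - b)) = int t ^ b * (A + int t ^ (a - b) * B)"
    using assms(4) by (simp add: algebra_simps)
  then have "A = C * int t ^ (n - b) - int t ^ (a - b) * B"
    using assms(1) by (auto simp: prime_gt_0_nat)
  moreover have "int t dvd int t ^ (n - b)" "int t dvd int t ^ (a - b)"
    using assms(2) \<open>\<not> a \<le> b\<close> by (simp_all add: dvd_power)
  ultimately show False using assms(3) by auto
qed

text \<open>The count of \<open>V\<close> when elements of trace \<open>s\<close> have no eigenvalue
  in the field: \<open>t ^ n\<close>, \<open>t ^ b\<close> and \<open>t ^ c\<close> are the orders
  of \<open>V\<close>, of \<open>F_e\<close> and of the fixed points of such an element. After
  cancelling \<open>q\<close> (or \<open>q / 2\<close> when \<open>t = 2\<close>) a single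
  \<open>q + 1\<close> is left that \<open>t\<close> does not divide. The exception is
  \<open>t = 2\<close>, \<open>b = a - 1\<close>, where \<open>q - 1\<close> would divide a power of
  2.\<close>

lemma no_elliptic_solution:
  fixes t a b c n :: nat
  defines "q \<equiv> t ^ a"
  assumes t: "Factorial_Ring.prime t" and q: "q \<ge> 4" and c: "c \<ge> 1" and n: "n > b"
    and eq: "2 * (int t ^ n - 1) = 2 * (int q + 1) * (int t ^ b - 1) + int q * (int q - 1) * (int t
        ^ c - 1)"
  shows False
proof -
  have t2: "t \<ge> 2" using t by (rule prime_ge_2_nat)
  have "a \<noteq> 0" using q unfolding q_def by (intro notI) simp
  then have tq: "int t dvd int q" by (simp add: q_def dvd_power)
  have not_dvd: "\<not> int t dvd int q + 1"
  proof
    assume "int t dvd int q + 1"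
    then have "int t dvd 1" using tq by (simp add: dvd_add_right_iff)
    then show False using t2 by simp
  qed
  have t_c: "int t dvd int t ^ c" using c by (simp add: dvd_power)
  have eq': "2 * int t ^ n = 2 * (int q + 1) * int t ^ b + int q * ((int q - 1) * int t ^ c - (int
      q + 1))"
    using eq by (simp add: algebra_simps)
  show False
  proof (cases "t = 2")
    case False
    then have odd: "\<not> int t dvd 2 * (int q + 1)"
      using not_dvd t by (metis of_nat_numeral of_nat_dvd_iff prime_dvd_mult_iff
          prime_int_nat_transfer
        prime_nat_int_transfer primes_dvd_imp_eq two_is_prime_nat)
    have "a \<le> b"
      using prime_power_valuation_eq[OF t n odd, of 2 a "(int q - 1) * int t ^ c - (int q + 1)"] eq'
      by (simp add: q_def)
    then have "int t ^ n = int q * int t ^ (n - a)" "int t ^ b = int q * int t ^ (b - a)"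
      using n by (simp_all add: q_def power_add[symmetric])
    then have "int q * (2 * int t ^ (n - a)) =
        int q * (2 * (int q + 1) * int t ^ (b - a) + ((int q - 1) * int t ^ c - (int q + 1)))"
      using eq' by (simp add: algebra_simps)
    then have red: "2 * int t ^ (n - a) =
        2 * (int q + 1) * int t ^ (b - a) + ((int q - 1) * int t ^ c - (int q + 1))"
      using q by simp
    have na: "int t dvd int t ^ (n - a)" using n \<open>a \<le> b\<close> by (simp add: dvd_power)
    show False
    proof (cases "b = a")
      case True
      then have "int q + 1 = 2 * int t ^ (n - a) - (int q - 1) * int t ^ c"
        using red by simp
      then show False using not_dvd na t_c by (metis dvd_diff dvd_mult)
    next
      case False
      then have "int t dvd int t ^ (b - a)" using \<open>a \<le> b\<close> by (simp add: dvd_power)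
      moreover have "int q + 1 = 2 * (int q + 1) * int t ^ (b - a) + (int q - 1) * int t ^ c - 2 *
          int t ^ (n - a)"
        using red by simp
      ultimately show False using not_dvd na t_c by (metis dvd_add dvd_diff dvd_mult)
    qed
  next
    case t: True
    \<comment> \<open>The factor 2 in the equation cancels one factor of \<open>q\<close>, so the
      common power of 2 is now \<open>q / 2\<close>.\<close>
    define h :: nat where "h = 2 ^ (a - 1)"
    have qh: "int q = 2 * int h"
      using \<open>a \<noteq> 0\<close> by (simp add: q_def h_def t power_eq_if)
    have "2 * 2 ^ n = 2 * ((int q + 1) * 2 ^ b + int h * ((int q - 1) * 2 ^ c - (int q + 1)))"
      using eq' unfolding t by (simp add: qh algebra_simps)
    then have eq2: "2 ^ n = (int q + 1) * 2 ^ b + int h * ((int q - 1) * 2 ^ c - (int q + 1))"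
      by simp
    have ab: "a - 1 \<le> b"
      using prime_power_valuation_eq[OF two_is_prime_nat n, of "int q + 1" 1 "a - 1"
          "(int q - 1) * 2 ^ c - (int q + 1)"] eq2 not_dvd
      by (simp add: t h_def)
    then have "(2::int) ^ n = int h * 2 ^ (n - (a - 1))" "(2::int) ^ b = int h * 2 ^ (b - (a - 1))"
      using n by (simp_all add: h_def power_add[symmetric])
    then have "int h * 2 ^ (n - (a - 1)) =
        int h * ((int q + 1) * 2 ^ (b - (a - 1)) + ((int q - 1) * 2 ^ c - (int q + 1)))"
      using eq2 by (simp add: algebra_simps)
    moreover have "h > 0" by (simp add: h_def)
    ultimately have red: "2 ^ (n - (a - 1)) =
        (int q + 1) * 2 ^ (b - (a - 1)) + ((int q - 1) * 2 ^ c - (int q + 1))"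
      by simp
    have na: "(2::int) dvd 2 ^ (n - (a - 1))" using n ab by (simp add: dvd_power)
    show False
    proof (cases "b = a - 1")
      case True
      then have "2 ^ (n - (a - 1)) = (int q - 1) * 2 ^ c" using red by simp
      then have "int q - 1 dvd 2 ^ (n - (a - 1))" by (metis dvd_triv_left)
      moreover have "coprime (int q - 1) (2 ^ (n - (a - 1)))"
        using qh by simp
      ultimately have "is_unit (int q - 1)" by (metis coprime_absorb_left)
      then show False using q by simp
    next
      case False
      then have "(2::int) dvd 2 ^ (b - (a - 1))" using ab by (simp add: dvd_power)
      moreover have "int q + 1 = (int q + 1) * 2 ^ (b - (a - 1)) + (int q - 1) * 2 ^ c - 2 ^ (n -
          (a - 1))"
        using red by simp
      ultimately show False using not_dvd na t_c unfolding t of_nat_numeral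
        by (metis dvd_add dvd_diff dvd_mult)
    qed
  qed
qed

text \<open>The count when elements of trace \<open>s\<close> are diagonalizable: such an element
  fixes \<open>t ^ c\<close> points in all, \<open>t ^ d\<close> of them in \<open>F_e\<close>, and
  \<open>t ^ c - 2 * t ^ d + 1\<close> of the first kind. For odd \<open>t\<close>, reduction modulo
  \<open>t\<close> leaves only \<open>t = 3\<close> and \<open>d = 0\<close>; a second reduction
  modulo 3 and a comparison of valuations exclude this too.\<close>

lemma hyperbolic_solution_even:
  fixes t a b c d n :: nat
  defines "q \<equiv> t ^ a"
  assumes t: "Factorial_Ring.prime t" and q: "q \<ge> 4" and n: "n > b" and d: "d \<le> b" "d < c"
    and eq: "2 * (int t ^ n - 1) =
      2 * (int q + 1) * (int t ^ b - 1) + int q * (int q + 1) * (int t ^ c - 2 * int t ^ d + 1)"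
  shows "t = 2"
proof (rule ccontr)
  assume "t \<noteq> 2"
  have t2: "t \<ge> 2" using t by (rule prime_ge_2_nat)
  have a: "a \<noteq> 0" using q unfolding q_def by (intro notI) simp
  then have tq: "int t dvd int q" by (simp add: q_def dvd_power)
  have t3: "t \<ge> 3" using t2 \<open>t \<noteq> 2\<close> by simp
  have small: "int t dvd x \<Longrightarrow> \<bar>x\<bar> < int t \<Longrightarrow> x = 0" for x
    using dvd_imp_le_int[of x "int t"] by fastforce
  have "int t dvd 2 * (int q + 1) \<longleftrightarrow> int t dvd 2"
    using tq by (metis distrib_left dvd_add_right_iff dvd_mult mult.right_neutral)
  then have odd: "\<not> int t dvd 2 * (int q + 1)"
    using t3 small[of 2] by auto
  let ?R = "(int q + 1) * int t ^ c - 2 * (int q + 1) * int t ^ d + (int q - 1)"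
  have eq': "2 * int t ^ n = 2 * (int q + 1) * int t ^ b + int q * ?R"
    using eq by (simp add: algebra_simps)
  have ab: "a \<le> b"
    using prime_power_valuation_eq[OF t n odd, of 2 a ?R] eq' by (simp add: q_def)
  then have "int t ^ n = int q * int t ^ (n - a)" "int t ^ b = int q * int t ^ (b - a)"
    using n by (simp_all add: q_def power_add[symmetric])
  then have "int q * (2 * int t ^ (n - a)) = int q * (2 * (int q + 1) * int t ^ (b - a) + ?R)"
    using eq' by (simp add: algebra_simps)
  then have red: "2 * int t ^ (n - a) = 2 * (int q + 1) * int t ^ (b - a) + ?R"
    using q by simp
  have na: "int t dvd int t ^ (n - a)" using n ab by (simp add: dvd_power)
  have t_c: "int t dvd int t ^ c" using d by (simp add: dvd_power)
  \<comment> \<open>The equation divided by \<open>q\<close>, read modulo \<open>t\<close>; the term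
    with \<open>t ^ c\<close> drops out because \<open>c > 0\<close>.\<close>
  have key: "int t dvd 2 * int t ^ (b - a) - 2 * int t ^ d - 1"
  proof -
    have "2 * int t ^ (b - a) - 2 * int t ^ d - 1 = 2 * int t ^ (n - a) - (int q + 1) * int t ^ c
        - int q * (2 * int t ^ (b - a) - 2 * int t ^ d + 1)"
      using red by (simp add: algebra_simps)
    then show ?thesis using na t_c tq by (metis dvd_diff dvd_mult dvd_mult2)
  qed
  have d0: "d = 0"
  proof (rule ccontr)
    assume "d \<noteq> 0"
    then have "int t dvd int t ^ d" by (simp add: dvd_power)
    then have k: "int t dvd 2 * int t ^ (b - a) - 1"
      using dvd_add[OF key dvd_mult[of "int t" "int t ^ d" 2]] by simp
    show False
    proof (cases "b = a")
      case True
      then show False using k small[of 1] t3 by simp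
    next
      case False
      then have "int t dvd int t ^ (b - a)" using ab by (simp add: dvd_power)
      then have "int t dvd 1" using dvd_diff[OF dvd_mult[of "int t" "int t ^ (b - a)" 2] k] by simp
      then show False using small[of 1] t3 by simp
    qed
  qed
  have ba: "b \<noteq> a"
    using key small[of "- 1"] t3 by (auto simp: d0)
  then have tba: "int t dvd int t ^ (b - a)" using ab by (simp add: dvd_power)
  have "int t dvd - 3"
    using dvd_diff[OF key dvd_mult[OF tba, of 2]] by (simp add: d0)
  then have "\<not> \<bar>3\<bar> < int t" using small[of "- 3"] by auto
  then have t: "t = 3" using t3 by simp
  have "a \<noteq> 1" using q by (auto simp: q_def t)
  then have a2: "a \<ge> 2" using a by linarith
  \<comment> \<open>A power of 3 that is at least 4 is divisible by 9. Hence
    \<open>(q + 3) / 3\<close> is 1 modulo 3, which decides the second reduction.\<close>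
  define u where "u = int q div 9"
  have u: "int q = 9 * u"
  proof -
    have "(3::int) ^ 2 dvd 3 ^ a" using a2 by (rule le_imp_power_dvd)
    then show ?thesis by (simp add: u_def q_def t)
  qed
  have red3: "2 * 3 ^ (n - a) = 2 * (9 * u + 1) * 3 ^ (b - a) + (9 * u + 1) * 3 ^ c - (9 * u + 3)"
    using red unfolding t d0 by (simp add: u)
  obtain k where k: "b - a = Suc k" using ba ab by (metis Suc_diff_Suc le_neq_implies_less)
  obtain l where l: "c = Suc l" using d by (cases c) auto
  obtain m where m: "n - a = Suc (Suc m)"
  proof -
    have "n - a \<ge> 2" using n k by linarith
    then show ?thesis using that by (metis add_2_eq_Suc le_Suc_ex)
  qed
  have red1: "2 * (3::int) ^ Suc m = 2 * (9 * u + 1) * 3 ^ k + (9 * u + 1) * 3 ^ l - (3 * u + 1)"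
    using red3 unfolding k l m by simp
  then have mod: "(3::int) dvd 2 * 3 ^ k + 3 ^ l - 1"
  proof -
    have "2 * 3 ^ k + 3 ^ l - (1::int) = 3 * (2 * 3 ^ m - 6 * u * 3 ^ k - 3 * u * 3 ^ l + u)"
      using red1 by (simp add: algebra_simps)
    then show ?thesis by simp
  qed
  have "l = 0 \<and> k \<noteq> 0"
  proof -
    have three: "(3::int) dvd 3 ^ x" if "x \<noteq> 0" for x using that by (simp add: dvd_power)
    consider "l = 0" "k \<noteq> 0" | "l = 0" "k = 0" | "l \<noteq> 0" "k = 0" | "l \<noteq> 0" "k
        \<noteq> 0" by blast
    then show ?thesis
    proof cases
      case 3
      then have "(3::int) dvd 2 * 3 ^ k + 3 ^ l - 1 - 3 ^ l" using mod three by (metis dvd_diff)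
      then show ?thesis using 3 by simp
    next
      case 4
      then have "(3::int) dvd 2 * 3 ^ k + 3 ^ l - 1 - 3 ^ l - 2 * 3 ^ k"
        using mod three by (metis dvd_diff dvd_mult)
      then show ?thesis by simp
    qed (use mod in auto)
  qed
  then have c1: "c = 1" using l by simp
  have "2 * 3 ^ (n - a) = 2 * ((int q + 1) * 3 ^ (b - a) + int q)"
    using red3 by (simp add: c1 u algebra_simps)
  then have na: "3 ^ (n - a) = (int q + 1) * 3 ^ (b - a) + int q" by simp
  have "(3::int) ^ n = int q * 3 ^ (n - a)" and b3: "(3::int) ^ b = int q * 3 ^ (b - a)"
    using n ab by (simp_all add: q_def t power_add[symmetric])
  then have "(3::int) ^ n = int q * ((int q + 1) * 3 ^ (b - a) + int q)" by (simp only: na)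
  then have fin: "(3::int) ^ n = (int q + 1) * 3 ^ b + int q * int q"
    by (simp add: b3 algebra_simps)
  have q3: "(3::int) dvd int q" using tq t by simp
  have q2: "int q * int q = 3 ^ (2 * a)"
    by (simp add: q_def t power_add[symmetric] mult_2)
  show False
  proof (cases "b \<le> 2 * a")
    case True
    then have "int q * int q = 3 ^ b * 3 ^ (2 * a - b)" "(3::int) ^ n = 3 ^ b * 3 ^ (n - b)"
      using n by (simp_all add: q2 power_add[symmetric])
    then have "(3::int) ^ b * 3 ^ (n - b) = 3 ^ b * (int q + 1 + 3 ^ (2 * a - b))"
      using fin by (simp add: algebra_simps)
    then have e: "(3::int) ^ (n - b) = int q + 1 + 3 ^ (2 * a - b)" by simp
    have n3: "(3::int) dvd 3 ^ (n - b)" using n by (simp add: dvd_power)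
    show False
    proof (cases "2 * a = b")
      case True
      then have "2 = 3 ^ (n - b) - int q" using e by simp
      then have "(3::int) dvd 2" using n3 q3 by (metis dvd_diff)
      then show False by simp
    next
      case False
      then have "(3::int) dvd 3 ^ (2 * a - b)" using True by (simp add: dvd_power)
      moreover have "1 = 3 ^ (n - b) - int q - 3 ^ (2 * a - b)" using e by simp
      ultimately have "(3::int) dvd 1" using n3 q3 by (metis dvd_diff)
      then show False by simp
    qed
  next
    case False
    then have "(3::int) ^ b = int q * int q * 3 ^ (b - 2 * a)" "(3::int) ^ n = int q * int q * 3 ^
        (n - 2 * a)"
      using n by (simp_all add: q2 power_add[symmetric])
    then have "int q * int q * 3 ^ (n - 2 * a) = int q * int q * ((int q + 1) * 3 ^ (b - 2 * a) + 1)"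
      using fin by (simp add: algebra_simps)
    then have "1 = 3 ^ (n - 2 * a) - (int q + 1) * 3 ^ (b - 2 * a)" using q by simp
    moreover have "(3::int) dvd 3 ^ (n - 2 * a)" "(3::int) dvd 3 ^ (b - 2 * a)"
      using n False by (simp_all add: dvd_power)
    ultimately have "(3::int) dvd 1" by (metis dvd_diff dvd_mult)
    then show False by simp
  qed
qed

text \<open>After cancelling \<open>q / 2\<close>, parity gives \<open>b = a - 1\<close>. With
  \<open>c = d + 1 + k\<close> the remaining power of 2 is
  \<open>2 * q + (q + 1) * 2 ^ (d + 1) * (2 ^ k - 1)\<close>; if \<open>k > 0\<close>, taking out
  \<open>2 ^ (d + 1)\<close> would leave an odd factor greater than 1.\<close>

lemma hyperbolic_solution_2:
  fixes a b c d n :: nat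
  defines "q \<equiv> 2 ^ a"
  assumes q: "q \<ge> 4" and n: "n > b" and d: "d \<le> b" "d < c"
    and eq: "2 * (2 ^ n - 1) =
      2 * (q + 1) * (2 ^ b - 1) + q * (q + 1) * (2 ^ c - 2 * 2 ^ d + (1::int))"
  shows "b = a - 1 \<and> c = Suc d \<and> n = 2 * a"
proof -
  have a: "a \<noteq> 0" using q unfolding q_def by (intro notI) simp
  define h :: int where "h = 2 ^ (a - 1)"
  have qh: "q = 2 * h"
    using a by (simp add: q_def h_def power_eq_if)
  have h: "h > 0" by (simp add: h_def)
  let ?R = "(q + 1) * 2 ^ c - 2 * (q + 1) * 2 ^ d + (q - 1)"
  have "2 * 2 ^ n = 2 * ((q + 1) * 2 ^ b + h * ?R)"
    using eq by (simp add: qh algebra_simps)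
  then have eq2: "2 ^ n = (q + 1) * 2 ^ b + h * ?R" by simp
  have odd: "\<not> 2 dvd q + 1" using qh by simp
  have ab: "a - 1 \<le> b"
    using prime_power_valuation_eq[OF two_is_prime_nat n, of "q + 1" 1 "a - 1" ?R] eq2 odd
    by (simp add: h_def)
  then have "(2::int) ^ n = h * 2 ^ (n - (a - 1))" "(2::int) ^ b = h * 2 ^ (b - (a - 1))"
    using n by (simp_all add: h_def power_add[symmetric])
  then have "h * 2 ^ (n - (a - 1)) = h * ((q + 1) * 2 ^ (b - (a - 1)) + ?R)"
    using eq2 by (simp add: algebra_simps)
  then have red: "2 ^ (n - (a - 1)) = (q + 1) * 2 ^ (b - (a - 1)) + ?R" using h by simp
  have "even ((2::int) ^ (n - (a - 1)))" using n ab by simp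
  then have "even ((q + 1) * 2 ^ (b - (a - 1)) + ?R)" by (simp only: red[symmetric])
  then have ba: "b = a - 1" using ab d qh by (auto split: if_splits)
  obtain k where k: "c = Suc (d + k)" using d(2) by (metis less_iff_Suc_add)
  have red2: "2 ^ (n - (a - 1)) = 2 * q + (q + 1) * 2 ^ Suc d * (2 ^ k - 1)"
    using red by (simp add: ba k power_add algebra_simps)
  have "k = 0"
  proof (rule ccontr)
    assume k0: "k \<noteq> 0"
    have da: "a = Suc (d + (a - Suc d))" using d a ba by simp
    then have "q = 2 ^ Suc d * 2 ^ (a - Suc d)"
      unfolding q_def power_add[symmetric] by simp
    then have e: "2 ^ (n - (a - 1)) = 2 ^ Suc d * (2 * 2 ^ (a - Suc d) + (q + 1) * (2 ^ k - 1))"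
      using red2 by (simp add: algebra_simps)
    then have "2 * 2 ^ (a - Suc d) + (q + 1) * (2 ^ k - 1) dvd 2 ^ (n - (a - 1))"
      by (metis dvd_triv_right)
    moreover have "odd (2 * 2 ^ (a - Suc d) + (q + 1) * (2 ^ k - 1))"
      using k0 qh by simp
    ultimately have "is_unit (2 * 2 ^ (a - Suc d) + (q + 1) * (2 ^ k - 1))"
      by (metis coprime_absorb_left coprime_power_right_iff coprime_right_2_iff_odd)
    moreover have "(q + 1) * (2 ^ k - 1) \<ge> 0" using q by simp
    moreover have "(2::int) ^ (a - Suc d) \<ge> 1" by simp
    ultimately show False by (simp add: zdvd1_eq)
  qed
  then have c: "c = Suc d" and "(2::int) ^ (n - (a - 1)) = 2 ^ Suc a"
    using k red2 by (simp_all add: q_def)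
  then have "n - (a - 1) = Suc a" by (metis power_inject_exp one_less_numeral_iff semiring_norm(76))
  then have "n = 2 * a" using a by linarith
  then show ?thesis using ba c by simp
qed

section \<open>Actions in which every nontrivial stabilizer has one of two types\<close>

text \<open>Multiplying \<open>A - c\<close> by its adjugate shows that its determinant annihilates
  both coordinates of \<open>e\<close>.\<close>

lemma eigenvalue_equation:
  fixes A :: "'a::field ^ 2 ^ 2"
  assumes "A *v e = c *s e" "e \<noteq> 0"
  shows "c * (trace A - c) = det A"
proof -
  obtain p q r w where A: "A = mat2 p q r w" by (rule mat2_cases)
  obtain x y where e: "e = vec2 x y" by (rule vec2_cases)
  have 1: "p * x + q * y = c * x" "r * x + w * y = c * y" using assms(1) by (simp_all add: A e)
  have "((p - c) * (w - c) - q * r) * x = (w - c) * (p * x + q * y - c * x) - q * (r * x + w * y -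
      c * y)"
    "((p - c) * (w - c) - q * r) * y = (p - c) * (r * x + w * y - c * y) - r * (p * x + q * y - c *
        x)"
    by (simp_all add: algebra_simps)
  then have "((p - c) * (w - c) - q * r) * x = 0" "((p - c) * (w - c) - q * r) * y = 0"
    by (simp_all add: 1)
  then have "(p - c) * (w - c) - q * r = 0" using assms(2) by (auto simp: e)
  then show ?thesis by (simp add: A algebra_simps)
qed

text \<open>Translation by 1 permutes the field, so summing all elements shows that
  \<open>CARD('f)\<close> is zero in the field.\<close>

lemma char_2_if_card_power_2:
  assumes "CARD('f::{field,finite}) = 2 ^ a"
  shows "(2::'f) = 0"
proof -
  have "(\<Sum>x\<in>UNIV. x + (1::'f)) = (\<Sum>x\<in>UNIV. x)"
    by (rule sum.reindex_bij_witness[of _ "\<lambda>x. x - 1" "\<lambda>x. x + 1"]) auto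
  then have "of_nat CARD('f) = (0::'f)" by (simp add: sum.distrib)
  then have "(2::'f) ^ a = 0" unfolding assms by simp
  then show ?thesis by simp
qed

definition diag2 :: "'a::field \<Rightarrow> 'a ^ 2 ^ 2"
  where "diag2 l = mat2 l 0 0 (inverse l)"

lemma det_diag2 [simp]: "l \<noteq> 0 \<Longrightarrow> det (diag2 l) = 1"
  by (simp add: diag2_def)

lemma diag2_commute: "diag2 k ** diag2 l = diag2 l ** diag2 k"
  by (simp add: diag2_def mult.commute)

lemma diag2_mult: "diag2 k ** diag2 l = diag2 (k * l)"
  by (simp add: diag2_def mult.commute)

text \<open>The hypotheses of the forward direction in matrix form; \<open>s\<close> will be the
  trace of a central element of \<open>R\<close>.\<close>

locale sl2_two_types = sl2_action V act
  for V :: "('v, 'y) monoid_scheme" (structure)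
    and act :: "'f::{field,finite} ^ 2 ^ 2 \<Rightarrow> 'v \<Rightarrow> 'v" +
  fixes s :: 'f and t a n :: nat
  assumes s: "s * s \<noteq> 4"
    and prime_t: "Factorial_Ring.prime t"
    and card_f: "CARD('f) = t ^ a" and card_f_ge: "CARD('f) \<ge> 4"
    and card_V: "card (carrier V) = t ^ n"
    and cover: "v \<in> carrier V \<Longrightarrow> v \<noteq> \<one> \<Longrightarrow> typeI s v
        \<or> typeII v"
    and exI: "\<exists>v. v \<noteq> \<one> \<and> typeI s v"
begin

text \<open>Cut out by exclusion, so that \<open>W1\<close>, \<open>W2\<close> and the identity
  partition \<open>V\<close> by definition.\<close>

definition W1 :: "'v set" where "W1 = {v \<in> carrier V. v \<noteq> \<one> \<and> \<not> typeII v}"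
definition W2 :: "'v set" where "W2 = {v \<in> carrier V. v \<noteq> \<one> \<and> typeII v}"

lemma W_subset: "W1 \<subseteq> carrier V" "W2 \<subseteq> carrier V" by (auto simp: W1_def W2_def)

lemma finite_W: "finite W1" "finite W2"
  using W_subset finite_carrier by (auto intro: finite_subset)

lemma W1_typeI: "v \<in> W1 \<Longrightarrow> typeI s v"
  using cover by (auto simp: W1_def)

lemma act_eq_one_iff: "det P = 1 \<Longrightarrow> v \<in> carrier V \<Longrightarrow> act P v =
    \<one> \<longleftrightarrow> v = \<one>"
  by (metis act_inj act_one one_closed)

lemma typeII_act_iff: "det P = 1 \<Longrightarrow> v \<in> carrier V \<Longrightarrow> typeII (act
    P v) \<longleftrightarrow> typeII v"
  by (metis act_adj2(1) det_adj2 typeII_act)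

lemma W1_act_iff: "det P = 1 \<Longrightarrow> v \<in> carrier V \<Longrightarrow> act P v \<in> W1
    \<longleftrightarrow> v \<in> W1"
  by (simp add: W1_def typeII_act_iff act_eq_one_iff)

lemma W2_act_iff: "det P = 1 \<Longrightarrow> v \<in> carrier V \<Longrightarrow> act P v \<in> W2
    \<longleftrightarrow> v \<in> W2"
  by (simp add: W2_def typeII_act_iff act_eq_one_iff)

lemma Fix_unip_iff: "v \<in> carrier V \<Longrightarrow> v \<in> Fix (unip e) \<longleftrightarrow>
    unip e \<subseteq> Stab v"
  by (auto simp: Fix_def Stab_def unip_def)

text \<open>The conjugates of \<open>g\<close> under the unipotent subgroup are distinct, too many
    for type one.\<close>

lemma Fix_unip_not_typeI:
  assumes "e \<noteq> 0" "v \<in> Fix (unip e)"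
  shows "\<not> typeI s v"
proof
  assume I: "typeI s v"
  obtain P where P: "det P = 1" "P *v vec2 1 0 = e" using obtain_sl2_image assms(1) by blast
  define u where "u = act (adj2 P) v"
  have v: "v \<in> carrier V" using assms(2) by (simp add: Fix_def)
  then have u: "u \<in> carrier V" "act P u = v" using P by (simp_all add: u_def)
  have "typeI s u" using typeI_act[OF _ I, of "adj2 P"] P by (simp add: u_def)
  then obtain g where g: "g \<in> Stab u" "trace g = s" and
    g_only: "\<And>h. h \<in> Stab u \<Longrightarrow> trace h = s \<Longrightarrow> h = g \<or> h
        = adj2 g"
    by (auto simp: typeI_def)
  have "u \<in> Fix (unip (vec2 1 0))" using Fix_unip_act[OF P(1) u(1), of "vec2 1 0"] assms(2) P u
      by simp
  then have "unip (vec2 1 0) \<subseteq> Stab u" using u by (simp add: Fix_unip_iff)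
  then have U: "mat2 1 x 0 1 \<in> Stab u" for x by (auto simp: unip_std)
  define h where "h x = mat2 1 x 0 1 ** g ** adj2 (mat2 1 x 0 1)" for x
  have "h x \<in> Stab u" for x unfolding h_def using U g(1) u(1) by (intro Stab_subgroup)
  moreover have "trace (h x) = s" for x unfolding h_def by (subst trace_conj) (simp_all add: g)
  ultimately have "h x \<in> {g, adj2 g}" for x using g_only by blast
  then have "range h \<subseteq> {g, adj2 g}" by blast
  then have "card (range h) \<le> card {g, adj2 g}" by (intro card_mono) auto
  also have "\<dots> \<le> 2" by (simp add: card_insert_if)
  finally have "\<not> inj h" using card_f_ge by (auto simp: card_image)
  then obtain x y where xy: "x \<noteq> y" "h x = h y" by (auto simp: inj_def)
  obtain p q r w where G: "g = mat2 p q r w" by (rule mat2_cases)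
  have det: "p * w - q * r = 1" using g(1) by (simp add: Stab_def G)
  have tr: "s = p + w" using g(2) by (simp add: G)
  have e: "x * r = y * r" "- x * (p + x * r) + (q + x * w) = - y * (p + y * r) + (q + y * w)"
    using xy(2) by (simp_all add: h_def G algebra_simps)
  have r: "r = 0" using e(1) xy(1) by simp
  have "(x - y) * (w - p) = 0" using e(2) by (simp add: r algebra_simps)
  then have "w = p" using xy(1) by simp
  then have "s * s = 4 * (p * w - q * r)" by (simp add: tr r algebra_simps)
  then show False using det s by simp
qed

lemma typeII_iff:
  assumes "v \<in> carrier V" "v \<noteq> \<one>"
  shows "typeII v \<longleftrightarrow> (\<exists>e. e \<noteq> 0 \<and> v \<in> Fix (unip e))"
  using cover[OF assms] Fix_unip_not_typeI assms by (auto simp: typeII_def Fix_unip_iff)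

text \<open>The line attached to a point of the second kind is unique: a unipotent subgroup
  belonging to another line would move the invariant line.\<close>

lemma typeII_Fix:
  assumes "e \<noteq> 0" "unip e \<subseteq> Stab v" "\<And>A. A \<in> Stab v \<Longrightarrow>
      cross e (A *v e) = 0"
    and "e' \<noteq> 0" "v \<in> carrier V"
  shows "v \<in> Fix (unip e') \<longleftrightarrow> cross e e' = 0"
proof
  assume v: "v \<in> Fix (unip e')"
  obtain x y where e: "e = vec2 x y" by (rule vec2_cases)
  obtain p q where e': "e' = vec2 p q" by (rule vec2_cases)
  \<comment> \<open>The transvection \<open>x \<mapsto> x + cross e' x *s e'\<close>: it fixes
    \<open>e'\<close> and moves \<open>e\<close> off its line unless
    \<open>cross e e' = 0\<close>.\<close>
  define A where "A = mat2 (1 - p * q) (p * p) (- q * q) (1 + p * q)"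
  have "A \<in> unip e'" by (simp add: unip_def A_def e' algebra_simps)
  then have "cross e (A *v e) = 0" using v assms(3,5) by (auto simp: Fix_unip_iff)
  moreover have "cross e (A *v e) = - (cross e e' * cross e e')"
    by (simp add: A_def e e' algebra_simps)
  ultimately show "cross e e' = 0" by simp
next
  assume "cross e e' = 0"
  then obtain c where c: "e' = c *s e" using assms(1) by (auto simp: cross_eq_0_iff)
  then have "c \<noteq> 0" using assms(4) by auto
  then show "v \<in> Fix (unip e')" using assms by (simp add: c unip_smult Fix_unip_iff)
qed

lemma Stab_line:
  assumes "e \<noteq> 0" "v \<in> Fix (unip e)" "v \<noteq> \<one>" "A \<in> Stab v"
  shows "cross e (A *v e) = 0"
proof -
  have v: "v \<in> carrier V" using assms(2) by (simp add: Fix_def)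
  then have "typeII v" using typeII_iff assms by blast
  then obtain e0 where e0: "e0 \<noteq> 0" "unip e0 \<subseteq> Stab v" "\<And>A. A \<in> Stab v
      \<Longrightarrow> cross e0 (A *v e0) = 0"
    by (auto simp: typeII_def)
  have "cross e0 e = 0" using typeII_Fix[OF e0 assms(1) v] assms(2) by simp
  then obtain c where "e = c *s e0" using e0(1) by (auto simp: cross_eq_0_iff)
  then show ?thesis using e0(3)[OF assms(4)] by (simp add: vec.scale)
qed

lemma Fix_unip_Int:
  assumes "cross e e' \<noteq> 0"
  shows "Fix (unip e) \<inter> Fix (unip e') = {\<one>}"
proof -
  have ne: "e \<noteq> 0" "e' \<noteq> 0" using assms by auto
  have "v = \<one>" if v: "v \<in> Fix (unip e)" "v \<in> Fix (unip e')" for v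
  proof (rule ccontr)
    assume "v \<noteq> \<one>"
    have vc: "v \<in> carrier V" using v by (simp add: Fix_def)
    then have "typeII v" using typeII_iff \<open>v \<noteq> \<one>\<close> ne v by blast
    then obtain e0 where e0: "e0 \<noteq> 0" "unip e0 \<subseteq> Stab v" "\<And>A. A \<in> Stab v
        \<Longrightarrow> cross e0 (A *v e0) = 0"
      by (auto simp: typeII_def)
    have "cross e0 e = 0" "cross e0 e' = 0" using typeII_Fix[OF e0 _ vc] ne v by blast+
    then show False using cross_trans[OF e0(1)] assms by blast
  qed
  then show ?thesis by (auto intro: one_in_Fix unip_det)
qed

section \<open>The counting equation\<close>

abbreviation F0 :: "'v set" where "F0 \<equiv> Fix (unip (vec2 1 0))"

lemma finite_Fix: "finite (Fix S)"
  using finite_carrier by (rule finite_subset[rotated]) (auto simp: Fix_def)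

text \<open>A point of the second kind determines a line, not a vector on it, so it is counted
  \<open>q - 1\<close> times. Cancelling this against the \<open>q * q - 1\<close> nonzero vectors
  leaves the number \<open>q + 1\<close> of lines.\<close>

lemma card_W2: "card W2 = (CARD('f) + 1) * (card F0 - 1)"
proof -
  let ?q = "CARD('f)"
  let ?E = "{e :: 'f ^ 2. e \<noteq> 0}"
  have "(\<Sum>e\<in>?E. card {v \<in> W2. v \<in> Fix (unip e)}) = (?q - 1) * card W2"
  proof (rule sum_multicount)
    show "\<forall>v\<in>W2. card {e \<in> ?E. v \<in> Fix (unip e)} = ?q - 1"
    proof
      fix v assume "v \<in> W2"
      then have v: "v \<in> carrier V" "typeII v" by (auto simp: W2_def)
      then obtain e0 where e0: "e0 \<noteq> 0" "unip e0 \<subseteq> Stab v" "\<And>A. A \<in> Stab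
          v \<Longrightarrow> cross e0 (A *v e0) = 0"
        by (auto simp: typeII_def)
      have "{e \<in> ?E. v \<in> Fix (unip e)} = {e \<in> ?E. cross e0 e = 0}"
        using typeII_Fix[OF e0 _ v(1)] by auto
      also have "\<dots> = (\<lambda>c. c *s e0) ` (UNIV - {0})"
        using e0(1) by (auto simp: cross_eq_0_iff)
      also have "card \<dots> = card (UNIV - {0::'f})"
        by (rule card_image) (use e0(1) in \<open>auto simp: inj_on_def\<close>)
      finally show "card {e \<in> ?E. v \<in> Fix (unip e)} = ?q - 1" by (simp add:
          card_Diff_singleton)
    qed
  qed (simp_all add: finite_W)
  moreover have "card {v \<in> W2. v \<in> Fix (unip e)} = card F0 - 1" if "e \<in> ?E" for e
  proof -
    have "{v \<in> W2. v \<in> Fix (unip e)} = Fix (unip e) - {\<one>}"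
      using that typeII_iff by (auto simp: W2_def Fix_def)
    then show ?thesis
      using that card_Fix_unip[of e] by (simp add: card_Diff_singleton one_in_Fix unip_det)
  qed
  ultimately have "(?q * ?q - 1) * (card F0 - 1) = (?q - 1) * card W2"
    by (simp add: card_nonzero_vectors)
  moreover have "?q * ?q - 1 = (?q - 1) * (?q + 1)"
    using card_f_ge by (simp add: algebra_simps)
  ultimately have "(?q - 1) * card W2 = (?q - 1) * ((?q + 1) * (card F0 - 1))"
    by (simp only: mult.assoc)
  then show ?thesis using card_f_ge by simp
qed

definition W1_fixed :: "'f ^ 2 ^ 2 \<Rightarrow> 'v set"
  where "W1_fixed h = {v \<in> W1. act h v = v}"

text \<open>Ensures that \<open>g\<close> and its inverse are two different elements, the source of
  the factor 2 in \<open>card_W1\<close>. An element equal to its adjugate would have trace square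
  4, in every characteristic.\<close>

lemma trace_adj_neq:
  assumes "det g = 1" "trace g = s"
  shows "adj2 g \<noteq> g"
proof
  assume *: "adj2 g = g"
  obtain p q r w where G: "g = mat2 p q r w" by (rule mat2_cases)
  have "w = p" "- q = q" using * unfolding G adj2_mat2 mat2_eq_iff by blast+
  then have e: "w = p" "q + q = 0" by (metis add.right_inverse)+
  have tr: "s = p + p" using assms(2)[symmetric] by (simp add: G e(1))
  have "s * s = 4 * (p * p - q * r) + 2 * ((q + q) * r)"
    unfolding tr by (simp add: algebra_simps)
  moreover have "p * p - q * r = 1" using assms(1) by (simp add: G e(1))
  ultimately show False using s by (simp only: e(2)) simp
qed

lemma act_conj_fixed:
  assumes "det P = 1" "det h = 1" "v \<in> carrier V"
  shows "act (P ** h ** adj2 P) (act P v) = act P v \<longleftrightarrow> act h v = v"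
  using Stab_act[OF assms(1,3), of "P ** h ** adj2 P"] det_conj(2)[OF assms(1), of h] assms(2)
  by (simp add: Stab_def conj_cancel assms(1))

lemma card_W1_fixed:
  assumes "det h = 1" "trace h = s"
  shows "card (W1_fixed h) = card (W1_fixed (comp2 s))"
proof -
  obtain P where P: "det P = 1" "h ** P = P ** comp2 s"
    using conjugate_comp2[OF assms(1)] assms(2) s by auto
  have h: "h = P ** comp2 s ** adj2 P"
    by (metis P adj2_inverse(1) matrix_mul_assoc matrix_mul_rid)
  show ?thesis
  proof (rule card_act_image[OF P(1), symmetric])
    fix v assume v: "v \<in> carrier V"
    show "act P v \<in> W1_fixed h \<longleftrightarrow> v \<in> W1_fixed (comp2 s)"
      using act_conj_fixed[OF P(1) _ v, of "comp2 s"] W1_act_iff[OF P(1) v]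
      by (simp add: W1_fixed_def h comp2_def)
  qed (use W_subset in \<open>auto simp: W1_fixed_def\<close>)
qed

lemma card_W1:
  "2 * card W1 = card {h :: 'f ^ 2 ^ 2. det h = 1 \<and> trace h = s} * card (W1_fixed (comp2 s))"
proof -
  let ?C = "{h :: 'f ^ 2 ^ 2. det h = 1 \<and> trace h = s}"
  have "(\<Sum>h\<in>?C. card {v \<in> W1. act h v = v}) = 2 * card W1"
  proof (rule sum_multicount)
    show "\<forall>v\<in>W1. card {h \<in> ?C. act h v = v} = 2"
    proof
      fix v assume "v \<in> W1"
      from W1_typeI[OF this] obtain g where g: "g \<in> Stab v" "trace g = s" "v \<in> carrier V"
        "\<forall>h\<in>Stab v. trace h = s \<longrightarrow> h = g \<or> h = adj2 g"
        unfolding typeI_def by (elim conjE bexE)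
      have "{h \<in> ?C. act h v = v} = {h \<in> Stab v. trace h = s}" by (auto simp: Stab_def)
      also have "\<dots> = {g, adj2 g}" using g Stab_subgroup(2) by auto
      finally show "card {h \<in> ?C. act h v = v} = 2"
        using trace_adj_neq[of g] g by (simp add: Stab_def card_insert_if)
    qed
  qed (simp_all add: finite_W)
  then show ?thesis using card_W1_fixed by (simp add: W1_fixed_def)
qed

lemma card_carrier: "card (carrier V) = 1 + card W1 + card W2"
proof -
  have "carrier V = insert \<one> (W1 \<union> W2)" by (auto simp: W1_def W2_def)
  moreover have "card (insert \<one> (W1 \<union> W2)) = Suc (card (W1 \<union> W2))"
    using finite_W by (intro card_insert_disjoint) (auto simp: W1_def W2_def)
  moreover have "card (W1 \<union> W2) = card W1 + card W2"
    using finite_W by (intro card_Un_disjoint) (auto simp: W1_def W2_def)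
  ultimately show ?thesis by simp
qed

lemma W1_nonempty: "W1 \<noteq> {}"
proof -
  obtain v where v: "v \<noteq> \<one>" "typeI s v" using exI by blast
  then have vc: "v \<in> carrier V" by (simp add: typeI_def)
  then have "\<not> typeII v" using v typeII_iff Fix_unip_not_typeI by blast
  then show ?thesis using v vc by (auto simp: W1_def)
qed

lemma card_W1_fixed_pos: "card (W1_fixed (comp2 s)) > 0"
proof -
  have "card W1 > 0" using W1_nonempty finite_W by (simp add: card_gt_0_iff)
  then have "2 * card W1 \<noteq> 0" by simp
  then show ?thesis unfolding card_W1 by simp
qed

lemma subgroup_card_power:
  assumes "subgroup H V"
  obtains k where "card H = t ^ k" "k \<le> n"
proof -
  have "card H dvd t ^ n"
    using lagrange[OF assms] card_V by (metis dvd_triv_right order_def)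
  then show ?thesis using prime_t divides_primepow_nat that by blast
qed

lemma card_F0:
  obtains b where "card F0 = t ^ b" "b < n"
proof -
  obtain b where b: "card F0 = t ^ b" "b \<le> n" using subgroup_card_power subgroup_Fix_unip by blast
  have "b \<noteq> n"
  proof
    assume "b = n"
    then have "F0 = carrier V" using b card_V finite_carrier
      by (intro card_subset_eq) (auto simp: Fix_def)
    moreover obtain w where "w \<in> W1" using W1_nonempty by blast
    ultimately have "w \<in> F0" "w \<in> carrier V" "w \<noteq> \<one>" "\<not> typeII w" by (auto
        simp: W1_def)
    moreover have "vec2 1 0 \<noteq> (0 :: 'f ^ 2)" by simp
    ultimately show False using typeII_iff by blast
  qed
  then show ?thesis using b that by simp
qed

lemma master_equation:
  "2 * (int t ^ n - 1) = 2 * (int CARD('f) + 1) * (int (card F0) - 1) +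
    int (card {h :: 'f ^ 2 ^ 2. det h = 1 \<and> trace h = s}) * int (card (W1_fixed (comp2 s)))"
proof -
  have F: "card F0 \<ge> 1" using card_F0 prime_t by (metis One_nat_def Suc_leI prime_gt_0_nat
      zero_less_power)
  have "int t ^ n = 1 + int (card W1) + int (card W2)"
    using card_carrier card_V by (metis of_nat_1 of_nat_add of_nat_power)
  moreover have "int (card W2) = (int CARD('f) + 1) * (int (card F0) - 1)"
  proof -
    have "int (card F0 - 1) = int (card F0) - 1" using F by simp
    then show ?thesis by (simp only: card_W2 of_nat_mult of_nat_add of_nat_1)
  qed
  moreover have "2 * int (card W1) =
      int (card {h :: 'f ^ 2 ^ 2. det h = 1 \<and> trace h = s}) * int (card (W1_fixed (comp2 s)))"
    using arg_cong[OF card_W1, of int] by simp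
  ultimately show ?thesis by simp
qed

text \<open>An element without eigenvalue in the field preserves no line, hence fixes no point of
  the second kind. Its nontrivial fixed points all lie in \<open>W1\<close>, so they number
  \<open>t ^ c - 1\<close>, and the counting equation becomes the unsolvable one.\<close>

lemma hyperbolic: "\<exists>x. x * (s - x) = 1"
proof (rule ccontr)
  assume ell: "\<nexists>x. x * (s - x) = 1"
  let ?h = "comp2 s"
  have h: "det ?h = 1" "trace ?h = s" by (simp_all add: comp2_def)
  have "W1_fixed ?h = Fix {?h} - {\<one>}"
  proof -
    have "\<not> typeII v" if "act ?h v = v" for v
    proof
      assume "typeII v"
      then obtain e where e: "e \<noteq> 0" "\<forall>A\<in>Stab v. cross e (A *v e) = 0" by (auto
          simp: typeII_def)
      then have "cross e (?h *v e) = 0" using that h by (simp add: Stab_def)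
      then obtain c where "?h *v e = c *s e" using e(1) by (auto simp: cross_eq_0_iff)
      then show False using eigenvalue_equation[of ?h e c] e(1) ell h by auto
    qed
    then show ?thesis by (auto simp: W1_fixed_def Fix_def W1_def)
  qed
  moreover have sub: "subgroup (Fix {?h}) V" by (rule subgroup_Fix) (use h in auto)
  moreover obtain c where c: "card (Fix {?h}) = t ^ c" using sub subgroup_card_power by blast
  ultimately have m: "card (W1_fixed ?h) = t ^ c - 1"
    by (simp add: card_Diff_singleton subgroup.one_closed)
  then have "c \<noteq> 0" using card_W1_fixed_pos by (intro notI) simp
  then have "c \<ge> 1" by simp
  obtain b where b: "card F0 = t ^ b" "b < n" by (rule card_F0)
  have tc: "t ^ c \<ge> 1" using prime_t by (simp add: prime_gt_0_nat Suc_leI)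
  have "2 * (int t ^ n - 1) = 2 * (int (t ^ a) + 1) * (int t ^ b - 1)
      + int (t ^ a) * (int (t ^ a) - 1) * (int t ^ c - 1)"
    using master_equation card_trace_class[OF s] ell card_f_ge tc
    by (simp add: b m card_f of_nat_diff)
  then show False
    using no_elliptic_solution[where t = t and a = a, OF prime_t _ \<open>c \<ge> 1\<close> b(2)]
        card_f card_f_ge by simp
qed

section \<open>Fixed points of the diagonal torus\<close>

lemma diag2_mult_vec: "diag2 l *v vec2 1 0 = l *s vec2 1 0" "diag2 l *v vec2 0 1 = inverse l *s
    vec2 0 1"
  by (simp_all add: diag2_def)

lemma swap_Fix:
  assumes "l \<noteq> 0" and v: "v \<in> carrier V"
  shows "act (mat2 0 (- 1) 1 0) v \<in> Fix (unip (vec2 0 1)) \<inter> Fix {diag2 l}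
      \<longleftrightarrow> v \<in> F0 \<inter> Fix {diag2 l}"
proof -
  \<comment> \<open>The Weyl element: it exchanges the two coordinate lines and inverts the
    torus.\<close>
  let ?w = "mat2 0 (- 1) 1 (0::'f)"
  have w: "det ?w = 1" "?w *v vec2 1 0 = vec2 0 1" by simp_all
  have "?w ** adj2 (diag2 l) ** adj2 ?w = diag2 l" by (simp add: diag2_def)
  then have "act (diag2 l) (act ?w v) = act ?w v \<longleftrightarrow> act (adj2 (diag2 l)) v = v"
    using act_conj_fixed[OF w(1) _ v, of "adj2 (diag2 l)"] assms(1) by simp
  also have "\<dots> \<longleftrightarrow> act (diag2 l) v = v"
    using assms by (metis act_adj2 det_diag2)
  finally have "act ?w v \<in> Fix {diag2 l} \<longleftrightarrow> v \<in> Fix {diag2 l}"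
    using w v by (simp add: Fix_def)
  moreover have "act ?w v \<in> Fix (unip (vec2 0 1)) \<longleftrightarrow> v \<in> F0"
    using Fix_unip_act[OF w(1) v, of "vec2 1 0"] w(2) by simp
  ultimately show ?thesis by blast
qed

lemma card_swap:
  assumes "l \<noteq> 0"
  shows "card (Fix (unip (vec2 0 1)) \<inter> Fix {diag2 l}) = card (F0 \<inter> Fix {diag2 l})"
  by (rule card_act_image[of "mat2 0 (- 1) 1 0", symmetric])
     (use swap_Fix[OF assms] in \<open>auto simp: Fix_def\<close>)

text \<open>A diagonal matrix with distinct eigenvalues preserves only the two coordinate lines, so
  its fixed points of the second kind lie in \<open>F0\<close> or in the opposite group. Both parts
  have the same size by the Weyl element and share exactly the identity, whence the
  \<open>+ 1\<close>.\<close>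

lemma card_Fix_diag2:
  assumes "l \<noteq> 0" "l \<noteq> inverse l"
  shows "card (Fix {diag2 l}) + 1 = card (W1_fixed (diag2 l)) + 2 * card (F0 \<inter> Fix {diag2 l})"
proof -
  let ?g = "diag2 l"
  let ?A = "F0 \<inter> Fix {?g}" and ?B = "Fix (unip (vec2 0 1)) \<inter> Fix {?g}"
  have g: "det ?g = 1" using assms by simp
  have split: "Fix {?g} = insert \<one> (W1_fixed ?g \<union> ((?A - {\<one>}) \<union> (?B -
      {\<one>})))"
  proof -
    have "v \<in> F0 \<or> v \<in> Fix (unip (vec2 0 1))"
      if v: "v \<in> carrier V" "v \<noteq> \<one>" "typeII v" "act ?g v = v" for v
    proof -
      obtain e where e: "e \<noteq> 0" "unip e \<subseteq> Stab v" "\<And>A. A \<in> Stab v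
          \<Longrightarrow> cross e (A *v e) = 0"
        using v by (auto simp: typeII_def)
      obtain x y where xy: "e = vec2 x y" by (rule vec2_cases)
      have "cross e (?g *v e) = 0" using e(3) v g by (simp add: Stab_def)
      then have "x * y * (inverse l - l) = 0" by (simp add: xy diag2_def algebra_simps)
      then have "x = 0 \<or> y = 0" using assms by auto
      then have "cross e (vec2 1 0) = 0 \<or> cross e (vec2 0 1) = 0" by (auto simp: xy)
      then show ?thesis using typeII_Fix[OF e _ v(1)] by auto
    qed
    then show ?thesis using g by (auto simp: W1_fixed_def W1_def Fix_def)
  qed
  have disj: "?A \<inter> ?B = {\<one>}"
    using Fix_unip_Int[of "vec2 1 0" "vec2 0 1"] g by (auto simp: Fix_def)
  have fin: "finite ?A" "finite ?B" "finite (W1_fixed ?g)"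
    using finite_Fix finite_W by (auto simp: W1_fixed_def)
  have one: "\<one> \<in> ?A" "\<one> \<in> ?B" using disj by auto
  have W: "W1_fixed ?g \<inter> (?A \<union> ?B) = {}" "\<one> \<notin> W1_fixed ?g"
    using typeII_iff by (auto simp: W1_fixed_def W1_def) (metis vec2_eq_0_iff zero_neq_one)+
  have "card ((?A - {\<one>}) \<union> (?B - {\<one>})) = card (?A - {\<one>}) + card (?B - {\<one>})"
    using fin disj by (intro card_Un_disjoint) auto
  also have "\<dots> = (card ?A - 1) + (card ?A - 1)"
    using card_swap[OF assms(1)] one by (simp add: card_Diff_singleton)
  finally have 1: "card ((?A - {\<one>}) \<union> (?B - {\<one>})) = (card ?A - 1) + (card ?A - 1)" .
  have "card (W1_fixed ?g \<union> ((?A - {\<one>}) \<union> (?B - {\<one>}))) =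
      card (W1_fixed ?g) + card ((?A - {\<one>}) \<union> (?B - {\<one>}))"
    using fin W by (intro card_Un_disjoint) auto
  moreover have "card (insert \<one> (W1_fixed ?g \<union> ((?A - {\<one>}) \<union> (?B -
      {\<one>})))) =
      Suc (card (W1_fixed ?g \<union> ((?A - {\<one>}) \<union> (?B - {\<one>}))))"
    using fin W by (intro card_insert_disjoint) auto
  moreover have "card ?A > 0" using fin one by (auto simp: card_gt_0_iff)
  ultimately show ?thesis using 1 unfolding split[symmetric] by linarith
qed

lemma obtain_hyperbolic:
  obtains l where "l \<noteq> 0" "l \<noteq> inverse l" "trace (diag2 l) = s"
proof -
  obtain l where l: "l * (s - l) = 1" using hyperbolic by blast
  then have l0: "l \<noteq> 0" by auto
  then have il: "inverse l = s - l" using l by (metis inverse_unique)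
  then have tr: "trace (diag2 l) = s" by (simp add: diag2_def)
  have "l \<noteq> inverse l"
  proof
    assume *: "l = inverse l"
    have "s = inverse l + l" using il by simp
    then have "s = l + l" using * by metis
    moreover have "l * l = 1" using * l0 by (metis right_inverse)
    ultimately show False using s by (simp add: algebra_simps)
  qed
  then show ?thesis using that l0 tr by blast
qed

lemma parameters:
  "t = 2 \<and> 2 * card F0 = CARD('f) \<and> card (W1_fixed (comp2 s)) = 1"
proof -
  obtain l where l: "l \<noteq> 0" "l \<noteq> inverse l" "trace (diag2 l) = s" by (rule
      obtain_hyperbolic)
  let ?g = "diag2 l"
  have g: "det ?g = 1" using l by simp
  obtain b where b: "card F0 = t ^ b" "b < n" by (rule card_F0)
  have sub: "subgroup (Fix {?g}) V" by (rule subgroup_Fix) (use g in auto)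
  obtain c where c: "card (Fix {?g}) = t ^ c" using sub subgroup_card_power by blast
  have sub2: "subgroup (F0 \<inter> Fix {?g}) V"
    using sub subgroup_Fix_unip by (rule subgroups_Inter_pair[rotated])
  obtain d where d: "card (F0 \<inter> Fix {?g}) = t ^ d" using sub2 subgroup_card_power by blast
  have t2: "t \<ge> 2" using prime_t by (rule prime_ge_2_nat)
  have "card (F0 \<inter> Fix {?g}) \<le> card F0" by (intro card_mono finite_Fix) auto
  then have db: "d \<le> b" using t2 by (simp add: b d)
  define m where "m = card (W1_fixed (comp2 s))"
  have m: "t ^ c + 1 = m + 2 * t ^ d"
    using card_Fix_diag2[OF l(1,2)] card_W1_fixed[OF g l(3)] by (simp add: c d m_def)
  have "m > 0" using card_W1_fixed_pos by (simp add: m_def)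
  moreover have "t ^ d \<ge> 1" using t2 by simp
  ultimately have "t ^ d < t ^ c" using m by linarith
  then have dc: "d < c" using t2 by (simp add: power_strict_increasing_iff)
  have "int (t ^ c + 1) = int (m + 2 * t ^ d)" unfolding m ..
  then have "int t ^ c + 1 = int m + 2 * int t ^ d" by simp
  then have mi: "int m = int t ^ c - 2 * int t ^ d + 1" by linarith
  have C: "card {h :: 'f ^ 2 ^ 2. det h = 1 \<and> trace h = s} = t ^ a * (t ^ a + 1)"
    by (simp only: card_trace_class[OF s] hyperbolic if_True card_f)
  have eq: "2 * (int t ^ n - 1) = 2 * (int (t ^ a) + 1) * (int t ^ b - 1)
      + int (t ^ a) * (int (t ^ a) + 1) * (int t ^ c - 2 * int t ^ d + 1)"
    using master_equation
    by (simp only: C m_def[symmetric] b card_f mi[symmetric] of_nat_mult of_nat_add of_nat_1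
        of_nat_power)
  have q4: "t ^ a \<ge> 4" using card_f card_f_ge by simp
  have t: "t = 2"
    by (rule hyperbolic_solution_even[OF prime_t q4 b(2) db dc eq])
  have "b = a - 1 \<and> c = Suc d \<and> n = 2 * a"
  proof (rule hyperbolic_solution_2[OF _ b(2) db dc])
    show "4 \<le> (2::int) ^ a" using q4 unfolding t by (metis of_nat_le_iff of_nat_numeral
        of_nat_power)
    show "2 * ((2::int) ^ n - 1) =
      2 * (2 ^ a + 1) * (2 ^ b - 1) + 2 ^ a * (2 ^ a + 1) * (2 ^ c - 2 * 2 ^ d + 1)"
      using eq unfolding t by simp
  qed
  moreover obtain a' where "a = Suc a'" using q4 by (cases a) auto
  ultimately have "2 * card F0 = CARD('f)" "t ^ c = 2 * t ^ d"
    by (simp_all add: b card_f t)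
  then show ?thesis using t m by (simp add: m_def)
qed

end

section \<open>Reduction to the field with four elements\<close>

context sl2_two_types
begin

lemma char_2: "(2::'f) = 0"
  using char_2_if_card_power_2[of a] card_f parameters by simp

lemma neq_inverse: "k \<noteq> 0 \<Longrightarrow> k \<noteq> 1 \<Longrightarrow> k \<noteq>
    inverse (k::'f)"
proof
  assume k: "k \<noteq> 0" "k \<noteq> 1" "k = inverse k"
  then have "k * k = 1" by (metis right_inverse)
  moreover have "(k - 1) * (k - 1) = (k * k - 1) - 2 * (k - 1)" by (simp add: algebra_simps)
  ultimately have "(k - 1) * (k - 1) = 0" using char_2 by simp
  then show False using k by simp
qed

text \<open>All nontrivial torus elements share one fixed point of the first kind. One inclusion
  comes from commutativity of the torus. For the other, a \<open>diag2 k\<close> fixing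
  \<open>v\<close> permutes the pair \<open>g\<close>, \<open>adj2 g\<close> attached to
  \<open>v\<close>, which forces \<open>g\<close> to be diagonal.\<close>

lemma W1_fixed_diag2:
  obtains l v0 where "l \<noteq> 0" "trace (diag2 l) = s"
    "\<forall>k. k \<noteq> 0 \<longrightarrow> k \<noteq> 1 \<longrightarrow> W1_fixed (diag2 k) =
        {v0}" "W1_fixed (diag2 l) = {v0}"
proof -
  obtain l where l: "l \<noteq> 0" "l \<noteq> inverse l" "trace (diag2 l) = s" by (rule
      obtain_hyperbolic)
  have "card (W1_fixed (diag2 l)) = 1" using card_W1_fixed[of "diag2 l"] l parameters by simp
  then obtain v0 where v0: "W1_fixed (diag2 l) = {v0}" by (auto simp: card_1_singleton_iff)
  then have v0': "v0 \<in> W1" "act (diag2 l) v0 = v0" "v0 \<in> carrier V"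
    using W_subset by (auto simp: W1_fixed_def)
  have "W1_fixed (diag2 k) = {v0}" if k: "k \<noteq> 0" "k \<noteq> 1" for k
  proof -
    have "act (diag2 l) (act (diag2 k) v0) = act (diag2 k) (act (diag2 l) v0)"
      using act_mult[of "diag2 l" "diag2 k" v0] act_mult[of "diag2 k" "diag2 l" v0]
        l k v0' by (simp add: diag2_commute)
    then have "act (diag2 k) v0 \<in> W1_fixed (diag2 l)"
      using v0' W1_act_iff[of "diag2 k" v0] k by (simp add: W1_fixed_def)
    then have "act (diag2 k) v0 = v0" using v0 by simp
    moreover have "v = v0" if v: "v \<in> W1" "act (diag2 k) v = v" for v
    proof -
      have vc: "v \<in> carrier V" using v W_subset by blast
      from W1_typeI[OF v(1)] obtain g where g: "g \<in> Stab v" "trace g = s"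
        "\<forall>h\<in>Stab v. trace h = s \<longrightarrow> h = g \<or> h = adj2 g"
        unfolding typeI_def by (elim conjE bexE)
      obtain p q r w where G: "g = mat2 p q r w" by (rule mat2_cases)
      have det: "p * w - q * r = 1" using g(1) by (simp add: Stab_def G)
      have tr: "p + w = s" using g(2) by (simp add: G)
      have ks: "diag2 k \<in> Stab v" using v k by (simp add: Stab_def)
      have "diag2 k ** g ** adj2 (diag2 k) \<in> Stab v"
        using Stab_subgroup[OF vc] ks g(1) by blast
      moreover have "trace (diag2 k ** g ** adj2 (diag2 k)) = s"
        using g(2) k by (simp add: trace_conj)
      ultimately have "diag2 k ** g ** adj2 (diag2 k) = g \<or> diag2 k ** g ** adj2 (diag2 k) =
          adj2 g"
        using g(3) by blast
      moreover have "diag2 k ** g ** adj2 (diag2 k) = mat2 p (k * k * q) (inverse k * inverse k *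
          r) w"
        using k by (simp add: G diag2_def algebra_simps)
      \<comment> \<open>Equality with \<open>adj2 g\<close> would give \<open>p = w\<close>, so
        \<open>s = 2 * p = 0\<close>, against \<open>s * s \<noteq> 4\<close> in characteristic
        2.\<close>
      ultimately consider "k * k * q = q" "inverse k * inverse k * r = r" | "p = w"
        by (auto simp: G)
      then show ?thesis
      proof cases
        case 1
        have kk: "k * k \<noteq> 1" using neq_inverse[OF k] k(1) by (metis inverse_unique)
        then have "q = 0" using 1(1) by simp
        have "inverse k * inverse k \<noteq> 1" using kk k(1) by (metis inverse_1 inverse_eq_iff_eq
            inverse_mult_distrib)
        then have "r = 0" using 1(2) by simp
        have pw: "p * w = 1" using det \<open>q = 0\<close> by simp
        have "l + inverse l = p + w" using l(3) tr by (simp add: diag2_def)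
        \<comment> \<open>Trace and determinant of \<open>g\<close> and \<open>diag2 l\<close>
          agree, so \<open>p\<close> is a root of the quadratic with roots \<open>l\<close> and
          \<open>inverse l\<close>.\<close>
        then have "(p - l) * (p - inverse l) = 0"
        proof -
          have "(p - l) * (p - inverse l) = p * p - p * (l + inverse l) + l * inverse l"
            by (simp add: algebra_simps)
          also have "\<dots> = p * p - p * (p + w) + l * inverse l"
            by (simp only: \<open>l + inverse l = p + w\<close>)
          also have "\<dots> = 0" using pw l(1) by (simp add: algebra_simps)
          finally show ?thesis .
        qed
        moreover have "w = inverse p" using pw by (metis inverse_unique)
        ultimately have "g = diag2 l \<or> g = adj2 (diag2 l)"
          using \<open>q = 0\<close> \<open>r = 0\<close> by (auto simp: G diag2_def)
        then have "diag2 l \<in> Stab v" using g(1) Stab_subgroup(2)[OF vc] by (metis adj2_adj2)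
        then have "v \<in> W1_fixed (diag2 l)" using v by (simp add: W1_fixed_def Stab_def)
        then show ?thesis using v0 by simp
      next
        case 2
        then have "s = 2 * p" using tr by simp
        moreover have "(4::'f) = 2 * 2" by simp
        ultimately show ?thesis using s char_2 by (metis mult_zero_left)
      qed
    qed
    ultimately have "v \<in> W1_fixed (diag2 k) \<longleftrightarrow> v = v0" for v
      unfolding W1_fixed_def mem_Collect_eq using v0'(1) by metis
    then show ?thesis by blast
  qed
  then have "\<forall>k. k \<noteq> 0 \<longrightarrow> k \<noteq> 1 \<longrightarrow> W1_fixed
      (diag2 k) = {v0}" by simp
  then show ?thesis by (rule that[OF l(1,3) _ v0])
qed

lemma card_Fix_diag2_eq:
  assumes "k \<noteq> 0" "k \<noteq> 1"
  shows "card (Fix {diag2 k}) = 2 * card (F0 \<inter> Fix {diag2 k})"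
proof -
  obtain v0 where "\<forall>k. k \<noteq> 0 \<longrightarrow> k \<noteq> 1 \<longrightarrow>
      W1_fixed (diag2 k) = {v0}"
    by (rule W1_fixed_diag2) (rule that)
  then have "card (W1_fixed (diag2 k)) = 1" using assms by simp
  then show ?thesis using card_Fix_diag2[OF assms(1) neq_inverse[OF assms]] by simp
qed

text \<open>The two factors \<open>F0\<close> and its opposite meet trivially, so products of their
    fixed points
  are distinct fixed points.\<close>

lemma card_F0_fixed_le:
  assumes "k \<noteq> 0" "k \<noteq> 1"
  shows "card (F0 \<inter> Fix {diag2 k}) \<le> 2"
proof -
  let ?A = "F0 \<inter> Fix {diag2 k}" and ?B = "Fix (unip (vec2 0 1)) \<inter> Fix {diag2 k}"
  have g: "det (diag2 k) = 1" using assms by simp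
  have subs: "subgroup F0 V" "subgroup (Fix (unip (vec2 0 1))) V" "subgroup (Fix {diag2 k}) V"
    using subgroup_Fix_unip subgroup_Fix[of "{diag2 k}"] g by auto
  have inj: "inj_on (\<lambda>(x, y). x \<otimes> y) (?A \<times> ?B)"
  proof (rule inj_onI, clarify)
    fix x y x' y' assume x: "x \<in> F0" "x' \<in> F0" and y: "y \<in> Fix (unip (vec2 0 1))" "y'
        \<in> Fix (unip (vec2 0 1))"
      and e: "x \<otimes> y = x' \<otimes> y'"
    have c: "x \<in> carrier V" "x' \<in> carrier V" "y \<in> carrier V" "y' \<in> carrier V"
      using x y by (auto simp: Fix_def)
    have "inv x' \<otimes> x = y' \<otimes> inv y"
      using e c by (metis inv_closed inv_solve_left inv_solve_right m_assoc m_closed)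
    moreover have "inv x' \<otimes> x \<in> F0" "y' \<otimes> inv y \<in> Fix (unip (vec2 0 1))"
      using x y subs by (simp_all add: subgroup.m_closed subgroup.m_inv_closed)
    ultimately have "inv x' \<otimes> x \<in> F0 \<inter> Fix (unip (vec2 0 1))" by simp
    then have "inv x' \<otimes> x = \<one>" using Fix_unip_Int[of "vec2 1 0" "vec2 0 1"] by simp
    then have "x = x'" using c by (metis inv_closed inv_equality inv_inv)
    then show "x = x' \<and> y = y'" using e c by simp
  qed
  have "(\<lambda>(x, y). x \<otimes> y) ` (?A \<times> ?B) \<subseteq> Fix {diag2 k}"
    using subs(3) by (auto simp: subgroup.m_closed)
  then have "card (?A \<times> ?B) \<le> card (Fix {diag2 k})"
    using inj finite_Fix by (metis card_image card_mono)
  then have "card ?A * card ?A \<le> 2 * card ?A"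
    using card_swap[OF assms(1)] card_Fix_diag2_eq[OF assms] by (simp add: card_cartesian_product)
  moreover have "\<one> \<in> ?A" using subs subgroup.one_closed by blast
  then have "card ?A > 0" using finite_Fix by (auto simp: card_gt_0_iff)
  ultimately show ?thesis by simp
qed

lemma act_diag2_F0:
  assumes "k \<noteq> 0" "v \<in> F0"
  shows "act (diag2 k) v \<in> F0"
  using Fix_unip_act[of "diag2 k" v "vec2 1 0"] assms unip_smult[OF assms(1), of "vec2 1 0"]
  by (simp add: diag2_mult_vec Fix_def del: smult_vec2)

text \<open>The torus has \<open>q - 1\<close> elements and \<open>F0\<close> only
  \<open>q / 2\<close>, so some \<open>diag2 l\<close> with \<open>l \<noteq> 1\<close> fixes
  \<open>w\<close>. Its fixed points in \<open>F0\<close> are then exactly the identity and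
  \<open>w\<close>, and the commutative torus preserves this set.\<close>

lemma F0_fixed:
  assumes w: "w \<in> F0" "k \<noteq> 0"
  shows "act (diag2 k) w = w"
proof (cases "w = \<one>")
  case False
  have wc: "w \<in> carrier V" using w by (simp add: Fix_def)
  have "\<exists>l. l \<noteq> 0 \<and> l \<noteq> 1 \<and> act (diag2 l) w = w"
  proof (rule ccontr)
    assume no: "\<nexists>l. l \<noteq> 0 \<and> l \<noteq> 1 \<and> act (diag2 l) w = w"
    have "inj_on (\<lambda>l. act (diag2 l) w) (UNIV - {0})"
    proof (rule inj_onI)
      fix x y assume xy: "x \<in> UNIV - {0}" "y \<in> UNIV - {0}" "act (diag2 x) w = act (diag2 y) w"
      have d: "det (diag2 (inverse y)) = 1" using xy by simp
      have "act (diag2 (inverse y)) (act (diag2 x) w) = act (diag2 (inverse y)) (act (diag2 y) w)"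
        using xy by simp
      then have "act (diag2 (inverse y) ** diag2 x) w = act (diag2 (inverse y) ** diag2 y) w"
        using xy act_mult[OF d _ wc] by simp
      then have "act (diag2 (inverse y * x)) w = act (diag2 (inverse y * y)) w"
        unfolding diag2_mult .
      moreover have "diag2 (inverse y * y) = mat 1" using xy by (simp add: diag2_def mat_1_eq)
      ultimately have "act (diag2 (inverse y * x)) w = w" using wc by simp
      then have "inverse y * x = 1" using no xy by (metis DiffD2 inverse_nonzero_iff_nonzero
          mult_eq_0_iff singletonI)
      then show "x = y" using xy by (simp add: field_simps)
    qed
    then have "card ((\<lambda>l. act (diag2 l) w) ` (UNIV - {0})) = CARD('f) - 1"
      by (simp add: card_image card_Diff_singleton)
    moreover have "(\<lambda>l. act (diag2 l) w) ` (UNIV - {0}) \<subseteq> F0"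
      using act_diag2_F0 w(1) by auto
    ultimately have "CARD('f) - 1 \<le> card F0" using finite_Fix by (metis card_mono)
    then show False using parameters card_f_ge by linarith
  qed
  then obtain l where l: "l \<noteq> 0" "l \<noteq> 1" "act (diag2 l) w = w" by blast
  let ?A = "F0 \<inter> Fix {diag2 l}"
  have "{\<one>, w} \<subseteq> ?A" using w l wc by (auto simp: Fix_def unip_det)
  moreover have "card ?A \<le> card {\<one>, w}" using card_F0_fixed_le[OF l(1,2)] False by simp
  ultimately have A: "{\<one>, w} = ?A" using finite_Fix by (intro card_seteq) auto
  have "act (diag2 l) (act (diag2 k) w) = act (diag2 k) (act (diag2 l) w)"
    using act_mult[of "diag2 l" "diag2 k" w] act_mult[of "diag2 k" "diag2 l" w] l w wc
    by (simp add: diag2_commute)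
  then have "act (diag2 k) w \<in> ?A" using act_diag2_F0 w l wc by (simp add: Fix_def)
  then have "act (diag2 k) w \<in> {\<one>, w}" using A by simp
  then show ?thesis using False act_eq_one_iff w(2) wc by auto
qed (use assms in simp)

lemma card_f_eq: "CARD('f) = 4" and card_F0_eq: "card F0 = 2"
proof -
  have "\<exists>k. k \<noteq> 0 \<and> k \<noteq> (1::'f)"
  proof (rule ccontr)
    assume "\<nexists>k. k \<noteq> 0 \<and> k \<noteq> (1::'f)"
    then have "(UNIV :: 'f set) \<subseteq> {0, 1}" by blast
    then have "CARD('f) \<le> card {0, 1::'f}" by (intro card_mono) auto
    then show False using card_f_ge by simp
  qed
  then obtain k :: 'f where k: "k \<noteq> 0" "k \<noteq> 1" by blast
  have "F0 \<inter> Fix {diag2 k} = F0" using F0_fixed k by (auto simp: Fix_def)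
  then have "card F0 \<le> 2" using card_F0_fixed_le[OF k] by simp
  then show "CARD('f) = 4" "card F0 = 2" using parameters card_f_ge by linarith+
qed

lemma card_W2_eq: "card W2 = 5"
  using card_W2 by (simp add: card_f_eq card_F0_eq)

section \<open>The five involutions and their products\<close>

lemma Fix_unip_pair:
  assumes "e \<noteq> 0"
  obtains x where "Fix (unip e) = {\<one>, x}" "x \<in> W2"
proof -
  have "card (Fix (unip e)) = 2" using card_Fix_unip[OF assms] card_F0_eq by simp
  moreover have "\<one> \<in> Fix (unip e)" by (simp add: one_in_Fix unip_det)
  ultimately obtain x where x: "Fix (unip e) = {\<one>, x}" "x \<noteq> \<one>"
    by (auto simp: card_2_iff doubleton_eq_iff)
  then have "x \<in> Fix (unip e)" by simp
  then have "x \<in> W2" using x assms typeII_iff by (auto simp: W2_def Fix_def)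
  then show ?thesis using that x by blast
qed

lemma W2_line:
  assumes "x \<in> W2"
  obtains e where "e \<noteq> 0" "Fix (unip e) = {\<one>, x}"
proof -
  have x: "x \<in> carrier V" "x \<noteq> \<one>" using assms by (auto simp: W2_def)
  then obtain e where e: "e \<noteq> 0" "x \<in> Fix (unip e)" using assms typeII_iff by (auto
      simp: W2_def)
  then have "Fix (unip e) = {\<one>, x}" using Fix_unip_pair x by (metis insertE singletonD)
  then show ?thesis using that e by blast
qed

lemma W2_involution:
  assumes "x \<in> W2"
  shows "x \<otimes> x = \<one>"
proof -
  have x: "x \<in> carrier V" "x \<noteq> \<one>" using assms by (auto simp: W2_def)
  obtain e where e: "Fix (unip e) = {\<one>, x}" using assms by (rule W2_line)
  then have "x \<in> Fix (unip e)" by simp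
  then have "x \<otimes> x \<in> Fix (unip e)" by (intro subgroup.m_closed[OF subgroup_Fix_unip])
  then show ?thesis using e x by (auto simp: r_cancel_one)
qed

text \<open>The identity, the involutions of the two coordinate lines and the point
  \<open>v0\<close> of the first kind fill the fixed group of \<open>diag2 l\<close>, which has
  order 4. The product of the two involutions can then only be \<open>v0\<close>.\<close>

lemma W2_std:
  obtains x0 y0 v0 where "x0 \<in> W2" "y0 \<in> W2"
    "x0 \<otimes> y0 = v0" "y0 \<otimes> x0 = v0" "v0 \<in> W1"
    "\<exists>l. l \<noteq> 0 \<and> trace (diag2 l) = s \<and> W1_fixed (diag2 l) = {v0}"
proof -
  obtain l v0 where l: "l \<noteq> 0" "trace (diag2 l) = s" "W1_fixed (diag2 l) = {v0}"
    by (rule W1_fixed_diag2) (rule that)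
  obtain x where x: "F0 = {\<one>, x}" "x \<in> W2" by (rule Fix_unip_pair[of "vec2 1 0"]) auto
  obtain y where y: "Fix (unip (vec2 0 1)) = {\<one>, y}" "y \<in> W2" by (rule Fix_unip_pair[of
      "vec2 0 1"]) auto
  have c: "x \<in> carrier V" "y \<in> carrier V" "x \<noteq> \<one>" "y \<noteq> \<one>" using x y
      by (auto simp: W2_def)
  have "x \<noteq> y" using Fix_unip_Int[of "vec2 1 0" "vec2 0 1"] x y c by auto
  let ?g = "diag2 l"
  have g: "det ?g = 1" using l by simp
  have l1: "l \<noteq> 1"
  proof
    assume "l = 1"
    then have "s = 2" using l(2) by (simp add: diag2_def)
    then show False using s by simp
  qed
  have A: "F0 \<inter> Fix {?g} = F0" using F0_fixed l by (auto simp: Fix_def)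
  have "card (Fix (unip (vec2 0 1)) \<inter> Fix {?g}) = 2" using card_swap[OF l(1)] A card_F0_eq
      by simp
  moreover have "card (Fix (unip (vec2 0 1))) = 2" using y c by simp
  ultimately have "Fix (unip (vec2 0 1)) \<inter> Fix {?g} = Fix (unip (vec2 0 1))"
    using finite_Fix by (intro card_subset_eq) auto
  then have xy: "x \<in> Fix {?g}" "y \<in> Fix {?g}" using A x y by auto
  have v0: "v0 \<in> W1" "v0 \<in> Fix {?g}" using l(3) W_subset by (auto simp: W1_fixed_def Fix_def)
  then have v0': "v0 \<noteq> \<one>" "v0 \<noteq> x" "v0 \<noteq> y" using x y by (auto simp:
      W1_def W2_def)
  have sub: "subgroup (Fix {?g}) V" by (rule subgroup_Fix) (use g in auto)
  have "card (Fix {?g}) = 4" using card_Fix_diag2_eq[OF l(1) l1] A card_F0_eq by simp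
  moreover have "card {\<one>, x, y, v0} = 4" using c v0' \<open>x \<noteq> y\<close> by auto
  ultimately have F: "{\<one>, x, y, v0} = Fix {?g}"
    using xy v0 sub finite_Fix by (intro card_subset_eq) (auto simp: subgroup.one_closed)
  have prod: "u \<otimes> w = v0" if u: "u = x \<and> w = y \<or> u = y \<and> w = x" for u w
  proof -
    have "u \<otimes> w \<in> Fix {?g}" using u xy sub by (auto simp: subgroup.m_closed)
    then have "u \<otimes> w \<in> {\<one>, x, y, v0}" using F by simp
    moreover have "u \<in> carrier V" "w \<in> carrier V" "u \<noteq> \<one>" "w \<noteq> \<one>"
        "u \<noteq> w" using u c \<open>x \<noteq> y\<close> by auto
    moreover have "u \<otimes> u = \<one>" using u x y W2_involution by auto
    ultimately show ?thesis using u by (metis insertE l_cancel r_cancel_one' l_one one_closed r_one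
        singletonD l_cancel_one)
  qed
  have "x \<otimes> y = v0" "y \<otimes> x = v0" using prod by blast+
  then show ?thesis using that x y v0 l by blast
qed

lemma W2_line_transport:
  assumes "det P = 1" "P *v e = c *s e'" "c \<noteq> 0" "Fix (unip e) = {\<one>, x}" "Fix (unip e')
      = {\<one>, x'}"
    and "x \<in> W2"
  shows "act P x = x'"
proof -
  have x: "x \<in> carrier V" "x \<noteq> \<one>" using assms by (auto simp: W2_def)
  have "act P x \<in> Fix (unip e')"
    using Fix_unip_act[OF assms(1) x(1), of e] assms(2-4) by (simp add: unip_smult)
  moreover have "act P x \<noteq> \<one>" using act_eq_one_iff assms(1) x by simp
  ultimately show ?thesis using assms(5) by simp
qed

text \<open>The involutions correspond to lines, and SL2 is transitive on ordered pairs of distinct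
  lines.\<close>

lemma W2_pair_transitive:
  assumes "x \<in> W2" "y \<in> W2" "x \<noteq> y" "x' \<in> W2" "y' \<in> W2" "x' \<noteq> y'"
  obtains A where "det A = 1" "act A x = x'" "act A y = y'"
proof -
  have std: "\<exists>P. det P = 1 \<and> P *v vec2 1 0 = e \<and> (\<exists>c. c \<noteq> 0 \<and>
      P *v vec2 0 1 = c *s f)"
    if E: "Fix (unip e) = {\<one>, u}" "Fix (unip f) = {\<one>, w}" "e \<noteq> 0" "f \<noteq> 0"
        "u \<noteq> w" "u \<noteq> \<one>" for e f u w
  proof -
    have "cross e f \<noteq> 0"
    proof
      assume "cross e f = 0"
      then obtain k where k: "f = k *s e" using E(3) by (auto simp: cross_eq_0_iff)
      then have "k \<noteq> 0" using E(4) by auto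
      then have "Fix (unip f) = Fix (unip e)" by (simp add: k unip_smult)
      then show False using E by auto
    qed
    then show ?thesis using obtain_basis_change[of e f] by (metis inverse_nonzero_iff_nonzero)
  qed
  obtain e where e: "e \<noteq> 0" "Fix (unip e) = {\<one>, x}" using W2_line assms(1) .
  obtain f where f: "f \<noteq> 0" "Fix (unip f) = {\<one>, y}" using W2_line assms(2) .
  obtain e' where e': "e' \<noteq> 0" "Fix (unip e') = {\<one>, x'}" using W2_line assms(4) .
  obtain f' where f': "f' \<noteq> 0" "Fix (unip f') = {\<one>, y'}" using W2_line assms(5) .
  have ne: "x \<noteq> \<one>" "x' \<noteq> \<one>" using assms by (auto simp: W2_def)
  obtain P c where P: "det P = 1" "P *v vec2 1 0 = e" "c \<noteq> 0" "P *v vec2 0 1 = c *s f"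
    using std[OF e(2) f(2) e(1) f(1) assms(3) ne(1)] by blast
  obtain P' c' where P': "det P' = 1" "P' *v vec2 1 0 = e'" "c' \<noteq> 0" "P' *v vec2 0 1 = c' *s
      f'"
    using std[OF e'(2) f'(2) e'(1) f'(1) assms(6) ne(2)] by blast
  let ?A = "P' ** adj2 P"
  have A: "det ?A = 1" using P P' by (simp add: det_mul)
  have "adj2 P *v e = vec2 1 0" using adj2_mult_vec(1)[OF P(1)] P(2) by metis
  then have Ae: "?A *v e = 1 *s e'" using P' by (simp add: matrix_vector_mul_assoc[symmetric])
  have "f = inverse c *s (P *v vec2 0 1)" using P(3,4) by simp
  then have "adj2 P *v f = inverse c *s vec2 0 1"
    using adj2_mult_vec(1)[OF P(1)] by (simp add: vec.scale del: smult_vec2)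
  then have Af: "?A *v f = (inverse c * c') *s f'"
    using P'(4) by (simp add: matrix_vector_mul_assoc[symmetric] vec.scale del: smult_vec2)
  have "act ?A x = x'" by (rule W2_line_transport[OF A Ae _ e(2) e'(2) assms(1)]) simp
  moreover have "act ?A y = y'" by (rule W2_line_transport[OF A Af _ f(2) f'(2) assms(2)]) (use P
      P' in simp)
  ultimately show ?thesis using that A by blast
qed

lemma W2_product:
  assumes "x \<in> W2" "y \<in> W2" "x \<noteq> y"
  shows "x \<otimes> y \<in> W1" "x \<otimes> y = y \<otimes> x"
proof -
  obtain x0 y0 v0 where std: "x0 \<in> W2" "y0 \<in> W2" "x0 \<otimes> y0 = v0" "y0 \<otimes> x0 =
      v0" "v0 \<in> W1"
    by (rule W2_std) (rule that)
  have c0: "x0 \<in> carrier V" "y0 \<in> carrier V" using std by (auto simp: W2_def)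
  have "x0 \<noteq> y0" using std W2_involution by (auto simp: W1_def)
  then obtain P where P: "det P = 1" "act P x0 = x" "act P y0 = y"
    using W2_pair_transitive[OF std(1,2) _ assms] by blast
  have "x \<otimes> y = act P v0" "y \<otimes> x = act P v0"
    using act_hom[OF P(1)] c0 std P by metis+
  moreover have "act P v0 \<in> W1" using std P(1) W1_act_iff W_subset by blast
  ultimately show "x \<otimes> y \<in> W1" "x \<otimes> y = y \<otimes> x" by simp_all
qed

text \<open>Elements of trace \<open>s\<close> are conjugate and \<open>diag2 l\<close> fixes only
  \<open>v0\<close> in \<open>W1\<close>, so every point of \<open>W1\<close> is an image of
  \<open>v0\<close>, which is such a product.\<close>

lemma W1_as_product:
  assumes "v \<in> W1"
  shows "\<exists>x y. x \<in> W2 \<and> y \<in> W2 \<and> x \<noteq> y \<and> v = x \<otimes> y"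
proof -
  obtain x0 y0 v0 where std: "x0 \<in> W2" "y0 \<in> W2" "x0 \<otimes> y0 = v0" "v0 \<in> W1"
    "\<exists>l. l \<noteq> 0 \<and> trace (diag2 l) = s \<and> W1_fixed (diag2 l) = {v0}"
    by (rule W2_std) (rule that)
  then obtain l where l: "l \<noteq> 0" "trace (diag2 l) = s" "W1_fixed (diag2 l) = {v0}" by blast
  have vc: "v \<in> carrier V" using assms W_subset by blast
  from W1_typeI[OF assms] obtain g where g: "g \<in> Stab v" "trace g = s"
    unfolding typeI_def by blast
  have dg: "det g = 1" using g by (simp add: Stab_def)
  obtain P where P: "det P = 1" "g ** P = P ** comp2 s"
    using conjugate_comp2[OF dg] g(2) s by auto
  obtain P' where P': "det P' = 1" "diag2 l ** P' = P' ** comp2 s"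
    using conjugate_comp2[of "diag2 l"] l s by auto
  let ?Q = "P ** adj2 P'"
  have Q: "det ?Q = 1" using P P' by (simp add: det_mul)
  have g': "g = P ** comp2 s ** adj2 P"
    by (metis P adj2_inverse(1) matrix_mul_assoc matrix_mul_rid)
  have "comp2 s = adj2 P' ** diag2 l ** P'"
    by (metis P' adj2_inverse(2) matrix_mul_assoc matrix_mul_lid)
  then have "g = ?Q ** diag2 l ** adj2 ?Q" unfolding g' by (simp add: adj2_mult matrix_mul_assoc)
  then have "act (?Q ** diag2 l ** adj2 ?Q) v = v" using g(1) by (simp add: Stab_def)
  moreover define u where "u = act (adj2 ?Q) v"
  have u: "u \<in> carrier V" "act ?Q u = v" using vc Q by (simp_all add: u_def)
  ultimately have "act (diag2 l) u = u" using act_conj_fixed[OF Q _ u(1), of "diag2 l"] l u(2) by simp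
  moreover have "u \<in> W1" using u assms W1_act_iff[OF Q u(1)] by simp
  ultimately have "u = v0" using l(3) by (auto simp: W1_fixed_def)
  have c0: "x0 \<in> carrier V" "y0 \<in> carrier V" using std W_subset by auto
  have "v = act ?Q x0 \<otimes> act ?Q y0"
    using u \<open>u = v0\<close> std(3) act_hom[OF Q c0] by simp
  moreover have "act ?Q x0 \<in> W2" "act ?Q y0 \<in> W2" using std Q W2_act_iff c0 by blast+
  moreover have "act ?Q x0 \<noteq> act ?Q y0"
  proof
    assume "act ?Q x0 = act ?Q y0"
    then have "x0 = y0" using act_inj[OF Q c0] by simp
    then have "v0 = \<one>" using std W2_involution by metis
    then show False using std by (simp add: W1_def)
  qed
  ultimately show ?thesis by blast
qed

text \<open>Fixing all five involutions entails preserving all lines, so the matrix is scalar; a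
  scalar of determinant 1 is 1 in characteristic 2.\<close>

lemma faithful:
  assumes "det A = 1" "\<And>x. x \<in> W2 \<Longrightarrow> act A x = x"
  shows "A = mat 1"
proof -
  have line: "cross e (A *v e) = 0" if e: "e \<noteq> 0" for e
  proof -
    obtain x where x: "Fix (unip e) = {\<one>, x}" "x \<in> W2" using Fix_unip_pair[OF e] .
    have "x \<in> Fix (unip e)" "x \<noteq> \<one>" using x by (auto simp: W2_def)
    then show ?thesis using Stab_line[OF e] assms x by (simp add: Stab_def)
  qed
  obtain p q r w where A: "A = mat2 p q r w" by (rule mat2_cases)
  have "r = 0" using line[of "vec2 1 0"] by (simp add: A)
  moreover have "q = 0" using line[of "vec2 0 1"] by (simp add: A)
  ultimately have "w = p" using line[of "vec2 1 1"] by (simp add: A)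
  then have "p * p = 1" using assms(1) \<open>r = 0\<close> by (simp add: A)
  then have "p = 1 \<or> p = - 1" by (metis square_eq_1_iff)
  moreover have "- 1 = (1::'f)" using char_2 by (metis add.right_inverse add_left_cancel one_add_one)
  ultimately show ?thesis using \<open>q = 0\<close> \<open>r = 0\<close> \<open>w = p\<close> by
      (auto simp: A mat_1_eq)
qed

end

section \<open>Five involutions generating a group of order sixteen\<close>

lemma vec4_eq_iff: "(v :: 'a ^ 4) = w \<longleftrightarrow> v $ 1 = w $ 1 \<and> v $ 2 = w $ 2
    \<and> v $ 3 = w $ 3 \<and> v $ 4 = w $ 4"
  by (simp add: vec_eq_iff forall_4)

definition vec4 :: "'a \<Rightarrow> 'a \<Rightarrow> 'a \<Rightarrow> 'a \<Rightarrow> 'a ^ 4"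
  where "vec4 a b c d = (\<chi> i. if i = 1 then a else if i = 2 then b else if i = 3 then c else d)"

lemma vec4_nth [simp]:
  "vec4 a b c d $ 1 = a" "vec4 a b c d $ 2 = b" "vec4 a b c d $ 3 = c" "vec4 a b c d $ 4 = d"
  by (simp_all add: vec4_def)

definition singular_vectors :: "(bit ^ 4) set"
  where "singular_vectors = {w. w \<noteq> 0 \<and> Q_minus w = 0}"

lemma singular_vectors_eq:
  "singular_vectors = {vec4 1 0 0 0, vec4 0 1 0 0, vec4 1 1 1 0, vec4 1 1 0 1, vec4 1 1 1 1}"
proof -
  have "(\<not> (a = 0 \<and> b = 0 \<and> c = 0 \<and> d = 0) \<and> a * b + (c * c + c * d + d *
      d) = 0) \<longleftrightarrow>
      (a = 1 \<and> b = 0 \<and> c = 0 \<and> d = 0 \<or> a = 0 \<and> b = 1 \<and> c = 0 \<and> d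
          = 0 \<or>
       a = 1 \<and> b = 1 \<and> c = 1 \<and> d = 0 \<or> a = 1 \<and> b = 1 \<and> c = 0 \<and> d
           = 1 \<or>
       a = 1 \<and> b = 1 \<and> c = 1 \<and> d = 1)" for a b c d :: bit
    by (cases a; cases b; cases c; cases d) simp_all
  from this[of "w $ 1" "w $ 2" "w $ 3" "w $ 4" for w] have "w \<in> singular_vectors
      \<longleftrightarrow>
      w \<in> {vec4 1 0 0 0, vec4 0 1 0 0, vec4 1 1 1 0, vec4 1 1 0 1, vec4 1 1 1 1}" for w
    unfolding singular_vectors_def Q_minus_def mem_Collect_eq vec4_eq_iff insert_iff empty_iff
      vec4_nth zero_index simp_thms by this
  then show ?thesis by blast
qed

lemma card_singular_vectors: "card singular_vectors = 5"
  by (simp add: singular_vectors_eq vec4_eq_iff)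

lemma card_bit4: "CARD(bit ^ 4) = 16"
proof -
  have "(UNIV :: bit set) = {0, 1}" by (auto intro: bit.exhaust)
  then have "CARD(bit) = card {0, 1 :: bit}" by (rule arg_cong)
  then have "CARD(bit) = 2" by simp
  then show ?thesis by simp
qed

text \<open>A power with exponent in the field with two elements; it is additive in the exponent
  when the square of \<open>x\<close> is trivial.\<close>

definition (in group) bit_power :: "'a \<Rightarrow> bit \<Rightarrow> 'a"
  where "bit_power x b = (if b = 1 then x else \<one>)"

text \<open>The five singular vectors are related like the five involutions: their sum is zero, and
    any four
  of them form a basis.\<close>

lemma (in comm_group) iso_from_five_involutions:
  assumes fin: "finite (carrier G)" and card: "card (carrier G) = 16"
    and S: "S \<subseteq> carrier G" "card S = 5"
    and ne: "\<one> \<notin> S" and sq: "\<And>x. x \<in> S \<Longrightarrow> x \<otimes> x = \<one>"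
    and indep: "\<And>x y. x \<in> S \<Longrightarrow> y \<in> S \<Longrightarrow> x \<otimes> y
        \<notin> S"
    and prod: "finprod G (\<lambda>x. x) S = \<one>"
  obtains f where "f \<in> iso G (vec_group :: (bit ^ 4) monoid)"
    "\<And>v. v \<in> carrier G \<Longrightarrow> v \<in> S \<longleftrightarrow> f v \<in>
        singular_vectors"
proof -
  have "finite S" using S by (metis card.infinite zero_neq_numeral)
  then obtain xs where xs: "set xs = S" "distinct xs" using finite_distinct_list by blast
  then have "length xs = 5" using S(2) distinct_card by metis
  then obtain x1 x2 x3 x4 x5 where "xs = [x1, x2, x3, x4, x5]"
    by (auto simp: numeral_eq_Suc length_Suc_conv)
  then have S_eq: "S = {x1, x2, x3, x4, x5}" and dist: "distinct [x1, x2, x3, x4, x5]"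
    using xs by auto
  have c: "x1 \<in> carrier G" "x2 \<in> carrier G" "x3 \<in> carrier G" "x4 \<in> carrier G" "x5
      \<in> carrier G"
    using S by (auto simp: S_eq)
  have sq': "x1 \<otimes> x1 = \<one>" "x2 \<otimes> x2 = \<one>" "x3 \<otimes> x3 = \<one>" "x4
      \<otimes> x4 = \<one>" "x5 \<otimes> x5 = \<one>"
    using sq by (auto simp: S_eq)
  have five: "x1 \<otimes> (x2 \<otimes> (x3 \<otimes> (x4 \<otimes> x5))) = \<one>"
    using prod dist c by (simp add: S_eq Pi_def)
  have cancel: "x \<otimes> y = \<one> \<Longrightarrow> x = y" if "x \<in> carrier G" "y \<in>
      carrier G" "y \<otimes> y = \<one>" for x y
    using that by (metis r_cancel)
  have x5: "x1 \<otimes> (x2 \<otimes> (x3 \<otimes> x4)) = x5"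
    by (rule cancel) (use c sq' five in \<open>simp_all add: m_assoc\<close>)
  let ?p = "bit_power"
  \<comment> \<open>The exponents are the coordinates of \<open>w\<close> in the basis
    \<open>vec4 1 0 0 0\<close>, \<open>vec4 0 1 0 0\<close>, \<open>vec4 1 1 1 0\<close>,
    \<open>vec4 1 1 0 1\<close> of singular vectors. These go to \<open>x1\<close>,
    \<open>x2\<close>, \<open>x3\<close>, \<open>x4\<close>, and their sum
    \<open>vec4 1 1 1 1\<close> goes to \<open>x5\<close>.\<close>
  define \<Phi> :: "bit ^ 4 \<Rightarrow> 'a" where
    "\<Phi> w = ?p x1 (w $ 1 + w $ 3 + w $ 4) \<otimes> (?p x2 (w $ 2 + w $ 3 + w $ 4) \<otimes>
        (?p x3 (w $ 3) \<otimes> ?p x4 (w $ 4)))" for w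
  have pc: "?p x b \<in> carrier G" if "x \<in> carrier G" for x b using that by (simp add:
      bit_power_def)
  have padd: "?p x (b + b') = ?p x b \<otimes> ?p x b'" if "x \<in> carrier G" "x \<otimes> x =
      \<one>" for x b b'
    using that by (cases b; cases b') (simp_all add: bit_power_def)
  have \<Phi>_closed: "\<Phi> w \<in> carrier G" for w using c by (simp add: \<Phi>_def pc)
  have \<Phi>_add: "\<Phi> (w + w') = \<Phi> w \<otimes> \<Phi> w'" for w w'
  proof -
    have reorder: "a + a' + (b + b') + (c + c') = (a + b + c) + (a' + b' + c')" for a a' b b' c c'
        :: bit
      by (simp only: ac_simps)
    show ?thesis
      unfolding \<Phi>_def vector_add_component reorder
      using c sq' by (simp only: padd) (simp add: pc m_ac)
  qed
  have ne': "x1 \<noteq> \<one>" "x2 \<noteq> \<one>" "x3 \<noteq> \<one>" "x4 \<noteq> \<one>" "x5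
      \<noteq> \<one>" using ne by (auto simp: S_eq)
  have pair: "x \<otimes> y \<noteq> \<one>" if "x \<in> S" "y \<in> S" "x \<noteq> y" for x y
    using cancel that sq S by blast
  have triple: "x \<otimes> (y \<otimes> z) \<noteq> \<one>" if "x \<in> S" "y \<in> S" "z \<in> S"
      for x y z
    using cancel[of "x \<otimes> y" z] indep[of x y] that sq S by (auto simp: m_assoc subset_iff)
  \<comment> \<open>No product of some of \<open>x1\<close> to \<open>x4\<close> is trivial: two of
    them are distinct involutions, a product of two is never in \<open>S\<close>, and the product of
    all four is \<open>x5\<close>.\<close>
  have kernel: "w = 0" if "\<Phi> w = \<one>" for w
  proof -
    define a b where "a = w $ 1 + w $ 3 + w $ 4" and "b = w $ 2 + w $ 3 + w $ 4"
    have in_S: "x1 \<in> S" "x2 \<in> S" "x3 \<in> S" "x4 \<in> S" by (auto simp: S_eq)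
    have neq: "x1 \<noteq> x2" "x1 \<noteq> x3" "x1 \<noteq> x4" "x2 \<noteq> x3" "x2 \<noteq> x4"
        "x3 \<noteq> x4" using dist by auto
    note facts = ne' x5 c pair[OF in_S(1,2) neq(1)] pair[OF in_S(1,3) neq(2)] pair[OF in_S(1,4)
        neq(3)]
      pair[OF in_S(2,3) neq(4)] pair[OF in_S(2,4) neq(5)] pair[OF in_S(3,4) neq(6)]
      triple[OF in_S(1,2,3)] triple[OF in_S(1,2,4)] triple[OF in_S(1,3,4)] triple[OF in_S(2,3,4)]
    have "?p x1 a \<otimes> (?p x2 b \<otimes> (?p x3 (w $ 3) \<otimes> ?p x4 (w $ 4))) = \<one>"
      using that by (simp add: \<Phi>_def a_def b_def)
    then have "a = 0 \<and> b = 0 \<and> w $ 3 = 0 \<and> w $ 4 = 0"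
      by (cases a; cases b; cases "w $ 3"; cases "w $ 4") (simp_all add: bit_power_def facts)
    then show ?thesis unfolding vec4_eq_iff a_def b_def
      by (cases "w $ 1"; cases "w $ 2"; cases "w $ 3"; cases "w $ 4") simp_all
  qed
  have inj: "inj \<Phi>"
  proof (rule injI)
    fix w w' assume "\<Phi> w = \<Phi> w'"
    moreover have "w' + w' = 0" by (simp add: vec_eq_iff)
    then have "\<Phi> w' \<otimes> \<Phi> w' = \<one>" using \<Phi>_add[of w' w'] c by (simp add:
        \<Phi>_def bit_power_def)
    ultimately have "\<Phi> (w + w') = \<one>" by (simp add: \<Phi>_add)
    then have *: "w + w' = 0" by (rule kernel)
    have "w = w + (w' + w')" using \<open>w' + w' = 0\<close> by simp
    also have "\<dots> = w'" by (simp only: add.assoc[symmetric] * add_0)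
    finally show "w = w'" .
  qed
  have "card (range \<Phi>) = card (carrier G)" using inj card card_bit4 by (simp add: card_image)
  then have surj: "range \<Phi> = carrier G" using \<Phi>_closed fin by (intro card_subset_eq) auto
  define f where "f = inv_into UNIV \<Phi>"
  have f\<Phi>: "f (\<Phi> w) = w" for w by (simp add: f_def inj)
  have \<Phi>f: "\<Phi> (f v) = v" if "v \<in> carrier G" for v using that surj by (simp add: f_def
      f_inv_into_f)
  have "f \<in> hom G vec_group"
  proof (rule homI)
    fix u v assume "u \<in> carrier G" "v \<in> carrier G"
    then have "u \<otimes> v = \<Phi> (f u + f v)" by (simp add: \<Phi>_add \<Phi>f)
    then show "f (u \<otimes> v) = f u \<otimes>\<^bsub>vec_group\<^esub> f v" by (simp add:
        f\<Phi> vec_group_def)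
  qed (simp add: vec_group_def)
  moreover have "bij_betw f (carrier G) (carrier vec_group)"
    by (rule bij_betw_byWitness[where f' = \<Phi>]) (auto simp: f\<Phi> \<Phi>f \<Phi>_closed
        vec_group_def)
  ultimately have iso: "f \<in> iso G vec_group" by (simp add: iso_def)
  have "\<Phi> (vec4 1 0 0 0) = x1" "\<Phi> (vec4 0 1 0 0) = x2" "\<Phi> (vec4 1 1 1 0) = x3"
    "\<Phi> (vec4 1 1 0 1) = x4" "\<Phi> (vec4 1 1 1 1) = x5"
    using c x5 by (simp_all add: \<Phi>_def bit_power_def)
  then have "\<Phi> ` singular_vectors = S" by (simp add: singular_vectors_eq S_eq)
  then have "v \<in> S \<longleftrightarrow> f v \<in> singular_vectors" if "v \<in> carrier G" for v
    using f\<Phi> \<Phi>f[OF that] by (metis image_iff)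
  then show ?thesis using that iso by blast
qed

section \<open>The orthogonal group of minus type\<close>

lemma invertible_mat_1: "invertible (mat 1 :: 'f::field ^ 'n ^ 'n)"
  by (auto simp: invertible_def intro: exI[of _ "mat 1"])

lemma group_GL: "group (GL :: ('f::field ^ 'n ^ 'n) monoid)"
proof (rule groupI)
  fix A :: "'f ^ 'n ^ 'n" assume "A \<in> carrier GL"
  then obtain B where "A ** B = mat 1" "B ** A = mat 1" by (auto simp: GL_def invertible_def)
  then show "\<exists>B\<in>carrier GL. B \<otimes>\<^bsub>GL\<^esub> A = \<one>\<^bsub>GL\<^esub>"
      by (auto simp: GL_def invertible_def)
qed (simp_all add: GL_def invertible_mult matrix_mul_assoc invertible_mat_1)

lemma matrix_inj_on_GL: "invertible A \<Longrightarrow> A *v x = A *v y \<Longrightarrow> x = (y ::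
    'f::field ^ 'n)"
  by (metis invertible_def matrix_vector_mul_assoc matrix_vector_mul_lid)

lemma subgroup_O4_minus: "subgroup O4_minus GL"
proof (rule group.subgroupI[OF group_GL])
  show "O4_minus \<noteq> {}"
    by (rule ex_in_conv[THEN iffD1], rule exI[of _ "mat 1"]) (simp add: O4_minus_def invertible_mat_1)
  fix A :: "bit ^ 4 ^ 4" assume A: "A \<in> O4_minus"
  then obtain B where B: "A ** B = mat 1" "B ** A = mat 1" by (auto simp: O4_minus_def invertible_def)
  have AG: "A \<in> carrier GL" using A by (simp add: O4_minus_def GL_def)
  moreover have BG: "B \<in> carrier GL" using B by (auto simp: GL_def invertible_def)
  ultimately have "inv\<^bsub>GL\<^esub> A = B" using B group_GL by (metis (full_types) GL_def
      group.inv_equality monoid.simps)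
  moreover have "Q_minus (B *v x) = Q_minus x" for x
  proof -
    have "Q_minus (A *v (B *v x)) = Q_minus (B *v x)" using A by (simp add: O4_minus_def)
    then show ?thesis by (simp add: matrix_vector_mul_assoc B)
  qed
  ultimately show "inv\<^bsub>GL\<^esub> A \<in> O4_minus" using BG by (simp add: O4_minus_def GL_def)
next
  fix A B :: "bit ^ 4 ^ 4" assume "A \<in> O4_minus" "B \<in> O4_minus"
  then show "A \<otimes>\<^bsub>GL\<^esub> B \<in> O4_minus"
    by (simp add: O4_minus_def GL_def invertible_mult matrix_vector_mul_assoc[symmetric])
qed (auto simp: O4_minus_def GL_def)

lemma singular_vectors_span:
  assumes "\<And>x. x \<in> singular_vectors \<Longrightarrow> A *v x = B *v (x :: bit ^ 4)"
  shows "A = (B :: bit ^ 4 ^ 4)"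
proof -
  let ?e1 = "vec4 1 0 0 0 :: bit ^ 4" and ?e2 = "vec4 0 1 0 0 :: bit ^ 4"
    and ?e3 = "vec4 1 1 1 0 :: bit ^ 4" and ?e4 = "vec4 1 1 0 1 :: bit ^ 4"
  have eq: "A *v ?e1 = B *v ?e1" "A *v ?e2 = B *v ?e2" "A *v ?e3 = B *v ?e3" "A *v ?e4 = B *v ?e4"
    using assms by (auto simp: singular_vectors_eq)
  have "A *v x = B *v x" for x
  proof -
    define a b where "a = x $ 1 + x $ 3 + x $ 4" and "b = x $ 2 + x $ 3 + x $ 4"
    have x: "x = a *s ?e1 + b *s ?e2 + (x $ 3) *s ?e3 + (x $ 4) *s ?e4"
      unfolding vec4_eq_iff by (cases "x $ 1"; cases "x $ 2"; cases "x $ 3"; cases "x $ 4")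
          (simp_all add: a_def b_def)
    show ?thesis by (subst (1 2) x) (simp only: matrix_vector_right_distrib vec.scale eq)
  qed
  then show ?thesis by (simp add: matrix_eq)
qed

text \<open>The singular vectors span, so the action on these five vectors embeds the group into the
  symmetric group of degree 5.\<close>

lemma O4_minus_card_le: "finite O4_minus" "card O4_minus \<le> 120"
proof -
  show "finite O4_minus" by simp
  let ?r = "\<lambda>A x. if x \<in> singular_vectors then A *v x else x"
  have "?r A permutes singular_vectors" if A: "A \<in> O4_minus" for A
  proof (rule bij_imp_permutes)
    have "A *v x \<in> singular_vectors" if "x \<in> singular_vectors" for x
    proof -
      have "A *v x \<noteq> 0" using matrix_inj_on_GL[of A x 0] A that by (auto simp: O4_minus_def
          singular_vectors_def)
      then show ?thesis using A that by (simp add: O4_minus_def singular_vectors_def)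
    qed
    moreover have "inj_on (\<lambda>x. A *v x) singular_vectors"
      using A matrix_inj_on_GL by (auto simp: inj_on_def O4_minus_def)
    ultimately have "bij_betw (\<lambda>x. A *v x) singular_vectors singular_vectors"
      unfolding bij_betw_def by (metis endo_inj_surj finite image_subsetI)
    then show "bij_betw (?r A) singular_vectors singular_vectors"
      by (subst bij_betw_cong[of _ _ "\<lambda>x. A *v x"]) auto
  qed auto
  moreover have "inj_on ?r O4_minus"
  proof (rule inj_onI)
    fix A B assume "?r A = ?r B"
    then have "A *v x = B *v x" if "x \<in> singular_vectors" for x
      using that by (metis (mono_tags, lifting))
    then show "A = B" by (rule singular_vectors_span)
  qed
  ultimately have "card O4_minus \<le> card {p. p permutes singular_vectors}"
    by (intro card_inj_on_le[of ?r]) (auto intro: finite_permutations)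
  also have "\<dots> = 120" by (simp add: card_permutations[OF card_singular_vectors] fact_numeral)
  finally show "card O4_minus \<le> 120" .
qed

text \<open>A subgroup of index at most two contains all squares, and a commutator is a product of
  three squares.\<close>

lemma (in group) derived_subset_of_index_le_2:
  assumes H: "subgroup H G" and K: "K \<subseteq> H" "subgroup K G" and fin: "finite H"
    and card: "card H \<le> 2 * card K"
  shows "derived G H \<subseteq> K"
proof -
  have Hc: "H \<subseteq> carrier G" using H by (rule subgroup.subset)
  have Kc: "K \<subseteq> carrier G" using K(2) by (rule subgroup.subset)
  have square: "x \<otimes> x \<in> K" if x: "x \<in> H" for x
  proof (rule ccontr)
    assume xx: "x \<otimes> x \<notin> K"
    have xc: "x \<in> carrier G" using x Hc by blast
    have inj: "inj_on (\<lambda>k. y \<otimes> k) K" if "y \<in> carrier G" for y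
      using that Kc by (intro inj_onI) (metis l_cancel subsetD)
    have disj1: "K \<inter> (\<lambda>k. x \<otimes> k) ` K = {}"
    proof -
      have "x \<otimes> k \<notin> K" if k: "k \<in> K" for k
      proof
        assume "x \<otimes> k \<in> K"
        then have "x \<otimes> k \<otimes> inv k \<in> K" using k K(2) by (simp add:
            subgroup.m_closed subgroup.m_inv_closed)
        moreover have "x \<otimes> k \<otimes> inv k = x" using k xc Kc by (simp add: m_assoc
            subset_iff)
        ultimately have "x \<in> K" by simp
        then show False using xx K(2) by (simp add: subgroup.m_closed)
      qed
      then show ?thesis by auto
    qed
    have fK: "finite K" using K fin by (auto intro: finite_subset)
    have "card (K \<union> (\<lambda>k. x \<otimes> k) ` K) = card K + card K"
      using disj1 fK inj[OF xc] by (simp add: card_Un_disjoint card_image)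
    moreover have sub: "K \<union> (\<lambda>k. x \<otimes> k) ` K \<subseteq> H"
      using K x H by (auto simp: subgroup.m_closed)
    \<comment> \<open>The disjoint cosets \<open>K\<close> and \<open>x K\<close> fill
      \<open>H\<close>. The square of \<open>x\<close>, not being in \<open>K\<close>, lies in
      \<open>x K\<close>, and cancelling \<open>x\<close> puts \<open>x\<close> itself into
      \<open>K\<close>.\<close>
    ultimately have "H = K \<union> (\<lambda>k. x \<otimes> k) ` K"
      using card fin by (intro card_seteq[symmetric]) auto
    moreover have "x \<otimes> x \<in> H" using x H by (simp add: subgroup.m_closed)
    ultimately obtain k where k: "k \<in> K" "x \<otimes> x = x \<otimes> k" using xx by auto
    then have "x = k" using xc Kc by (metis l_cancel subsetD)
    then show False using xx k K(2) by (simp add: subgroup.m_closed)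
  qed
  have comm: "x \<otimes> y \<otimes> inv x \<otimes> inv y \<in> K" if xy: "x \<in> H" "y \<in> H"
      for x y
  proof -
    have c: "x \<in> carrier G" "y \<in> carrier G" using xy Hc by auto
    \<comment> \<open>The commutator of \<open>x\<close> and \<open>y\<close> is the square of
      \<open>x y\<close>, times the square of \<open>y^-1 x^-1 y\<close>, times the square of
      \<open>y^-1\<close>.\<close>
    let ?a = "x \<otimes> y" and ?b = "inv y \<otimes> inv x \<otimes> y"
    have "?a \<otimes> ?a \<in> K" "?b \<otimes> ?b \<in> K" "inv y \<otimes> inv y \<in> K"
      using xy H by (auto intro!: square simp: subgroup.m_closed subgroup.m_inv_closed)
    then have "?a \<otimes> ?a \<otimes> (?b \<otimes> ?b) \<otimes> (inv y \<otimes> inv y) \<in> K"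
      using K(2) by (simp add: subgroup.m_closed)
    moreover have "?a \<otimes> ?a \<otimes> (?b \<otimes> ?b) \<otimes> (inv y \<otimes> inv y) =
        x \<otimes> y \<otimes> inv x \<otimes> inv y"
    proof -
      have cancel: "y \<otimes> (inv y \<otimes> z) = z" "inv y \<otimes> (y \<otimes> z) = z" "x
          \<otimes> (inv x \<otimes> z) = z" "inv x \<otimes> (x \<otimes> z) = z"
        if "z \<in> carrier G" for z using c that by (simp_all add: m_assoc[symmetric])
      show ?thesis using c by (simp add: m_assoc cancel)
    qed
    ultimately show ?thesis by simp
  qed
  have "derived_set G H \<subseteq> K" using comm by auto
  then show ?thesis unfolding derived_def using K(2) generate_subgroup_incl by blast
qed

section \<open>Group-theoretic preliminaries\<close>

text \<open>Orbits with more than one point have size divisible by \<open>p\<close>. This will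
  produce a vector fixed by \<open>T\<close>, central elements of \<open>R\<close>, and fixed points
  among the five singular ones.\<close>

lemma p_group_fixed_points:
  fixes H (structure)
  assumes "group H" and p: "Factorial_Ring.prime p" and order: "order H = p ^ k" and fin: "finite E"
    and closed: "\<And>h x. h \<in> carrier H \<Longrightarrow> x \<in> E \<Longrightarrow> op h x
        \<in> E"
    and mult: "\<And>g h x. g \<in> carrier H \<Longrightarrow> h \<in> carrier H \<Longrightarrow>
        x \<in> E \<Longrightarrow> op (g \<otimes> h) x = op g (op h x)"
    and one: "\<And>x. x \<in> E \<Longrightarrow> op \<one> x = x"
  shows "card E mod p = card {x \<in> E. \<forall>h \<in> carrier H. op h x = x} mod p"
proof -
  interpret group H by fact
  \<comment> \<open>Elements of \<open>BijGroup E\<close> are extensional, so \<open>op h\<close> is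
    cut down to \<open>E\<close>.\<close>
  let ?\<phi> = "\<lambda>h. restrict (op h) E"
  have bij: "?\<phi> h \<in> Bij E" if h: "h \<in> carrier H" for h
  proof -
    have "bij_betw (op h) E E"
      by (rule bij_betw_byWitness[where f' = "op (inv h)"])
         (use h closed mult[of "inv h" h] mult[of h "inv h"] one in auto)
    then show ?thesis by (simp add: Bij_def)
  qed
  have "?\<phi> (g \<otimes> h) = ?\<phi> g \<otimes>\<^bsub>BijGroup E\<^esub> ?\<phi> h" if "g
      \<in> carrier H" "h \<in> carrier H" for g h
    using that bij closed mult by (auto simp: BijGroup_def compose_def fun_eq_iff)
  then have hom: "?\<phi> \<in> hom H (BijGroup E)" using bij by (simp add: hom_def BijGroup_def)
  interpret group_action H E ?\<phi>
    using hom group_BijGroup is_group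
    by (simp add: group_action_def group_hom_def group_hom_axioms_def)
  let ?F = "{x \<in> E. \<forall>h \<in> carrier H. op h x = x}"
  let ?O = "{orb \<in> orbits H E ?\<phi>. card orb \<noteq> 1}"
  have orbit_eq: "orbit H ?\<phi> x = (\<lambda>h. op h x) ` carrier H" if "x \<in> E" for x
    using that by (auto simp: orbit_def)
  have self: "x \<in> orbit H ?\<phi> x" if "x \<in> E" for x
    using orbit_refl[OF that] .
  have single: "card (orbit H ?\<phi> x) = 1 \<longleftrightarrow> x \<in> ?F" if x: "x \<in> E" for x
  proof
    assume "card (orbit H ?\<phi> x) = 1"
    then have "orbit H ?\<phi> x = {x}" using self[OF x] by (metis card_1_singletonE singletonD)
    then show "x \<in> ?F" using x by (auto simp: orbit_eq)
  next
    assume "x \<in> ?F"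
    then have "orbit H ?\<phi> x = {x}" using x one_closed by (auto simp: orbit_eq)
    then show "card (orbit H ?\<phi> x) = 1" by simp
  qed
  have union: "\<Union>?O = E - ?F"
  proof
    show "\<Union>?O \<subseteq> E - ?F"
    proof
      fix y assume "y \<in> \<Union>?O"
      then obtain orb where orb: "orb \<in> orbits H E ?\<phi>" "card orb \<noteq> 1" "y \<in> orb"
          by blast
      then have y: "y \<in> E" using orbits_coverture by blast
      then have "orbit H ?\<phi> y \<in> orbits H E ?\<phi>" by (auto simp: orbits_def)
      then have "orbit H ?\<phi> y = orb" using disjoint_union[OF _ orb(1)] orb(3) self[OF y] by blast
      then show "y \<in> E - ?F" using single[OF y] orb(2) y by simp
    qed
    show "E - ?F \<subseteq> \<Union>?O"
    proof
      fix y assume y: "y \<in> E - ?F"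
      then have "orbit H ?\<phi> y \<in> ?O" using single[of y] by (auto simp: orbits_def)
      then show "y \<in> \<Union>?O" using self y by blast
    qed
  qed
  have "p dvd card (\<Union>?O)"
  proof (rule dvd_partition)
    show "finite (\<Union>?O)" using fin unfolding union by simp
    show "\<forall>c\<in>?O. p dvd card c"
    proof
      fix c assume "c \<in> ?O"
      then obtain x where x: "x \<in> E" "c = orbit H ?\<phi> x" "card c \<noteq> 1" by (auto simp:
          orbits_def)
      have "card c dvd p ^ k"
        using orbit_stabilizer_theorem[OF x(1)] order x(2) by (metis dvd_triv_left)
      then obtain i where "card c = p ^ i" using p divides_primepow_nat by blast
      then show "p dvd card c" using x(3) by (cases i) auto
    qed
    show "\<forall>c1\<in>?O. \<forall>c2\<in>?O. c1 \<noteq> c2 \<longrightarrow> c1 \<inter> c2 =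
        {}" using disjoint_union by blast
  qed
  then have "p dvd card (E - ?F)" unfolding union .
  moreover have "card E = card ?F + card (E - ?F)"
    using fin by (metis (no_types, lifting) card_Diff_subset card_mono le_add_diff_inverse
        mem_Collect_eq rev_finite_subset subsetI)
  ultimately show ?thesis by (auto elim!: dvdE)
qed

lemma hom_AutoGroupD:
  assumes "group G" "group V" "\<phi> \<in> hom G (AutoGroup V)"
  shows "g \<in> carrier G \<Longrightarrow> v \<in> carrier V \<Longrightarrow> \<phi> g v \<in>
      carrier V"
    and "g \<in> carrier G \<Longrightarrow> h \<in> carrier G \<Longrightarrow> v \<in> carrier V
        \<Longrightarrow> \<phi> (g \<otimes>\<^bsub>G\<^esub> h) v = \<phi> g (\<phi> h v)"
    and "v \<in> carrier V \<Longrightarrow> \<phi> \<one>\<^bsub>G\<^esub> v = v"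
    and "g \<in> carrier G \<Longrightarrow> u \<in> carrier V \<Longrightarrow> v \<in> carrier V
        \<Longrightarrow> \<phi> g (u \<otimes>\<^bsub>V\<^esub> v) = \<phi> g u
        \<otimes>\<^bsub>V\<^esub> \<phi> g v"
proof -
  have aut: "\<phi> g \<in> hom V V" "\<phi> g \<in> Bij (carrier V)" if "g \<in> carrier G" for g
    using assms(3) that by (auto simp: hom_def AutoGroup_def auto_def)
  show "g \<in> carrier G \<Longrightarrow> v \<in> carrier V \<Longrightarrow> \<phi> g v \<in>
      carrier V" using aut by (auto simp: hom_def)
  show "g \<in> carrier G \<Longrightarrow> u \<in> carrier V \<Longrightarrow> v \<in> carrier V
      \<Longrightarrow> \<phi> g (u \<otimes>\<^bsub>V\<^esub> v) = \<phi> g u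
      \<otimes>\<^bsub>V\<^esub> \<phi> g v"
    using aut by (auto simp: hom_def)
  show "g \<in> carrier G \<Longrightarrow> h \<in> carrier G \<Longrightarrow> v \<in> carrier V
      \<Longrightarrow> \<phi> (g \<otimes>\<^bsub>G\<^esub> h) v = \<phi> g (\<phi> h v)"
    using hom_mult[OF assms(3), of g h] aut[of g] aut[of h]
    by (auto simp: AutoGroup_def BijGroup_def compose_def)
  have "group_hom G (AutoGroup V) \<phi>"
    using assms group.AutoGroup by (auto simp: group_hom_def group_hom_axioms_def)
  then have "\<phi> \<one>\<^bsub>G\<^esub> = \<one>\<^bsub>AutoGroup V\<^esub>" by (rule
      group_hom.hom_one)
  then show "v \<in> carrier V \<Longrightarrow> \<phi> \<one>\<^bsub>G\<^esub> v = v" by (simp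
      add: AutoGroup_def BijGroup_def)
qed

text \<open>\<open>N\<close> carries the full \<open>r\<close>-part of the group order, so the
  quotient of \<open>H\<close> by \<open>N\<close> has order prime to \<open>r\<close>, and every
  \<open>r\<close>-element of \<open>H\<close> becomes trivial in it.\<close>

lemma (in group) mem_normal_if_pow_eq_one:
  assumes fin: "finite (carrier G)" and H: "subgroup H G" and N: "N \<lhd> G\<lparr>carrier :=
      H\<rparr>"
    and card: "card N = r ^ multiplicity r (order G)" and r: "Factorial_Ring.prime r"
    and x: "x \<in> H" "x [^] (r ^ j) = \<one>"
  shows "x \<in> N"
proof -
  let ?H = "G\<lparr>carrier := H\<rparr>"
  interpret H: group ?H using H subgroup_imp_group by blast
  interpret N: normal N ?H by fact
  interpret Q: group "?H Mod N" by (rule N.factorgroup_is_group)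
  have xH: "x \<in> carrier ?H" using x by simp
  let ?X = "N #>\<^bsub>?H\<^esub> x"
  have X: "?X \<in> carrier (?H Mod N)" using x by (auto simp: FactGroup_def RCOSETS_def)
  have "?X [^]\<^bsub>?H Mod N\<^esub> (r ^ j) = N #>\<^bsub>?H\<^esub> (x [^]\<^bsub>?H\<^esub> (r
      ^ j))" using N.FactGroup_pow[OF xH] .
  also have "x [^]\<^bsub>?H\<^esub> (r ^ j) = \<one>\<^bsub>?H\<^esub>" using x(2)
      nat_pow_consistent by simp
  also have "N #>\<^bsub>?H\<^esub> \<one>\<^bsub>?H\<^esub> = \<one>\<^bsub>?H Mod N\<^esub>"
      using H.coset_mult_one N.subset by (simp add: FactGroup_def)
  finally have "Q.ord ?X dvd r ^ j" using Q.pow_eq_id[OF X] by simp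
  moreover have "Q.ord ?X dvd order (?H Mod N)"
    using Q.ord_dvd_group_order[OF X] .
  moreover have "coprime (r ^ j) (order (?H Mod N))"
  proof -
    have c: "order (?H Mod N) * card N = card H"
      using H.lagrange[OF N.subgroup_axioms] by (simp add: order_def FactGroup_def)
    have "card H dvd order G" using lagrange[OF H] by (metis dvd_triv_right)
    then have "order (?H Mod N) * r ^ multiplicity r (order G) dvd order G" using c card by simp
    moreover have "\<not> r ^ Suc (multiplicity r (order G)) dvd order G"
    proof -
      have "order G \<noteq> 0" using fin order_gt_0_iff_finite by simp
      moreover have "\<not> is_unit r" using r by auto
      ultimately have "\<not> Suc (multiplicity r (order G)) \<le> multiplicity r (order G)
          \<longrightarrow> ?thesis"
        using multiplicity_geI by blast
      then show ?thesis by simp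
    qed
    ultimately have "\<not> r dvd order (?H Mod N)"
      using mult_dvd_mono[OF _ dvd_refl, of r "order (?H Mod N)"] dvd_trans unfolding power_Suc by
          blast
    then show ?thesis using r by (simp add: prime_imp_coprime coprime_power_left_iff)
  qed
  ultimately have "is_unit (Q.ord ?X)" by (rule coprime_common_divisor[rotated 1])
  then have "Q.ord ?X = 1" by simp
  then have "?X = \<one>\<^bsub>?H Mod N\<^esub>" using Q.ord_eq_1[OF X] by simp
  then have "?X = N" by (simp add: FactGroup_def)
  then show ?thesis using H.coset_join1[OF _ xH N.subgroup_axioms] N.subset by simp
qed

lemma stabilizer_subgroupI:
  assumes "group G" "group V" "\<phi> \<in> hom G (AutoGroup V)" "v \<in> carrier V"
  shows "subgroup (stabilizer G \<phi> v) G"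
proof -
  interpret group G by fact
  note D = hom_AutoGroupD[OF assms(1-3)]
  show ?thesis
  proof (rule subgroupI)
    show "stabilizer G \<phi> v \<noteq> {}" using D(3)[OF assms(4)] by (auto simp: stabilizer_def)
    fix g assume g: "g \<in> stabilizer G \<phi> v"
    then have "\<phi> (inv\<^bsub>G\<^esub> g) (\<phi> g v) = v" using D(2)[of
        "inv\<^bsub>G\<^esub> g" g v] D(3) assms(4) by (simp add: stabilizer_def)
    then show "inv\<^bsub>G\<^esub> g \<in> stabilizer G \<phi> v" using g by (simp add:
        stabilizer_def)
  next
    fix g h assume "g \<in> stabilizer G \<phi> v" "h \<in> stabilizer G \<phi> v"
    then show "g \<otimes>\<^bsub>G\<^esub> h \<in> stabilizer G \<phi> v" using D(2) assms(4) by
        (simp add: stabilizer_def)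
  qed (auto simp: stabilizer_def)
qed

lemma (in group) conj_subgroup_eq:
  assumes "P \<subseteq> carrier G" "x \<in> carrier G"
  shows "conj_subgroup G P x = (\<lambda>p. inv x \<otimes> p \<otimes> x) ` P"
  using assms by (auto simp: conj_subgroup_def l_coset_def r_coset_def image_iff)

lemma (in group) subgroup_conj_subgroup:
  assumes "subgroup P G" "x \<in> carrier G"
  shows "subgroup (conj_subgroup G P x) G"
proof -
  have P: "P \<subseteq> carrier G" using assms by (simp add: subgroup.subset)
  note eq = conj_subgroup_eq[OF P assms(2)]
  show ?thesis
  proof (rule subgroupI)
    show "conj_subgroup G P x \<subseteq> carrier G" using P assms(2) by (auto simp: eq)
    show "conj_subgroup G P x \<noteq> {}" using assms(1) subgroup.one_closed by (fastforce simp: eq)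
    fix y assume "y \<in> conj_subgroup G P x"
    then obtain p where p: "p \<in> P" "y = inv x \<otimes> p \<otimes> x" by (auto simp: eq)
    then have "inv y = inv x \<otimes> inv p \<otimes> x" using P assms(2) by (auto simp:
        inv_mult_group m_assoc)
    moreover have "inv p \<in> P" using p assms(1) by (simp add: subgroup.m_inv_closed)
    ultimately show "inv y \<in> conj_subgroup G P x" by (auto simp: eq)
  next
    fix y z assume "y \<in> conj_subgroup G P x" "z \<in> conj_subgroup G P x"
    then obtain p q where p: "p \<in> P" "y = inv x \<otimes> p \<otimes> x" and q: "q \<in> P" "z
        = inv x \<otimes> q \<otimes> x" by (auto simp: eq)
    have c: "p \<in> carrier G" "q \<in> carrier G" using p q P by auto
    have "y \<otimes> z = inv x \<otimes> (p \<otimes> q) \<otimes> x"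
    proof -
      have "x \<otimes> (inv x \<otimes> (q \<otimes> x)) = q \<otimes> x" using c assms(2) by
          (simp add: m_assoc[symmetric])
      then show ?thesis using c assms(2) p q by (simp add: m_assoc)
    qed
    moreover have "p \<otimes> q \<in> P" using p q assms(1) by (simp add: subgroup.m_closed)
    ultimately show "y \<otimes> z \<in> conj_subgroup G P x" by (auto simp: eq)
  qed
qed

lemma (in group) card_conj_subgroup:
  assumes "P \<subseteq> carrier G" "x \<in> carrier G"
  shows "card (conj_subgroup G P x) = card P"
proof -
  have "inj_on (\<lambda>p. inv x \<otimes> p \<otimes> x) P"
    using assms by (auto simp: inj_on_def subset_iff)
  then show ?thesis by (simp add: conj_subgroup_eq[OF assms] card_image)
qed

lemma pts_with_normal_conjugate_iff:
  assumes "group G" "group V" "\<phi> \<in> hom G (AutoGroup V)" "subgroup P G"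
  shows "v \<in> pts_with_normal_conjugate G V \<phi> P \<longleftrightarrow> v \<in> carrier V \<and>
    (\<exists>x\<in>carrier G. conj_subgroup G P x \<subseteq> stabilizer G \<phi> v \<and>
      (\<forall>g\<in>stabilizer G \<phi> v. \<forall>y\<in>conj_subgroup G P x. g
          \<otimes>\<^bsub>G\<^esub> y \<otimes>\<^bsub>G\<^esub> inv\<^bsub>G\<^esub> g \<in>
          conj_subgroup G P x))"
proof -
  interpret group G by fact
  have "conj_subgroup G P x \<lhd> G\<lparr>carrier := stabilizer G \<phi> v\<rparr>
      \<longleftrightarrow>
      conj_subgroup G P x \<subseteq> stabilizer G \<phi> v \<and>
      (\<forall>g\<in>stabilizer G \<phi> v. \<forall>y\<in>conj_subgroup G P x. g
          \<otimes>\<^bsub>G\<^esub> y \<otimes>\<^bsub>G\<^esub> inv\<^bsub>G\<^esub> g \<in>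
          conj_subgroup G P x)"
    if v: "v \<in> carrier V" and x: "x \<in> carrier G" for x
  proof -
    have S: "subgroup (stabilizer G \<phi> v) G" using stabilizer_subgroupI[OF assms(1-3) v] .
    interpret S: group "G\<lparr>carrier := stabilizer G \<phi> v\<rparr>" using S
        subgroup_imp_group by blast
    have "subgroup (conj_subgroup G P x) (G\<lparr>carrier := stabilizer G \<phi> v\<rparr>)
        \<longleftrightarrow>
        conj_subgroup G P x \<subseteq> stabilizer G \<phi> v"
      using subgroup_incl[OF subgroup_conj_subgroup[OF assms(4) x] S] subgroup.subset by fastforce
    then show ?thesis
      unfolding S.normal_inv_iff using m_inv_consistent[OF S] by auto
  qed
  then show ?thesis unfolding pts_with_normal_conjugate_def by blast
qed

section \<open>Recognizing the standard module\<close>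

lemma bit_linear:
  assumes "\<And>x y. L (x + y) = L x + (L y :: bit ^ 'm)"
  shows "matrix L *v x = L (x :: bit ^ 'n)"
proof (rule matrix_works)
  have L0: "L 0 = 0" using assms[of 0 0] by simp
  show "Vector_Spaces.linear (*s) (*s) L"
  proof (unfold_locales)
    fix c :: bit and x
    show "L (c *s x) = c *s L x" by (cases c) (simp_all add: L0)
  qed (simp_all add: assms vec.scale_right_distrib vec.scale_left_distrib)
qed

text \<open>The image of \<open>G\<close> has index at most 2 in the orthogonal group, hence
  contains the commutator subgroup. Conversely the elements mapped into the commutator subgroup form
  a subgroup of \<open>G\<close> containing all commutators, which is \<open>G\<close> by
  perfectness.\<close>

lemma Omega4_minus_standard_moduleI:
  fixes G :: "('g, 'x) monoid_scheme" and V :: "('v, 'y) monoid_scheme"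
  assumes G: "group G" and V: "group V" and \<phi>: "\<phi> \<in> hom G (AutoGroup V)"
    and card: "card (carrier G) = 60"
    and f: "f \<in> iso V (vec_group :: (bit ^ 4) monoid)"
    and Q: "\<And>g v. g \<in> carrier G \<Longrightarrow> v \<in> carrier V \<Longrightarrow>
        Q_minus (f (\<phi> g v)) = Q_minus (f v)"
    and faithful: "\<And>g. g \<in> carrier G \<Longrightarrow> (\<forall>v\<in>carrier V. \<phi> g
        v = v) \<Longrightarrow> g = \<one>\<^bsub>G\<^esub>"
    and perfect: "\<And>D. subgroup D G \<Longrightarrow>
      (\<And>g h. g \<in> carrier G \<Longrightarrow> h \<in> carrier G \<Longrightarrow> g
          \<otimes>\<^bsub>G\<^esub> h \<otimes>\<^bsub>G\<^esub> inv\<^bsub>G\<^esub> g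
          \<otimes>\<^bsub>G\<^esub> inv\<^bsub>G\<^esub> h \<in> D) \<Longrightarrow>
      D = carrier G"
  shows "Omega4_minus_standard_module G V \<phi>"
proof -
  interpret G: group G by fact
  interpret V: group V by fact
  interpret GL: group "GL :: (bit ^ 4 ^ 4) monoid" by (rule group_GL)
  note D = hom_AutoGroupD[OF G V \<phi>]
  have bij: "bij_betw f (carrier V) UNIV" using f by (simp add: iso_def vec_group_def)
  have f_add: "f (u \<otimes>\<^bsub>V\<^esub> v) = f u + f v" if "u \<in> carrier V" "v \<in>
      carrier V" for u v
    using f that by (auto simp: iso_def hom_def vec_group_def)
  define k where "k = inv_into (carrier V) f"
  have k: "k w \<in> carrier V" "f (k w) = w" for w
    using bij by (auto simp: k_def bij_betw_def f_inv_into_f inv_into_into)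
  have kf: "k (f v) = v" if "v \<in> carrier V" for v using bij that by (simp add: k_def bij_betw_def)
  have k_add: "k (w + w') = k w \<otimes>\<^bsub>V\<^esub> k w'" for w w'
    by (metis V.m_closed f_add k kf)
  define \<psi> where "\<psi> g = matrix (\<lambda>w. f (\<phi> g (k w)))" for g
  have \<psi>: "\<psi> g *v w = f (\<phi> g (k w))" if g: "g \<in> carrier G" for g w
    unfolding \<psi>_def using g by (intro bit_linear) (simp add: k_add D k f_add)
  have \<psi>_f: "\<psi> g *v f v = f (\<phi> g v)" if "g \<in> carrier G" "v \<in> carrier V" for g v
    using that by (simp add: \<psi> kf)
  have \<psi>_mult: "\<psi> (g \<otimes>\<^bsub>G\<^esub> h) = \<psi> g ** \<psi> h" if "g \<in>
      carrier G" "h \<in> carrier G" for g h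
    unfolding matrix_eq using that by (simp add: matrix_vector_mul_assoc[symmetric] \<psi> D k kf)
  have \<psi>_one: "\<psi> \<one>\<^bsub>G\<^esub> = mat 1" unfolding matrix_eq by (simp add:
      \<psi> D k)
  have inv: "invertible (\<psi> g)" if "g \<in> carrier G" for g
  proof -
    have "\<psi> g ** \<psi> (inv\<^bsub>G\<^esub> g) = \<psi> (g \<otimes>\<^bsub>G\<^esub>
        inv\<^bsub>G\<^esub> g)" using that by (intro \<psi>_mult[symmetric]) auto
    then have "\<psi> g ** \<psi> (inv\<^bsub>G\<^esub> g) = mat 1" using that \<psi>_one by simp
    then show ?thesis unfolding invertible_right_inverse by blast
  qed
  have det: "det (\<psi> g) = 1" if "g \<in> carrier G" for g
  proof -
    have "det (\<psi> g) \<noteq> 0" using inv[OF that] by (simp add: invertible_det_nz)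
    then show ?thesis by (cases "det (\<psi> g)") simp_all
  qed
  have hom: "\<psi> \<in> hom G GL" using inv \<psi>_mult by (auto simp: hom_def GL_def)
  interpret h: group_hom G "GL :: (bit ^ 4 ^ 4) monoid" \<psi>
    using hom by (unfold_locales)
  have inj: "inj_on \<psi> (carrier G)"
  proof (rule inj_onI)
    fix g h assume gh: "g \<in> carrier G" "h \<in> carrier G" "\<psi> g = \<psi> h"
    have "\<phi> (inv\<^bsub>G\<^esub> h \<otimes>\<^bsub>G\<^esub> g) v = v" if v: "v \<in>
        carrier V" for v
    proof -
      have "f (\<phi> g v) = f (\<phi> h v)" using \<psi>_f gh v by metis
      then have "\<phi> g v = \<phi> h v" using kf D gh v by metis
      then have "\<phi> (inv\<^bsub>G\<^esub> h \<otimes>\<^bsub>G\<^esub> g) v = \<phi>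
          (inv\<^bsub>G\<^esub> h) (\<phi> h v)"
        using D(2)[OF _ gh(1) v, of "inv\<^bsub>G\<^esub> h"] gh(2) by simp
      also have "\<dots> = \<phi> (inv\<^bsub>G\<^esub> h \<otimes>\<^bsub>G\<^esub> h) v"
        using D(2)[OF _ gh(2) v, of "inv\<^bsub>G\<^esub> h"] gh(2) by (simp del: G.l_inv)
      also have "\<dots> = v" using D(3)[OF v] gh(2) by simp
      finally show ?thesis .
    qed
    then have "inv\<^bsub>G\<^esub> h \<otimes>\<^bsub>G\<^esub> g = \<one>\<^bsub>G\<^esub>" using
        gh by (intro faithful) auto
    then show "g = h" using gh by (metis G.inv_closed G.inv_equality G.inv_inv)
  qed
  let ?K = "\<psi> ` carrier G"
  have K: "subgroup ?K GL" by (rule h.img_is_subgroup)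
  have KO: "?K \<subseteq> O4_minus"
  proof
    fix A assume "A \<in> ?K"
    then obtain g where g: "g \<in> carrier G" "A = \<psi> g" by blast
    have "Q_minus (\<psi> g *v x) = Q_minus x" for x using Q[OF g(1) k(1)[of x]] by (simp add:
        \<psi> g k)
    then show "A \<in> O4_minus" using g inv by (simp add: O4_minus_def)
  qed
  have "card ?K = 60" using inj card by (simp add: card_image)
  then have sub: "Omega4_minus \<subseteq> ?K"
    unfolding Omega4_minus_def
    by (intro GL.derived_subset_of_index_le_2[OF subgroup_O4_minus KO K O4_minus_card_le(1)])
       (use O4_minus_card_le(2) in simp)
  have Om: "subgroup Omega4_minus GL"
    unfolding Omega4_minus_def
    by (rule GL.derived_is_subgroup) (rule subgroup.subset[OF subgroup_O4_minus])
  have "{g \<in> carrier G. \<psi> g \<in> Omega4_minus} = carrier G"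
  proof (rule perfect)
    show "subgroup {g \<in> carrier G. \<psi> g \<in> Omega4_minus} G"
      by (rule G.subgroupI)
         (use Om in \<open>auto simp: subgroup.m_closed subgroup.m_inv_closed subgroup.one_closed
            intro!: exI[of _ "\<one>\<^bsub>G\<^esub>"]\<close>)
    fix g h assume gh: "g \<in> carrier G" "h \<in> carrier G"
    have "\<psi> g \<otimes>\<^bsub>GL\<^esub> \<psi> h \<otimes>\<^bsub>GL\<^esub>
        inv\<^bsub>GL\<^esub> (\<psi> g) \<otimes>\<^bsub>GL\<^esub> inv\<^bsub>GL\<^esub> (\<psi>
        h) \<in> derived_set GL O4_minus"
      using gh KO by blast
    then have "\<psi> g \<otimes>\<^bsub>GL\<^esub> \<psi> h \<otimes>\<^bsub>GL\<^esub>
        inv\<^bsub>GL\<^esub> (\<psi> g) \<otimes>\<^bsub>GL\<^esub> inv\<^bsub>GL\<^esub> (\<psi>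
        h) \<in> Omega4_minus"
      unfolding Omega4_minus_def derived_def by (rule generate.incl)
    then show "g \<otimes>\<^bsub>G\<^esub> h \<otimes>\<^bsub>G\<^esub> inv\<^bsub>G\<^esub> g
        \<otimes>\<^bsub>G\<^esub> inv\<^bsub>G\<^esub> h \<in> {g \<in> carrier G. \<psi> g \<in>
        Omega4_minus}"
      using gh by simp
  qed
  then have "?K = Omega4_minus" using sub by blast
  moreover have "\<psi> \<in> hom G (SL :: (bit ^ 4 ^ 4) monoid)"
    using det \<psi>_mult by (auto simp: hom_def SL_def)
  moreover have "\<forall>g\<in>carrier G. \<forall>v\<in>carrier V. f (\<phi> g v) = \<psi> g *v f
      v" using \<psi>_f by simp
  ultimately show ?thesis
    unfolding Omega4_minus_standard_module_def using inj f by blast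
qed

section \<open>The special linear group as an abstract group\<close>

lemma SL_simps: "carrier SL = {A. det A = 1}" "A \<otimes>\<^bsub>SL\<^esub> B = A ** B"
    "\<one>\<^bsub>SL\<^esub> = mat 1"
  by (simp_all add: SL_def)

lemma group_SL2: "group (SL :: ('f::field ^ 2 ^ 2) monoid)"
proof (rule groupI)
  fix A :: "'f ^ 2 ^ 2" assume "A \<in> carrier SL"
  then show "\<exists>B\<in>carrier SL. B \<otimes>\<^bsub>SL\<^esub> A = \<one>\<^bsub>SL\<^esub>"
    by (intro bexI[of _ "adj2 A"]) (simp_all add: SL_simps adj2_inverse)
qed (auto simp: SL_simps det_mul matrix_mul_assoc)

lemma inv_SL2: "det A = 1 \<Longrightarrow> inv\<^bsub>SL\<^esub> A = adj2 A"
  by (rule group.inv_equality[OF group_SL2]) (simp_all add: SL_simps adj2_inverse)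

lemma subgroup_SL2I:
  assumes "S \<subseteq> {A :: 'f::field ^ 2 ^ 2. det A = 1}" "mat 1 \<in> S"
    and "\<And>A B. A \<in> S \<Longrightarrow> B \<in> S \<Longrightarrow> A ** B \<in> S"
        "\<And>A. A \<in> S \<Longrightarrow> adj2 A \<in> S"
  shows "subgroup S SL"
  by (rule group.subgroupI[OF group_SL2]) (use assms in \<open>auto simp: SL_simps inv_SL2
      subset_iff\<close>)

lemma subgroup_unip: "subgroup (unip e) SL"
proof (rule subgroup_SL2I)
  fix A assume "A \<in> unip e"
  then show "adj2 A \<in> unip e" using adj2_mult_vec(1)[of A e] by (simp add: unip_def)
qed (auto simp: unip_def det_mul matrix_vector_mul_assoc[symmetric])

lemma adj2_mat_1 [simp]: "adj2 (mat 1) = mat 1"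
  by (simp add: mat_1_eq)

lemma pow_conj_SL2:
  assumes "det Q = 1" "det A = 1"
  shows "(Q ** A ** adj2 Q) [^]\<^bsub>SL\<^esub> (n::nat) = Q ** (A [^]\<^bsub>SL\<^esub> n) **
      adj2 Q"
proof -
  interpret group "SL :: ('a ^ 2 ^ 2) monoid" by (rule group_SL2)
  show ?thesis
  proof (induction n)
    case 0
    then show ?case using assms by (simp add: SL_simps adj2_inverse)
  next
    case (Suc n)
    have "Q ** Z ** adj2 Q ** (Q ** A ** adj2 Q) = Q ** (Z ** A) ** adj2 Q" for Z
      using adj2_inverse(2)[OF assms(1)] by (metis matrix_mul_assoc matrix_mul_rid)
    then show ?case using Suc by (simp add: SL_simps)
  qed
qed

text \<open>Perfectness of SL2 over a field with a nonzero scalar of square other than 1: the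
  commutators of \<open>diag2 l\<close> with elementary matrices are again all the elementary
  matrices, and these generate.\<close>

lemma sl2_generated_by_commutators:
  fixes D :: "('f::field ^ 2 ^ 2) set" and l :: 'f
  assumes l: "l \<noteq> 0" "l * l \<noteq> 1"
    and mult: "\<And>A B. A \<in> D \<Longrightarrow> B \<in> D \<Longrightarrow> A ** B \<in> D"
    and comm: "\<And>A B. det A = 1 \<Longrightarrow> det B = 1 \<Longrightarrow> A ** B ** adj2 A
        ** adj2 B \<in> D"
    and A: "det A = 1"
  shows "A \<in> D"
proof -
  have up: "mat2 1 x 0 1 \<in> D" for x
  proof -
    \<comment> \<open>Conjugation by \<open>diag2 l\<close> scales the upper right entry by
      \<open>l * l\<close>, so the commutator has entry \<open>(l * l - 1) * y\<close>.\<close>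
    define y where "y = x / (l * l - 1)"
    have "x = (l * l - 1) * y" using l by (simp add: y_def)
    then have "diag2 l ** mat2 1 y 0 1 ** adj2 (diag2 l) ** adj2 (mat2 1 y 0 1) = mat2 1 x 0 1"
      using l by (simp add: diag2_def algebra_simps)
    moreover have "diag2 l ** mat2 1 y 0 1 ** adj2 (diag2 l) ** adj2 (mat2 1 y 0 1) \<in> D"
      using l by (intro comm) simp_all
    ultimately show ?thesis by (simp only:)
  qed
  have low: "mat2 1 0 x 1 \<in> D" for x
  proof -
    define k where "k = inverse l"
    have dl: "diag2 l = mat2 l 0 0 k" and kl: "k * l = 1" "l * k = 1" "\<And>z. k * (l * z) = z"
      using l by (simp_all add: diag2_def k_def)
    have k: "k * k \<noteq> 1"
    proof
      assume "k * k = 1"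
      then have "l * l = l * (k * k) * l" by simp
      also have "\<dots> = 1" using kl by (simp add: mult.assoc)
      finally show False using l by simp
    qed
    define y where "y = x / (k * k - 1)"
    have "x = (k * k - 1) * y" using k by (simp add: y_def)
    then have "diag2 l ** mat2 1 0 y 1 ** adj2 (diag2 l) ** adj2 (mat2 1 0 y 1) = mat2 1 0 x 1"
      by (simp add: dl kl algebra_simps)
    moreover have "diag2 l ** mat2 1 0 y 1 ** adj2 (diag2 l) ** adj2 (mat2 1 0 y 1) \<in> D"
      using l by (intro comm) simp_all
    ultimately show ?thesis by (simp only:)
  qed
  have c_nonzero: "mat2 a b c d \<in> D" if "c \<noteq> 0" "a * d - b * c = 1" for a b c d
  proof -
    \<comment> \<open>An upper, a lower and an upper elementary matrix multiply to diagonal entries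
      \<open>1 + x * c\<close> and \<open>1 + c * y\<close>; this determines \<open>x\<close> and
      \<open>y\<close>.\<close>
    define x y where "x = (a - 1) / c" and "y = (d - 1) / c"
    have xy: "x * c = a - 1" "c * y = d - 1" using that(1) by (simp_all add: x_def y_def)
    have bc: "b * c = a * d - 1" unfolding that(2)[symmetric] by simp
    have "c * (a * y + x) = a * (c * y) + x * c" by (simp add: algebra_simps)
    also have "\<dots> = a * (d - 1) + (a - 1)" by (simp only: xy)
    also have "\<dots> = a * d - 1" by (simp add: algebra_simps)
    also have "\<dots> = c * b" unfolding bc[symmetric] by (rule mult.commute)
    finally have "a * y + x = b" using that(1) by simp
    then have "mat2 1 x 0 1 ** mat2 1 0 c 1 ** mat2 1 y 0 1 = mat2 a b c d" by (simp add: xy)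
    moreover have "mat2 1 x 0 1 ** mat2 1 0 c 1 ** mat2 1 y 0 1 \<in> D" by (intro mult up low)
    ultimately show ?thesis by (simp only:)
  qed
  obtain a b c d where A_eq: "A = mat2 a b c d" by (rule mat2_cases)
  show ?thesis
  proof (cases "c = 0")
    case False
    then show ?thesis using c_nonzero A by (simp add: A_eq)
  next
    case True
    then have ad: "a * d = 1" using A by (simp add: A_eq)
    then have "d \<noteq> 0" by auto
    \<comment> \<open>Right multiplication by \<open>mat2 1 0 1 1\<close> makes the lower left entry
      \<open>d\<close>, which is nonzero; \<open>mat2 1 0 (- 1) 1\<close> undoes it.\<close>
    have "mat2 (a + b) b d d \<in> D"
      by (rule c_nonzero[OF \<open>d \<noteq> 0\<close>]) (use ad in \<open>simp add:
          distrib_right\<close>)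
    then have "mat2 (a + b) b d d ** mat2 1 0 (- 1) 1 \<in> D" using low mult by blast
    then show ?thesis using True by (simp add: A_eq)
  qed
qed

text \<open>The trace is \<open>2 * c\<close> with \<open>c * c = 1\<close>, so \<open>c\<close> is
  a double eigenvalue and \<open>g ** g\<close> fixes its eigenvector.\<close>

lemma double_eigenvalue_if_trace_square_4:
  fixes g :: "'f::field ^ 2 ^ 2"
  assumes "det g = 1" "trace g * trace g = 4"
  obtains e where "e \<noteq> 0" "g ** g \<in> unip e"
proof -
  obtain p q r w where g: "g = mat2 p q r w" by (rule mat2_cases)
  have "(trace g - 2) * (trace g + 2) = 0" using assms(2) by (simp add: algebra_simps)
  then have "trace g = 2 * 1 \<or> trace g = 2 * (- 1)" by (auto simp: eq_neg_iff_add_eq_0)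
  then obtain c where c: "c * c = 1" "trace g = 2 * c" by (metis mult_1 minus_mult_minus)
  then have w: "w = 2 * c - p" by (simp add: g eq_diff_eq add.commute)
  have det: "p * w - q * r = 1" using assms(1) by (simp add: g)
  have qr: "r * q = (p - c) * (c - p)"
  proof -
    have "(p - c) * (c - p) = p * w - c * c" by (simp add: w algebra_simps)
    then show ?thesis using det c(1) by (simp add: algebra_simps)
  qed
  have "\<exists>e. e \<noteq> 0 \<and> g *v e = c *s e"
  proof (cases "q = 0 \<and> p = c")
    case True
    then have "g *v vec2 0 1 = c *s vec2 0 1" by (simp add: g w)
    then show ?thesis by (intro exI[of _ "vec2 0 1"]) simp
  next
    case False
    \<comment> \<open>This vector is annihilated by the first row of \<open>g - c\<close>; the
      second row follows from \<open>qr\<close>.\<close>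
    have "g *v vec2 q (c - p) = c *s vec2 q (c - p)"
      using qr by (simp add: g w algebra_simps)
    then show ?thesis using False by (intro exI[of _ "vec2 q (c - p)"]) auto
  qed
  then obtain e where e: "e \<noteq> 0" "g *v e = c *s e" by blast
  have "(g ** g) *v e = (c * c) *s e" using e(2) by (simp add: matrix_vector_mul_assoc[symmetric]
      vec.scale)
  then show ?thesis using that[OF e(1)] c assms(1) by (simp add: unip_def det_mul)
qed

lemma card_field_of_card_sl2:
  assumes "card {A :: 'f::{field,finite} ^ 2 ^ 2. det A = 1} = 60"
  shows "CARD('f) = 4"
proof -
  let ?q = "CARD('f)"
  have eq: "?q * (?q * ?q - 1) = 60" using assms card_sl2[where 'f='f] by simp
  have "\<not> ?q \<ge> 5"
  proof
    assume "?q \<ge> 5"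
    then have "5 * 5 \<le> ?q * ?q" by (intro mult_le_mono)
    then have "24 \<le> ?q * ?q - 1" by simp
    then have "5 * 24 \<le> ?q * (?q * ?q - 1)" using \<open>?q \<ge> 5\<close> by (intro
        mult_le_mono)
    then show False using eq by simp
  qed
  then have "?q = 0 \<or> ?q = 1 \<or> ?q = 2 \<or> ?q = 3 \<or> ?q = 4" by arith
  then show ?thesis using eq by auto
qed

section \<open>Groups isomorphic to the special linear group acting on a group\<close>

locale sl2_group_action = G: group G + V: group V
  for G :: "('g, 'x) monoid_scheme" and V :: "('v, 'y) monoid_scheme" +
  fixes \<phi> :: "'g \<Rightarrow> 'v \<Rightarrow> 'v" and \<eta> :: "'f::{field,finite} ^ 2 ^ 2
      \<Rightarrow> 'g"
  assumes iso_\<eta>: "\<eta> \<in> iso SL G" and hom_\<phi>: "\<phi> \<in> hom G (AutoGroup V)"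
    and finite_V: "finite (carrier V)"
begin

definition act :: "'f ^ 2 ^ 2 \<Rightarrow> 'v \<Rightarrow> 'v"
  where "act A v = \<phi> (\<eta> A) v"

lemmas \<phi>D = hom_AutoGroupD[OF G.is_group V.is_group hom_\<phi>]

lemma \<eta>_closed [simp]: "det A = 1 \<Longrightarrow> \<eta> A \<in> carrier G"
  using iso_\<eta> by (auto simp: iso_def hom_def SL_simps)

lemma \<eta>_mult: "det A = 1 \<Longrightarrow> det B = 1 \<Longrightarrow> \<eta> (A ** B) =
    \<eta> A \<otimes>\<^bsub>G\<^esub> \<eta> B"
  using iso_\<eta> by (auto simp: iso_def hom_def SL_simps)

lemma \<eta>_one [simp]: "\<eta> (mat 1) = \<one>\<^bsub>G\<^esub>"
  using hom_one[of \<eta> SL G] iso_\<eta> group_SL2 G.is_group by (simp add: iso_def SL_simps)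

lemma \<eta>_adj2: "det A = 1 \<Longrightarrow> \<eta> (adj2 A) = inv\<^bsub>G\<^esub> (\<eta> A)"
  by (rule G.inv_equality[symmetric]) (simp_all flip: \<eta>_mult add: adj2_inverse)

lemma \<eta>_inj: "det A = 1 \<Longrightarrow> det B = 1 \<Longrightarrow> \<eta> A = \<eta> B
    \<longleftrightarrow> A = B"
  using iso_\<eta> by (auto simp: iso_def bij_betw_def inj_on_def SL_simps)

lemma \<eta>_image: "\<eta> ` {A. det A = 1} = carrier G"
  using iso_\<eta> by (simp add: iso_def bij_betw_def SL_simps)

lemma \<eta>_surj:
  assumes "g \<in> carrier G"
  shows "\<exists>A. det A = 1 \<and> g = \<eta> A"
proof -
  have "g \<in> \<eta> ` {A. det A = 1}" using assms unfolding \<eta>_image .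
  then obtain A where A: "g = \<eta> A" "A \<in> {A. det A = 1}" by (rule imageE)
  then have "det A = 1" by simp
  then show ?thesis using A(1) by (intro exI[of _ A] conjI)
qed

sublocale sl2_action V act
proof (intro sl2_action.intro sl2_action_axioms.intro V.is_group)
  show "act A v \<in> carrier V" if "det A = 1" "v \<in> carrier V" for A v
    unfolding act_def by (rule \<phi>D(1)) (simp_all add: that)
  show "act (A ** B) v = act A (act B v)" if "det A = 1" "det B = 1" "v \<in> carrier V" for A B v
    unfolding act_def \<eta>_mult[OF that(1,2)] by (rule \<phi>D(2)) (simp_all add: that)
  show "act (mat 1) v = v" if "v \<in> carrier V" for v
    unfolding act_def \<eta>_one by (rule \<phi>D(3)) (rule that)
  show "act A (u \<otimes>\<^bsub>V\<^esub> v) = act A u \<otimes>\<^bsub>V\<^esub> act A v"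
    if "det A = 1" "u \<in> carrier V" "v \<in> carrier V" for A u v
    unfolding act_def by (rule \<phi>D(4)) (simp_all add: that)
qed (rule finite_V)

lemma stabilizer_iff: "det A = 1 \<Longrightarrow> \<eta> A \<in> stabilizer G \<phi> v
    \<longleftrightarrow> A \<in> Stab v"
  by (simp add: stabilizer_def Stab_def act_def)

lemma stabilizer_eq: "stabilizer G \<phi> v = \<eta> ` Stab v"
proof
  show "\<eta> ` Stab v \<subseteq> stabilizer G \<phi> v"
  proof (rule image_subsetI)
    fix A assume "A \<in> Stab v"
    then show "\<eta> A \<in> stabilizer G \<phi> v" using stabilizer_iff[OF Stab_det] by blast
  qed
  show "stabilizer G \<phi> v \<subseteq> \<eta> ` Stab v"
  proof
    fix g assume g: "g \<in> stabilizer G \<phi> v"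
    then have "g \<in> carrier G" by (simp add: stabilizer_def)
    then obtain A where A: "det A = 1" "g = \<eta> A" using \<eta>_surj by blast
    then have "A \<in> Stab v" using g stabilizer_iff[OF A(1)] by simp
    then show "g \<in> \<eta> ` Stab v" using A(2) by blast
  qed
qed

lemma order_G: "order G = CARD('f) * (CARD('f) * CARD('f) - 1)"
proof -
  have "card (\<eta> ` {A. det A = 1}) = card {A :: 'f ^ 2 ^ 2. det A = 1}"
    by (rule card_image) (rule inj_onI, simp add: \<eta>_inj)
  then show ?thesis by (simp add: order_def \<eta>_image card_sl2)
qed

lemma finite_G: "finite (carrier G)"
  unfolding \<eta>_image[symmetric] by simp

definition pre :: "'g set \<Rightarrow> ('f ^ 2 ^ 2) set"
  where "pre P = {A. det A = 1 \<and> \<eta> A \<in> P}"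

lemma pre_det: "A \<in> pre P \<Longrightarrow> det A = 1" by (simp add: pre_def)

lemma inj_on_\<eta>: "(\<And>A. A \<in> S \<Longrightarrow> det A = 1) \<Longrightarrow> inj_on
    \<eta> S"
  by (rule inj_onI) (simp add: \<eta>_inj)

lemma \<eta>_pre:
  assumes "P \<subseteq> carrier G"
  shows "\<eta> ` pre P = P"
proof
  show "\<eta> ` pre P \<subseteq> P" by (auto simp: pre_def)
  show "P \<subseteq> \<eta> ` pre P"
  proof
    fix p assume "p \<in> P"
    then obtain A where "det A = 1" "p = \<eta> A" using \<eta>_surj assms by blast
    then show "p \<in> \<eta> ` pre P" using \<open>p \<in> P\<close> by (auto simp: pre_def)
  qed
qed

lemma card_pre:
  assumes "P \<subseteq> carrier G"
  shows "card (pre P) = card P"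
proof -
  have "inj_on \<eta> (pre P)" by (rule inj_on_\<eta>) (rule pre_det)
  then show ?thesis using card_image \<eta>_pre[OF assms] by fastforce
qed

lemma subgroup_pre:
  assumes "subgroup P G"
  shows "subgroup (pre P) SL"
  by (rule subgroup_SL2I)
     (use assms in \<open>auto simp: pre_def det_mul \<eta>_mult \<eta>_adj2 subgroup.m_closed
         subgroup.m_inv_closed
        subgroup.one_closed\<close>)

lemma conj_subgroup_\<eta>:
  assumes "P \<subseteq> carrier G" "det Z = 1"
  shows "conj_subgroup G P (\<eta> Z) = \<eta> ` ((\<lambda>A. adj2 Z ** A ** Z) ` pre P)"
proof -
  have "conj_subgroup G P (\<eta> Z) = (\<lambda>p. inv\<^bsub>G\<^esub> (\<eta> Z)
      \<otimes>\<^bsub>G\<^esub> p \<otimes>\<^bsub>G\<^esub> \<eta> Z) ` (\<eta> ` pre P)"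
    using assms by (simp add: G.conj_subgroup_eq \<eta>_pre)
  also have "\<dots> = \<eta> ` ((\<lambda>A. adj2 Z ** A ** Z) ` pre P)"
    unfolding image_image by (rule image_cong) (use assms(2) in \<open>simp_all add: pre_det
        \<eta>_mult \<eta>_adj2 det_mul\<close>)
  finally show ?thesis .
qed

text \<open>Pulling stabilizers and the conjugating element back along \<open>\<eta>\<close>
  describes the two point sets by matrices alone.\<close>

lemma pts_iff:
  assumes "subgroup P G"
  shows "v \<in> pts_with_normal_conjugate G V \<phi> P \<longleftrightarrow> v \<in> carrier V \<and>
    (\<exists>Z. det Z = 1 \<and> (\<lambda>A. adj2 Z ** A ** Z) ` pre P \<subseteq> Stab v \<and>
      (\<forall>B\<in>Stab v. \<forall>C\<in>(\<lambda>A. adj2 Z ** A ** Z) ` pre P. B ** C ** adj2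
          B \<in> (\<lambda>A. adj2 Z ** A ** Z) ` pre P))"
proof -
  have P: "P \<subseteq> carrier G" using assms by (rule subgroup.subset)
  have det: "det C = 1" if "C \<in> (\<lambda>A. adj2 Z ** A ** Z) ` pre P" "det Z = 1" for C Z
    using that by (auto simp: det_conj pre_det)
  have sub: "\<eta> ` S \<subseteq> \<eta> ` S' \<longleftrightarrow> S \<subseteq> S'" if
      "\<And>A. A \<in> S \<Longrightarrow> det A = 1" "\<And>A. A \<in> S' \<Longrightarrow> det A
      = 1" for S S'
    using that \<eta>_inj by (auto simp: subset_iff image_iff)
  have mem: "\<eta> A \<in> \<eta> ` S \<longleftrightarrow> A \<in> S" if "\<And>A. A \<in> S
      \<Longrightarrow> det A = 1" "det A = 1" for S A
    using that \<eta>_inj by (auto simp: image_iff)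
  have conj_iff: "conj_subgroup G P (\<eta> Z) \<subseteq> stabilizer G \<phi> v \<and>
      (\<forall>g\<in>stabilizer G \<phi> v. \<forall>y\<in>conj_subgroup G P (\<eta> Z). g
          \<otimes>\<^bsub>G\<^esub> y \<otimes>\<^bsub>G\<^esub> inv\<^bsub>G\<^esub> g \<in>
          conj_subgroup G P (\<eta> Z)) \<longleftrightarrow>
      (\<lambda>A. adj2 Z ** A ** Z) ` pre P \<subseteq> Stab v \<and>
      (\<forall>B\<in>Stab v. \<forall>C\<in>(\<lambda>A. adj2 Z ** A ** Z) ` pre P. B ** C ** adj2
          B \<in> (\<lambda>A. adj2 Z ** A ** Z) ` pre P)"
    if dZ: "det Z = 1" for Z
  proof -
    define S where "S = (\<lambda>A. adj2 Z ** A ** Z) ` pre P"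
    have dS: "det C = 1" if "C \<in> S" for C using det that dZ unfolding S_def by blast
    have "\<eta> B \<otimes>\<^bsub>G\<^esub> \<eta> C \<otimes>\<^bsub>G\<^esub>
        inv\<^bsub>G\<^esub> (\<eta> B) \<in> \<eta> ` S \<longleftrightarrow> B ** C ** adj2 B
        \<in> S" if "B \<in> Stab v" "C \<in> S" for B C
    proof -
      have d: "det B = 1" "det C = 1" using that dS Stab_det by blast+
      then have "\<eta> B \<otimes>\<^bsub>G\<^esub> \<eta> C \<otimes>\<^bsub>G\<^esub>
          inv\<^bsub>G\<^esub> (\<eta> B) = \<eta> (B ** C ** adj2 B)"
        by (simp add: \<eta>_mult \<eta>_adj2 det_mul)
      then show ?thesis using mem[OF dS] d by (simp add: det_mul)
    qed
    then have "(\<forall>g\<in>\<eta> ` Stab v. \<forall>y\<in>\<eta> ` S. g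
        \<otimes>\<^bsub>G\<^esub> y \<otimes>\<^bsub>G\<^esub> inv\<^bsub>G\<^esub> g \<in> \<eta>
        ` S) \<longleftrightarrow>
        (\<forall>B\<in>Stab v. \<forall>C\<in>S. B ** C ** adj2 B \<in> S)"
      unfolding ball_simps by blast
    moreover have "\<eta> ` S \<subseteq> \<eta> ` Stab v \<longleftrightarrow> S \<subseteq> Stab
        v" by (rule sub[OF dS Stab_det])
    ultimately show ?thesis
      unfolding conj_subgroup_\<eta>[OF P dZ] stabilizer_eq S_def[symmetric] by (simp only:)
  qed
  let ?\<Phi> = "\<lambda>x. conj_subgroup G P x \<subseteq> stabilizer G \<phi> v \<and>
      (\<forall>g\<in>stabilizer G \<phi> v. \<forall>y\<in>conj_subgroup G P x. g
          \<otimes>\<^bsub>G\<^esub> y \<otimes>\<^bsub>G\<^esub> inv\<^bsub>G\<^esub> g \<in>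
          conj_subgroup G P x)"
  let ?\<Psi> = "\<lambda>Z. (\<lambda>A. adj2 Z ** A ** Z) ` pre P \<subseteq> Stab v \<and>
      (\<forall>B\<in>Stab v. \<forall>C\<in>(\<lambda>A. adj2 Z ** A ** Z) ` pre P. B ** C ** adj2
          B \<in> (\<lambda>A. adj2 Z ** A ** Z) ` pre P)"
  have "(\<exists>x\<in>carrier G. ?\<Phi> x) \<longleftrightarrow> (\<exists>Z. det Z = 1 \<and>
      ?\<Psi> Z)"
  proof
    assume "\<exists>x\<in>carrier G. ?\<Phi> x"
    then obtain x where x: "x \<in> carrier G" "?\<Phi> x" by (elim bexE)
    obtain Z where Z: "det Z = 1" "x = \<eta> Z" using \<eta>_surj[OF x(1)] by (elim exE conjE)
    have "?\<Psi> Z" using x(2) unfolding Z(2) by (rule conj_iff[OF Z(1), THEN iffD1])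
    then show "\<exists>Z. det Z = 1 \<and> ?\<Psi> Z" using Z(1) by (intro exI[of _ Z] conjI)
        simp_all
  next
    assume "\<exists>Z. det Z = 1 \<and> ?\<Psi> Z"
    then obtain Z where Z: "det Z = 1" "?\<Psi> Z" by (elim exE conjE) (rule that, assumption, rule
        conjI)
    have "?\<Phi> (\<eta> Z)" using Z(2) by (rule conj_iff[OF Z(1), THEN iffD2])
    then show "\<exists>x\<in>carrier G. ?\<Phi> x" by (rule bexI) (rule \<eta>_closed[OF Z(1)])
  qed
  then show ?thesis
    unfolding pts_with_normal_conjugate_iff[OF G.is_group V.is_group hom_\<phi> assms] by (rule
        arg_cong)
qed

section \<open>Sylow subgroups as groups of matrices\<close>

lemma p_subgroup_pre:
  assumes "sylow_subgroup G p P"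
  shows "subgroup P G" "subgroup (pre P) SL" "card (pre P) = p ^ multiplicity p (order G)"
proof -
  show P: "subgroup P G" using assms by (simp add: sylow_subgroup_def)
  then show "subgroup (pre P) SL" by (rule subgroup_pre)
  show "card (pre P) = p ^ multiplicity p (order G)"
    using card_pre[OF subgroup.subset[OF P]] assms by (simp add: sylow_subgroup_def)
qed

lemma pre_fixed_points:
  assumes P: "sylow_subgroup G p P" and p: "Factorial_Ring.prime p" and E: "finite E"
    and "\<And>A x. A \<in> pre P \<Longrightarrow> x \<in> E \<Longrightarrow> op A x \<in> E"
    and "\<And>A B x. A \<in> pre P \<Longrightarrow> B \<in> pre P \<Longrightarrow> x \<in> E
        \<Longrightarrow> op (A ** B) x = op A (op B x)"
    and "\<And>x. x \<in> E \<Longrightarrow> op (mat 1) x = x"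
  shows "card E mod p = card {x \<in> E. \<forall>A \<in> pre P. op A x = x} mod p"
proof -
  let ?H = "SL\<lparr>carrier := pre P\<rparr>"
  have "group ?H" using group.subgroup_imp_group[OF group_SL2 p_subgroup_pre(2)[OF P]] .
  moreover have "order ?H = p ^ multiplicity p (order G)" using p_subgroup_pre(3)[OF P] by (simp
      add: order_def)
  ultimately show ?thesis
    using p_group_fixed_points[of ?H p _ E op] assms by (simp add: SL_simps)
qed

text \<open>A \<open>t\<close>-group acting on the \<open>q * q\<close> vectors fixes a multiple of
  \<open>t\<close> of them, hence some nonzero \<open>e\<close>. As \<open>t\<close> does not divide
  \<open>q * q - 1\<close>, the Sylow order is \<open>q\<close>, which is also the order of
  \<open>unip e\<close>.\<close>

lemma sylow_t_eq_unip:
  assumes t: "Factorial_Ring.prime t" "CARD('f) = t ^ a" "a > 0" and T: "sylow_subgroup G t T"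
  obtains e where "e \<noteq> 0" "pre T = unip e"
proof -
  let ?q = "CARD('f)"
  have td: "t dvd ?q" using t by (simp add: dvd_power)
  have q1: "?q * ?q > 1"
  proof -
    have "?q \<ge> 2" using t(1) prime_ge_2_nat dvd_imp_le[OF td] by (metis le_trans
        zero_less_card_finite)
    then have "2 * 2 \<le> ?q * ?q" by (intro mult_le_mono)
    then show ?thesis by simp
  qed
  have nd: "\<not> t dvd ?q * ?q - 1"
  proof
    assume *: "t dvd ?q * ?q - 1"
    have "t dvd ?q * ?q" using td by simp
    then have "t dvd ?q * ?q - (?q * ?q - 1)" using * by (rule dvd_diff_nat)
    then have "t dvd 1" using q1 by simp
    then show False using t(1) by simp
  qed
  have "multiplicity t (order G) = multiplicity t ?q + multiplicity t (?q * ?q - 1)"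
    unfolding order_G by (rule prime_elem_multiplicity_mult_distrib) (use t(1) q1 in auto)
  also have "\<dots> = a" using t(1) nd unfolding t(2) by (simp add: not_dvd_imp_multiplicity_0)
  finally have card: "card (pre T) = ?q" using p_subgroup_pre(3)[OF T] t(2) by simp
  let ?F = "{x :: 'f ^ 2. \<forall>A \<in> pre T. A *v x = x}"
  have "CARD('f ^ 2) mod t = card {x \<in> UNIV. \<forall>A \<in> pre T. A *v x = x} mod t"
    by (rule pre_fixed_points[OF T t(1)]) (auto simp: matrix_vector_mul_assoc)
  moreover have "t dvd CARD('f ^ 2)" using td by (simp add: power2_eq_square)
  ultimately have "t dvd card ?F" by (simp add: dvd_eq_mod_eq_0)
  moreover have "0 \<in> ?F" by simp
  ultimately have "card ?F \<noteq> 1" using t(1) by auto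
  then have "?F \<noteq> {0}" by auto
  then obtain e where e: "e \<noteq> 0" "\<forall>A \<in> pre T. A *v e = e" using \<open>0 \<in>
      ?F\<close> by blast
  then have "pre T \<subseteq> unip e" by (auto simp: unip_def pre_det)
  moreover have "card (unip e) = card (pre T)" using card card_unip[OF e(1)] by simp
  ultimately have "pre T = unip e" by (intro card_subset_eq) auto
  then show ?thesis using that e(1) by blast
qed

lemma unip_subset_imp:
  assumes "unip e \<subseteq> unip (e' :: 'f ^ 2)"
  shows "cross e e' = 0"
proof -
  obtain p q where e: "e = vec2 p q" by (rule vec2_cases)
  obtain x y where e': "e' = vec2 x y" by (rule vec2_cases)
  \<comment> \<open>The transvection with centre \<open>e\<close>; it sends \<open>e'\<close> to
    \<open>e' + cross e e' *s e\<close>.\<close>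
  define A where "A = mat2 (1 - p * q) (p * p) (- q * q) (1 + p * q)"
  have "A \<in> unip e" by (simp add: unip_def A_def e algebra_simps)
  then have "A *v e' = e'" using assms by (auto simp: unip_def)
  then have "p * cross e e' = 0" "q * cross e e' = 0"
    by (simp_all add: A_def e e' algebra_simps)
  then show ?thesis by (auto simp: e e')
qed

text \<open>Conjugation by \<open>B\<close> carries \<open>unip e\<close> to
  \<open>unip (B *v e)\<close>, so \<open>B\<close> normalizes it exactly when it preserves the line
  of \<open>e\<close>. By transitivity on nonzero vectors every \<open>unip e\<close> is a conjugate
  of \<open>pre T\<close>.\<close>

lemma V_II_iff_typeII:
  assumes T: "sylow_subgroup G t T" and e0: "e0 \<noteq> 0" "pre T = unip e0"
  shows "v \<in> pts_with_normal_conjugate G V \<phi> T \<longleftrightarrow> typeII v"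
proof -
  have conj: "(\<lambda>A. adj2 Z ** A ** Z) ` unip e0 = unip (adj2 Z *v e0)" if Z: "det Z = 1" for Z
  proof -
    have "B \<in> unip (adj2 Z *v e0) \<longleftrightarrow> B \<in> (\<lambda>A. adj2 Z ** A ** Z)
        ` unip e0" for B
    proof -
      have "B \<in> unip (adj2 Z *v e0) \<longleftrightarrow> Z ** B ** adj2 Z \<in> unip e0"
        using unip_mult_vec[of "adj2 Z" B e0] Z by simp
      also have "\<dots> \<longleftrightarrow> B \<in> (\<lambda>A. adj2 Z ** A ** Z) ` unip e0"
        using conj_cancel[OF Z] by (metis (no_types, lifting) image_iff)
      finally show ?thesis .
    qed
    then show ?thesis by blast
  qed
  have normalizes: "(\<forall>C\<in>unip e. B ** C ** adj2 B \<in> unip e) \<longleftrightarrow>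
      cross e (B *v e) = 0"
    if B: "det B = 1" and e: "e \<noteq> 0" for B :: "'f ^ 2 ^ 2" and e
  proof
    assume *: "\<forall>C\<in>unip e. B ** C ** adj2 B \<in> unip e"
    have "unip (B *v e) \<subseteq> unip e"
    proof
      fix A assume "A \<in> unip (B *v e)"
      then have "adj2 B ** A ** B \<in> unip e" using unip_mult_vec[OF B] by simp
      then have "B ** (adj2 B ** A ** B) ** adj2 B \<in> unip e" using * by blast
      then show "A \<in> unip e" by (simp add: conj_cancel B)
    qed
    then have "cross (B *v e) e = 0" by (rule unip_subset_imp)
    then show "cross e (B *v e) = 0" by (subst cross_commute) simp
  next
    assume "cross e (B *v e) = 0"
    then obtain c where c: "B *v e = c *s e" using e by (auto simp: cross_eq_0_iff)
    then have "c \<noteq> 0" using e sl2_mult_vec_eq_0_iff[OF B, of e] by auto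
    then have "unip (B *v e) = unip e" by (simp add: c unip_smult)
    moreover have "B ** C ** adj2 B \<in> unip (B *v e)" if "C \<in> unip e" for C
      using that by (simp add: unip_mult_vec[OF B] conj_cancel[OF B])
    ultimately show "\<forall>C\<in>unip e. B ** C ** adj2 B \<in> unip e" by simp
  qed
  have ex: "\<exists>Z. det Z = 1 \<and> adj2 Z *v e0 = e" if e: "e \<noteq> 0" for e :: "'f ^ 2"
  proof -
    obtain P where P: "det P = 1" "P *v vec2 1 0 = e" using obtain_sl2_image[OF e] .
    obtain P0 where P0: "det P0 = 1" "P0 *v vec2 1 0 = e0" using obtain_sl2_image[OF e0(1)] .
    have "adj2 (P0 ** adj2 P) *v e0 = e"
      using P adj2_mult_vec(1)[OF P0(1), of "vec2 1 0"] P0(2)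
      by (simp add: adj2_mult matrix_vector_mul_assoc[symmetric])
    moreover have "det (P0 ** adj2 P) = 1" using P P0 by (simp add: det_mul)
    ultimately show ?thesis by blast
  qed
  have *: "v \<in> pts_with_normal_conjugate G V \<phi> T \<longleftrightarrow> v \<in> carrier V
      \<and>
      (\<exists>Z. det Z = 1 \<and> unip (adj2 Z *v e0) \<subseteq> Stab v \<and>
        (\<forall>B\<in>Stab v. \<forall>C\<in>unip (adj2 Z *v e0). B ** C ** adj2 B \<in> unip
            (adj2 Z *v e0)))"
    unfolding pts_iff[OF p_subgroup_pre(1)[OF T]] e0(2) using conj by (metis (no_types, lifting))
  show ?thesis
  proof
    assume "v \<in> pts_with_normal_conjugate G V \<phi> T"
    then obtain Z where Z: "v \<in> carrier V" "det Z = 1" "unip (adj2 Z *v e0) \<subseteq> Stab v"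
      "\<forall>B\<in>Stab v. \<forall>C\<in>unip (adj2 Z *v e0). B ** C ** adj2 B \<in> unip (adj2
          Z *v e0)"
      unfolding * by blast
    have ne: "adj2 Z *v e0 \<noteq> 0" using Z(2) e0(1) by (simp add: sl2_mult_vec_eq_0_iff)
    have "cross (adj2 Z *v e0) (B *v (adj2 Z *v e0)) = 0" if "B \<in> Stab v" for B
      using Z(4) normalizes[OF Stab_det[OF that] ne] that by blast
    then show "typeII v" unfolding typeII_def using Z(1,3) ne by blast
  next
    assume "typeII v"
    then obtain e where e: "v \<in> carrier V" "e \<noteq> 0" "unip e \<subseteq> Stab v"
        "\<forall>A\<in>Stab v. cross e (A *v e) = 0"
      unfolding typeII_def by blast
    obtain Z where Z: "det Z = 1" "adj2 Z *v e0 = e" using ex[OF e(2)] by blast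
    have "\<forall>B\<in>Stab v. \<forall>C\<in>unip e. B ** C ** adj2 B \<in> unip e"
      using e(4) normalizes[OF Stab_det e(2)] by blast
    then show "v \<in> pts_with_normal_conjugate G V \<phi> T"
      unfolding * using e(1,3) Z by (intro conjI exI[of _ Z]) simp_all
  qed
qed

text \<open>Conjugation of a nontrivial \<open>r\<close>-group on itself has a multiple of
  \<open>r\<close> fixed points, one of which is the identity.\<close>

lemma obtain_central_element:
  assumes R: "sylow_subgroup G r R" and r: "Factorial_Ring.prime r" "r dvd order G"
  obtains g where "g \<in> pre R" "g \<noteq> mat 1" "\<forall>A\<in>pre R. A ** g = g ** A"
proof -
  have sub: "subgroup (pre R) SL" using p_subgroup_pre(2)[OF R] .
  have m: "multiplicity r (order G) > 0"
    using r finite_G G.order_gt_0_iff_finite by (simp add: prime_multiplicity_gt_zero_iff)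
  have closed: "A ** B \<in> pre R" if "A \<in> pre R" "B \<in> pre R" for A B
    using subgroup.m_closed[OF sub that] by (simp add: SL_simps)
  have adj: "adj2 A \<in> pre R" if "A \<in> pre R" for A
    using subgroup.m_inv_closed[OF sub that] that by (simp add: inv_SL2 pre_det)
  have comm: "A ** B ** adj2 A = B \<longleftrightarrow> A ** B = B ** A" if "A \<in> pre R" for A B
  proof
    note inv = adj2_inverse[OF pre_det[OF that]]
    show "A ** B = B ** A" if "A ** B ** adj2 A = B"
    proof -
      have "A ** B ** adj2 A ** A = B ** A" using that by simp
      then show ?thesis by (simp add: matrix_mul_assoc[symmetric] inv)
    qed
    show "A ** B ** adj2 A = B" if "A ** B = B ** A"
      unfolding that by (simp add: matrix_mul_assoc[symmetric] inv)
  qed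
  let ?F = "{B \<in> pre R. \<forall>A \<in> pre R. A ** B ** adj2 A = B}"
  have "card (pre R) mod r = card ?F mod r"
    by (rule pre_fixed_points[OF R r(1), where op = "\<lambda>A B. A ** B ** adj2 A"])
       (auto intro: closed adj simp: adj2_mult matrix_mul_assoc)
  moreover have "r dvd card (pre R)" using p_subgroup_pre(3)[OF R] m by (simp add: dvd_power)
  ultimately have "r dvd card ?F" by (simp add: dvd_eq_mod_eq_0)
  moreover have one: "mat 1 \<in> ?F"
    using subgroup.one_closed[OF sub] by (auto simp: SL_simps adj2_inverse pre_det)
  ultimately have "card ?F \<noteq> 1" using r(1) by auto
  then have "?F \<noteq> {mat 1}" by auto
  then obtain g where "g \<in> ?F" "g \<noteq> mat 1" using one by blast
  then show ?thesis using that comm by blast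
qed

end

section \<open>Structure of \<open>V\<close>: commutative, of order 16, irreducible\<close>

context sl2_two_types
begin

lemma carrier_cases:
  assumes "v \<in> carrier V"
  obtains "v = \<one>" | "v \<in> W2" | x y where "x \<in> W2" "y \<in> W2" "x \<noteq> y" "v = x
      \<otimes> y"
proof -
  consider "v = \<one>" | "v \<in> W2" | "v \<in> W1" using assms by (auto simp: W1_def W2_def)
  then show ?thesis
  proof cases
    case 3
    from W1_as_product[OF this] show ?thesis using that(3) by blast
  qed (use that in auto)
qed

lemma W2_carrier: "x \<in> W2 \<Longrightarrow> x \<in> carrier V"
  using W_subset by blast

lemma W2_commute:
  assumes "x \<in> W2" "v \<in> carrier V"
  shows "x \<otimes> v = v \<otimes> x"
proof -
  have W2: "x \<otimes> y = y \<otimes> x" if "y \<in> W2" for y using W2_product(2)[OF assms(1)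
      that] by blast
  from assms(2) show ?thesis
  proof (cases rule: carrier_cases)
    case 1
    then show ?thesis using assms W2_carrier by simp
  next
    case 2
    then show ?thesis by (rule W2)
  next
    case (3 y z)
    have c: "x \<in> carrier V" "y \<in> carrier V" "z \<in> carrier V" using 3 assms W2_carrier by
        auto
    have "x \<otimes> (y \<otimes> z) = (x \<otimes> y) \<otimes> z" using c by (simp add: m_assoc)
    also have "\<dots> = y \<otimes> (x \<otimes> z)" using c W2[OF 3(1)] by (simp add: m_assoc)
    also have "\<dots> = (y \<otimes> z) \<otimes> x" using c W2[OF 3(2)] by (simp add: m_assoc)
    finally show ?thesis using 3 by simp
  qed
qed

text \<open>The five involutions commute pairwise, and every element is a product of at most two of
  them.\<close>

lemma comm_group_V: "comm_group V"
proof (rule group_comm_groupI)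
  fix u v assume uv: "u \<in> carrier V" "v \<in> carrier V"
  from uv(1) show "u \<otimes> v = v \<otimes> u"
  proof (cases rule: carrier_cases)
    case 1
    then show ?thesis using uv by simp
  next
    case 2
    then show ?thesis by (rule W2_commute[OF _ uv(2)])
  next
    case (3 y z)
    have c: "y \<in> carrier V" "z \<in> carrier V" using 3 W2_carrier by auto
    have "(y \<otimes> z) \<otimes> v = y \<otimes> (v \<otimes> z)" using c uv W2_commute[OF 3(2)
        uv(2)] by (simp add: m_assoc)
    also have "\<dots> = (v \<otimes> y) \<otimes> z" using c uv W2_commute[OF 3(1) uv(2)] by (simp
        add: m_assoc[symmetric])
    also have "\<dots> = v \<otimes> (y \<otimes> z)" using c uv by (simp add: m_assoc)
    finally show ?thesis using 3 by simp
  qed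
qed

lemma card_W1_eq: "card W1 = 10"
  using card_W1 card_trace_class[OF s] hyperbolic card_f_eq parameters by simp

lemma card_carrier_eq: "card (carrier V) = 16"
  using card_carrier card_W1_eq card_W2_eq by simp

text \<open>The involutions are permuted, so their product is invariant. Triviality of the fixed
  points makes it 1, the one relation that \<open>iso_from_five_involutions\<close> asks
  for.\<close>

lemma iso_vec_group:
  assumes nofix: "\<And>v. v \<in> carrier V \<Longrightarrow> (\<And>A. det A = 1
      \<Longrightarrow> act A v = v) \<Longrightarrow> v = \<one>"
  obtains f where "f \<in> iso V (vec_group :: (bit ^ 4) monoid)"
    "\<And>v. v \<in> carrier V \<Longrightarrow> v \<in> W2 \<longleftrightarrow> f v \<in>
        singular_vectors"
proof -
  interpret C: comm_group V by (rule comm_group_V)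
  have act_prod: "act A (finprod V (\<lambda>x. x) S) = finprod V (act A) S"
    if A: "det A = 1" and S: "finite S" "S \<subseteq> carrier V" for A S
    using S
  proof (induction S)
    case empty
    then show ?case using A by simp
  next
    case (insert x S)
    then have "(\<lambda>x. x) \<in> S \<rightarrow> carrier V" "act A \<in> S \<rightarrow>
        carrier V" using A by auto
    then show ?case using insert A by (simp add: act_hom)
  qed
  have "finprod V (\<lambda>x. x) W2 = \<one>"
  proof (rule nofix)
    show "finprod V (\<lambda>x. x) W2 \<in> carrier V" using W2_carrier by (intro
        C.finprod_closed) auto
    fix A :: "'f ^ 2 ^ 2" assume A: "det A = 1"
    have inj: "inj_on (act A) W2" using act_inj[OF A] W2_carrier by (auto simp: inj_on_def)
    have "act A ` W2 \<subseteq> W2" using W2_act_iff[OF A] W2_carrier by auto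
    then have img: "act A ` W2 = W2" using inj finite_W by (simp add: endo_inj_surj)
    have "finprod V (act A) W2 = finprod V (\<lambda>x. x) (act A ` W2)"
      using inj img W2_carrier by (subst C.finprod_reindex) auto
    then show "act A (finprod V (\<lambda>x. x) W2) = finprod V (\<lambda>x. x) W2"
      using act_prod[OF A finite_W(2) W_subset(2)] img by simp
  qed
  moreover have "x \<otimes> y \<notin> W2" if "x \<in> W2" "y \<in> W2" for x y
    using that W2_product(1)[of x y] W2_involution[of x] by (cases "x = y") (auto simp: W1_def W2_def)
  moreover have "\<one> \<notin> W2" by (simp add: W2_def)
  ultimately show ?thesis
    using C.iso_from_five_involutions[OF finite_carrier card_carrier_eq W_subset(2) card_W2_eq _
        W2_involution]
      that by blast
qed

lemma W2_obtain_other: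
  assumes "finite S" "card S < 5"
  obtains x where "x \<in> W2" "x \<notin> S"
proof -
  have "\<not> W2 \<subseteq> S"
  proof
    assume "W2 \<subseteq> S"
    then have "card W2 \<le> card S" by (rule card_mono[OF assms(1)])
    then show False using assms(2) card_W2_eq by simp
  qed
  then show ?thesis using that by blast
qed

text \<open>By transitivity on pairs of involutions a nontrivial invariant subgroup contains all ten
  points of \<open>W1\<close>, so its order is at least 11 and divides 16.\<close>

lemma invariant_subgroup:
  assumes W: "subgroup W V" and inv: "\<And>A w. det A = 1 \<Longrightarrow> w \<in> W
      \<Longrightarrow> act A w \<in> W"
  shows "W = {\<one>} \<or> W = carrier V"
proof (cases "W = {\<one>}")
  case False
  have Wc: "W \<subseteq> carrier V" using W by (rule subgroup.subset)
  obtain w where w: "w \<in> W" "w \<noteq> \<one>" using False subgroup.one_closed[OF W] by blast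
  have pairs: "x' \<otimes> y' \<in> W" if P: "x \<in> W2" "y \<in> W2" "x \<noteq> y" "x \<otimes>
      y \<in> W" "x' \<in> W2" "y' \<in> W2" "x' \<noteq> y'" for x y x' y'
  proof -
    obtain A where A: "det A = 1" "act A x = x'" "act A y = y'"
      using W2_pair_transitive[OF P(1-3,5-7)] .
    have "act A (x \<otimes> y) = x' \<otimes> y'" using act_hom[OF A(1)] A P W2_carrier by simp
    then show ?thesis using inv[OF A(1) P(4)] by simp
  qed
  have W1: "W1 \<subseteq> W"
  proof -
    have "\<exists>x y. x \<in> W2 \<and> y \<in> W2 \<and> x \<noteq> y \<and> x \<otimes> y \<in> W"
    proof -
      have "w \<in> carrier V" using w Wc by blast
      then show ?thesis
      proof (cases rule: carrier_cases)
        case 2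
        obtain y where y: "y \<in> W2" "y \<notin> {w}" by (rule W2_obtain_other[of "{w}"]) auto
        obtain A where A: "det A = 1" "act A w = y" "act A y = w"
          using W2_pair_transitive[OF 2 y(1) _ y(1) 2] y(2) by blast
        then have "y \<in> W" using inv[OF A(1) w(1)] by simp
        then show ?thesis using 2 y w(1) subgroup.m_closed[OF W] by blast
      qed (use w in auto)
    qed
    then show ?thesis using pairs W1_as_product by blast
  qed
  have "card (insert \<one> W1) \<le> card W"
    using W1 subgroup.one_closed[OF W] Wc finite_carrier by (intro card_mono) (auto intro:
        finite_subset)
  moreover have "card (insert \<one> W1) = 11"
    using card_W1_eq finite_W by (subst card_insert_disjoint) (auto simp: W1_def)
  ultimately have "card W \<ge> 11" by simp
  moreover have "card W dvd 16"
    using lagrange[OF W] card_carrier_eq by (metis dvd_triv_right order_def)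
  then obtain k where k: "16 = card W * k" by (elim dvdE)
  have "k < 2"
  proof (rule ccontr)
    assume "\<not> k < 2"
    then have "11 * 2 \<le> card W * k" using \<open>card W \<ge> 11\<close> by (intro
        mult_le_mono) auto
    then show False using k by simp
  qed
  then have "k = 0 \<or> k = 1" by arith
  then have "card W = 16" using k by auto
  then have "W = carrier V" using card_carrier_eq finite_carrier Wc by (intro card_subset_eq) auto
  then show ?thesis ..
qed simp

end

section \<open>The field with four elements\<close>

lemma field_4_cube:
  fixes x :: "'f::{field,finite}"
  assumes card: "CARD('f) = 4" and x: "x \<noteq> 0" "x \<noteq> 1"
  shows "(UNIV :: 'f set) = {0, 1, x, x + 1}" "x * x = x + 1" "x * x * x = 1"
proof -
  have two: "(2::'f) = 0" using char_2_if_card_power_2[of 2] card by simp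
  have dbl: "y + y = 0" for y :: 'f using two by (metis mult_2 mult_zero_left)
  have x1: "x + 1 \<noteq> 0" using x(2) dbl[of 1] by (metis add_right_cancel)
  have "card {0, 1, x, x + 1} = 4" using x x1 by auto
  then have "{0, 1, x, x + 1} = (UNIV :: 'f set)" using card by (intro card_subset_eq) auto
  then show UNIV: "(UNIV :: 'f set) = {0, 1, x, x + 1}" by simp
  have "x * x \<in> {0, 1, x, x + 1}" using UNIV by blast
  moreover have "x * x \<noteq> 1"
  proof
    assume "x * x = 1"
    then have "(x + 1) * (x + 1) = (1 + 1) + (x + x)" by (simp add: algebra_simps)
    then show False using x1 by (simp add: dbl)
  qed
  ultimately show sq: "x * x = x + 1" using x by auto
  have "x * x * x = x * x + x" by (simp add: sq distrib_right)
  also have "\<dots> = 1 + (x + x)" by (simp add: sq)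
  finally show "x * x * x = 1" by (simp add: dbl)
qed

text \<open>Any \<open>w\<close> outside \<open>{0, 1}\<close> satisfies
  \<open>w * w = w + 1\<close>, the relation built into \<open>gf4\<close>, so
  \<open>GF4 c d \<mapsto> c + d * w\<close> is a field isomorphism, applied here entrywise.\<close>

lemma SL2_iso_gf4:
  assumes card: "CARD('f::{field,finite}) = 4"
  shows "(SL :: ('f ^ 2 ^ 2) monoid) \<cong> (SL :: (gf4 ^ 2 ^ 2) monoid)"
proof -
  have "\<exists>x. x \<notin> {0, 1 :: 'f}"
  proof (rule ccontr)
    assume "\<nexists>x. x \<notin> {0, 1 :: 'f}"
    then have "card (UNIV :: 'f set) \<le> card {0, 1 :: 'f}" by (intro card_mono) auto
    then show False using card by simp
  qed
  then obtain w :: 'f where w: "w \<noteq> 0" "w \<noteq> 1" by auto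
  have two: "(2::'f) = 0" using char_2_if_card_power_2[of 2] card by simp
  have dbl: "y + y = 0" for y :: 'f using two by (metis mult_2 mult_zero_left)
  have dbl2: "y + (y + z) = z" for y z :: 'f by (simp add: add.assoc[symmetric] dbl)
  note F = field_4_cube[OF card w]
  define b :: "bit \<Rightarrow> 'f" where "b c = (if c = 1 then 1 else 0)" for c
  have b: "b 0 = 0" "b 1 = 1" by (simp_all add: b_def)
  define h :: "gf4 \<Rightarrow> 'f" where "h x = (case x of GF4 c d \<Rightarrow> b c + b d * w)"
      for x
  have h_add: "h (x + y) = h x + h y" for x y
  proof (cases x; cases y)
    fix c d c' d' assume "x = GF4 c d" "y = GF4 c' d'"
    moreover have "b (c + c') = b c + b c'" for c c' by (cases c; cases c') (simp_all add: b dbl)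
    ultimately show ?thesis by (simp add: h_def algebra_simps)
  qed
  have h_mult: "h (x * y) = h x * h y" for x y
  proof (cases x; cases y)
    fix c d c' d' assume "x = GF4 c d" "y = GF4 c' d'"
    then show ?thesis
      by (cases c; cases d; cases c'; cases d')
         (simp_all add: h_def b F(2) algebra_simps dbl dbl2)
  qed
  have h_range: "h (GF4 0 0) = 0" "h (GF4 1 0) = 1" "h (GF4 0 1) = w" "h (GF4 1 1) = w + 1"
    by (simp_all add: h_def b add.commute)
  have "surj h"
  proof -
    have "{0, 1, w, w + 1} \<subseteq> range h" using h_range by (metis empty_subsetI insert_subset
        rangeI)
    then show ?thesis using F(1) by auto
  qed
  then have inj: "inj h" by (intro eq_card_imp_inj_on) (simp_all add: card card_gf4)
  have h0: "h 0 = 0" and h1: "h 1 = 1" by (simp_all add: zero_gf4_def one_gf4_def h_range)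
  have h_diff: "h (x - y) = h x - h y" for x y using h_add[of "x - y" y] by (simp add: eq_diff_eq)
  define m where "m A = mat2 (h (A $ 1 $ 1)) (h (A $ 1 $ 2)) (h (A $ 2 $ 1)) (h (A $ 2 $ 2))" for A
      :: "gf4 ^ 2 ^ 2"
  have m: "m (mat2 p q r s) = mat2 (h p) (h q) (h r) (h s)" for p q r s by (simp add: m_def)
  have det: "det (m A) = h (det A)" for A
    by (cases A rule: mat2_cases) (simp add: m h_mult h_diff)
  have mult: "m (A ** B) = m A ** m B" for A B
    by (cases A rule: mat2_cases; cases B rule: mat2_cases) (simp add: m h_mult h_add)
  have "m \<in> iso SL SL"
  proof (rule isoI)
    show "m \<in> hom SL SL" by (rule homI) (simp_all add: SL_simps det mult h1)
    show "bij_betw m (carrier SL) (carrier SL)"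
    proof (rule bij_betw_imageI)
      show "inj_on m (carrier SL)"
      proof (rule inj_onI)
        fix A B assume "m A = m B"
        then show "A = B"
          by (cases A rule: mat2_cases; cases B rule: mat2_cases) (simp add: m inj_eq[OF inj])
      qed
      show "m ` carrier SL = carrier SL"
      proof
        show "m ` carrier SL \<subseteq> carrier SL" by (auto simp: SL_simps det h1)
        show "carrier SL \<subseteq> m ` carrier SL"
        proof
          fix B :: "'f ^ 2 ^ 2" assume B: "B \<in> carrier SL"
          obtain p q r s where B_eq: "B = mat2 p q r s" by (rule mat2_cases)
          obtain p' q' r' s' where "p = h p'" "q = h q'" "r = h r'" "s = h s'" using \<open>surj
              h\<close> by (metis surjD)
          then have A: "B = m (mat2 p' q' r' s')" by (simp add: B_eq m)
          then have "h (det (mat2 p' q' r' s')) = h 1" using B det[of "mat2 p' q' r' s'"] by (simp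
              only: SL_simps mem_Collect_eq h1)
          then have "det (mat2 p' q' r' s') = 1" using inj by (simp only: inj_eq)
          then show "B \<in> m ` carrier SL" using A by (auto simp: SL_simps)
        qed
      qed
    qed
  qed
  then have "(SL :: (gf4 ^ 2 ^ 2) monoid) \<cong> (SL :: ('f ^ 2 ^ 2) monoid)" by (auto simp:
      is_iso_def)
  then show ?thesis using group.iso_sym[OF group_SL2] by blast
qed

section \<open>The forward direction\<close>

lemma (in group) pow_card_subgroup:
  assumes "subgroup H G" "x \<in> H"
  shows "x [^] card H = \<one>"
proof -
  interpret H: group "G\<lparr>carrier := H\<rparr>" using assms subgroup_imp_group by blast
  have "x [^]\<^bsub>G\<lparr>carrier := H\<rparr>\<^esub> order (G\<lparr>carrier := H\<rparr>) =
      \<one>\<^bsub>G\<lparr>carrier := H\<rparr>\<^esub>"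
    using assms(2) by (intro H.pow_order_eq_1) simp
  then show ?thesis by (simp add: order_def nat_pow_consistent[symmetric])
qed

locale sl2_sylow_action = sl2_group_action G V \<phi> \<eta>
  for G :: "('g, 'x) monoid_scheme" and V :: "('v, 'y) monoid_scheme"
    and \<phi> :: "'g \<Rightarrow> 'v \<Rightarrow> 'v" and \<eta> :: "'f::{field,finite} ^ 2 ^ 2
        \<Rightarrow> 'g" +
  fixes t a r n :: nat and T R :: "'g set"
  assumes prime_t: "Factorial_Ring.prime t" and card_f: "CARD('f) = t ^ a" and card_f_ge: "CARD('f)
      \<ge> 4"
    and sylow_T: "sylow_subgroup G t T"
    and prime_r: "Factorial_Ring.prime r" and odd_r: "odd r" and r_dvd: "r dvd t ^ (2 * a) - 1"
    and sylow_R: "sylow_subgroup G r R"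
    and card_V: "card (carrier V) = t ^ n"
    and no_fixed: "fixed_points G V \<phi> = {\<one>\<^bsub>V\<^esub>}"
begin

lemma r_dvd_card: "r dvd CARD('f) * CARD('f) - 1"
  using r_dvd by (simp add: card_f power_add mult_2)

lemma r_dvd_order: "r dvd order G"
  using r_dvd_card by (simp add: order_G)

lemma coprime_r: "coprime (r ^ k) (2 * CARD('f))"
proof -
  have "\<not> r dvd CARD('f)"
  proof
    assume "r dvd CARD('f)"
    then have "r dvd CARD('f) * CARD('f)" by simp
    then have "r dvd CARD('f) * CARD('f) - (CARD('f) * CARD('f) - 1)"
      using r_dvd_card by (rule dvd_diff_nat)
    then show False using prime_r by simp
  qed
  moreover have "\<not> r dvd 2" using prime_r odd_r by (metis dvd_refl primes_dvd_imp_eq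
      two_is_prime_nat)
  ultimately have "\<not> r dvd 2 * CARD('f)" using prime_r by (simp add: prime_dvd_mult_iff)
  then have "coprime r (2 * CARD('f))" by (rule prime_imp_coprime[OF prime_r])
  then show ?thesis by (simp only: coprime_power_left_iff simp_thms)
qed

text \<open>Otherwise the square of \<open>g\<close> is unipotent and the order of \<open>g\<close>
  divides \<open>2 * q\<close>, which is prime to \<open>r\<close> because \<open>r\<close> is odd
  and divides \<open>q * q - 1\<close>.\<close>

lemma trace_neq_4:
  assumes g: "g \<in> pre R" "g \<noteq> mat 1"
  shows "trace g * trace g \<noteq> 4"
proof
  interpret S: group "SL :: ('f ^ 2 ^ 2) monoid" by (rule group_SL2)
  assume "trace g * trace g = 4"
  then obtain e where e: "e \<noteq> 0" "g ** g \<in> unip e"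
    using double_eigenvalue_if_trace_square_4[OF pre_det[OF g(1)]] by blast
  have gS: "g \<in> carrier SL" using pre_det[OF g(1)] by (simp add: SL_simps)
  have "(g ** g) [^]\<^bsub>SL\<^esub> CARD('f) = \<one>\<^bsub>SL\<^esub>"
    using S.pow_card_subgroup[OF subgroup_unip e(2)] card_unip[OF e(1)] by simp
  moreover have "g ** g = g [^]\<^bsub>SL\<^esub> (2::nat)" using gS by (simp add: numeral_2_eq_2
      SL_simps)
  ultimately have "g [^]\<^bsub>SL\<^esub> (2 * CARD('f)) = \<one>\<^bsub>SL\<^esub>" using
      S.nat_pow_pow[OF gS] by metis
  then have "S.ord g dvd 2 * CARD('f)" using S.pow_eq_id[OF gS] by simp
  moreover have "g [^]\<^bsub>SL\<^esub> card (pre R) = \<one>\<^bsub>SL\<^esub>"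
    using S.pow_card_subgroup[OF p_subgroup_pre(2)[OF sylow_R] g(1)] .
  then have "S.ord g dvd r ^ multiplicity r (order G)"
    using S.pow_eq_id[OF gS] p_subgroup_pre(3)[OF sylow_R] by simp
  ultimately have "is_unit (S.ord g)" using coprime_r by (metis coprime_common_divisor)
  then have "g = \<one>\<^bsub>SL\<^esub>" using S.ord_eq_1[OF gS] by simp
  then show False using g(2) by (simp add: SL_simps)
qed

lemma conjugate_of_same_trace:
  assumes "det g = 1" "det k = 1" "trace k = trace g" "trace g * trace g \<noteq> (4::'f)"
  obtains Q where "det Q = 1" "k = Q ** g ** adj2 Q"
proof -
  obtain P where P: "det P = 1" "g ** P = P ** comp2 (trace g)" using conjugate_comp2[OF assms(1,4)] .
  obtain P' where P': "det P' = 1" "k ** P' = P' ** comp2 (trace g)"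
    using conjugate_comp2[OF assms(2)] assms(3,4) by metis
  have "comp2 (trace g) = adj2 P ** g ** P"
    using P(2) adj2_inverse(2)[OF P(1)] by (metis matrix_mul_assoc matrix_mul_lid)
  moreover have "k = P' ** comp2 (trace g) ** adj2 P'"
    using P'(2) adj2_inverse(1)[OF P'(1)] by (metis matrix_mul_assoc matrix_mul_rid)
  ultimately have "k = (P' ** adj2 P) ** g ** adj2 (P' ** adj2 P)"
    by (simp add: adj2_mult matrix_mul_assoc)
  moreover have "det (P' ** adj2 P) = 1" using P P' by (simp add: det_mul)
  ultimately show ?thesis using that by blast
qed

text \<open>An element of the stabilizer with the trace of \<open>g\<close> is conjugate to
  \<open>g\<close>, hence an \<open>r\<close>-element, hence in the normal conjugate of
  \<open>R\<close>. There the conjugate of \<open>g\<close> is central, and commuting elements of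
  equal trace are equal or inverse.\<close>

lemma V_I_typeI:
  assumes g: "g \<in> pre R" "g \<noteq> mat 1" "\<forall>A\<in>pre R. A ** g = g ** A"
    and v: "v \<in> pts_with_normal_conjugate G V \<phi> R"
  shows "typeI (trace g) v"
proof -
  interpret S: group "SL :: ('f ^ 2 ^ 2) monoid" by (rule group_SL2)
  have R: "subgroup R G" using p_subgroup_pre(1)[OF sylow_R] .
  have Rc: "R \<subseteq> carrier G" using R by (rule subgroup.subset)
  have dg: "det g = 1" using pre_det[OF g(1)] .
  have s4: "trace g * trace g \<noteq> 4" using trace_neq_4[OF g(1,2)] .
  obtain x where x: "v \<in> carrier V" "x \<in> carrier G"
    "conj_subgroup G R x \<lhd> G\<lparr>carrier := stabilizer G \<phi> v\<rparr>"
    using v by (auto simp: pts_with_normal_conjugate_def)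
  obtain Z where Z: "det Z = 1" "x = \<eta> Z" using \<eta>_surj[OF x(2)] by blast
  let ?g = "adj2 Z ** g ** Z"
  have "conj_subgroup G R x \<subseteq> stabilizer G \<phi> v"
    using x(3) by (auto dest!: normal_imp_subgroup subgroup.subset)
  then have sub: "\<eta> ` ((\<lambda>A. adj2 Z ** A ** Z) ` pre R) \<subseteq> stabilizer G \<phi> v"
    using conj_subgroup_\<eta>[OF Rc Z(1)] Z(2) by simp
  have dg': "det ?g = 1" using dg Z(1) by (simp add: det_conj)
  have "?g \<in> Stab v" using sub g(1) stabilizer_iff[OF dg'] by blast
  moreover have tr: "trace ?g = trace g" by (rule trace_conj(1)[OF Z(1)])
  moreover have "k = ?g \<or> k = adj2 ?g" if k: "k \<in> Stab v" "trace k = trace g" for k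
  proof -
    have dk: "det k = 1" using Stab_det[OF k(1)] .
    obtain Q where Q: "det Q = 1" "k = Q ** g ** adj2 Q"
      using conjugate_of_same_trace[OF dg dk k(2) s4] .
    have "g [^]\<^bsub>SL\<^esub> card (pre R) = \<one>\<^bsub>SL\<^esub>"
      using S.pow_card_subgroup[OF p_subgroup_pre(2)[OF sylow_R] g(1)] .
    then have "k [^]\<^bsub>SL\<^esub> card (pre R) = \<one>\<^bsub>SL\<^esub>"
      using pow_conj_SL2[OF Q(1) dg] Q by (simp add: SL_simps adj2_inverse)
    then have "\<eta> (k [^]\<^bsub>SL\<^esub> card (pre R)) = \<one>\<^bsub>G\<^esub>" by (simp
        add: SL_simps)
    moreover have "\<eta> (k [^]\<^bsub>SL\<^esub> card (pre R)) = \<eta> k [^]\<^bsub>G\<^esub>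
        card (pre R)"
      using iso_\<eta> dk by (intro hom_nat_pow group_SL2 G.is_group) (auto simp: iso_def SL_simps)
    ultimately have "\<eta> k [^]\<^bsub>G\<^esub> (r ^ multiplicity r (order G)) =
        \<one>\<^bsub>G\<^esub>"
      using p_subgroup_pre(3)[OF sylow_R] by simp
    then have "\<eta> k \<in> conj_subgroup G R x"
    proof (rule G.mem_normal_if_pow_eq_one[OF finite_G _ x(3) _ prime_r, rotated -1])
      show "subgroup (stabilizer G \<phi> v) G" using stabilizer_subgroupI[OF G.is_group V.is_group
          hom_\<phi> x(1)] .
      show "card (conj_subgroup G R x) = r ^ multiplicity r (order G)"
        using G.card_conj_subgroup[OF Rc x(2)] sylow_R by (simp add: sylow_subgroup_def)
      show "\<eta> k \<in> stabilizer G \<phi> v" using stabilizer_iff[OF dk] k(1) by simp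
    qed
    then obtain A where A: "A \<in> pre R" "\<eta> k = \<eta> (adj2 Z ** A ** Z)"
      unfolding Z(2) conj_subgroup_\<eta>[OF Rc Z(1)] by blast
    have "det (adj2 Z ** A ** Z) = 1" using Z(1) pre_det[OF A(1)] by (simp add: det_conj)
    then have kA: "k = adj2 Z ** A ** Z" using A(2) \<eta>_inj[OF dk] by simp
    have mul: "(adj2 Z ** B ** Z) ** (adj2 Z ** C ** Z) = adj2 Z ** (B ** C) ** Z" for B C
      using adj2_inverse(1)[OF Z(1)] by (metis matrix_mul_assoc matrix_mul_rid)
    have "k ** ?g = ?g ** k" unfolding kA mul g(3)[rule_format, OF A(1)] ..
    then show ?thesis using commute_same_trace[OF dg' dk] k(2) tr s4 by simp
  qed
  ultimately show ?thesis unfolding typeI_def using x(1) by metis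
qed

lemma no_fixed_act:
  assumes "v \<in> carrier V" "\<And>A. det A = 1 \<Longrightarrow> act A v = v"
  shows "v = \<one>\<^bsub>V\<^esub>"
proof -
  have "\<phi> g v = v" if "g \<in> carrier G" for g
    using \<eta>_surj[OF that] assms(2) by (auto simp: act_def)
  then have "v \<in> fixed_points G V \<phi>" using assms(1) by (simp add: fixed_points_def)
  then show ?thesis using no_fixed by simp
qed

lemma exponent_pos: "a > 0"
  using card_f card_f_ge by (cases a) auto

theorem structure_if_all_points_of_two_types:
  assumes ne: "pts_with_normal_conjugate G V \<phi> R \<noteq> {}"
    and cover: "carrier V - {\<one>\<^bsub>V\<^esub>} = pts_with_normal_conjugate G V \<phi> R
        \<union> pts_with_normal_conjugate G V \<phi> T"
  shows "CARD('f) = 4 \<and> r = 3 \<and> irreducible_F2_module_dim4 G V \<phi> \<and>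
      Omega4_minus_standard_module G V \<phi>"
proof -
  obtain g where g: "g \<in> pre R" "g \<noteq> mat 1" "\<forall>A\<in>pre R. A ** g = g ** A"
    using obtain_central_element[OF sylow_R prime_r r_dvd_order] .
  have dg: "det g = 1" using pre_det[OF g(1)] .
  obtain e0 where e0: "e0 \<noteq> 0" "pre T = unip e0"
    using sylow_t_eq_unip[OF prime_t card_f exponent_pos sylow_T] .
  note I = V_I_typeI[OF g] and II = V_II_iff_typeII[OF sylow_T e0]
  interpret W: sl2_two_types V act "trace g" t a n
  proof unfold_locales
    show "trace g * trace g \<noteq> 4" using trace_neq_4[OF g(1,2)] .
    show "\<exists>v. v \<noteq> \<one>\<^bsub>V\<^esub> \<and> typeI (trace g) v" using ne cover I
        by blast
    show "typeI (trace g) v \<or> typeII v" if "v \<in> carrier V" "v \<noteq>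
        \<one>\<^bsub>V\<^esub>" for v
      using that cover I II by blast
  qed (use prime_t card_f card_f_ge card_V in auto)
  have q4: "CARD('f) = 4" by (rule W.card_f_eq)
  \<comment> \<open>Over four elements \<open>l * l * l = 1\<close>, so the nontrivial element
    \<open>g\<close> of the \<open>r\<close>-group \<open>pre R\<close> has order dividing
    3.\<close>
  have r3: "r = 3"
  proof (rule ccontr)
    assume "r \<noteq> 3"
    interpret S: group "SL :: ('f ^ 2 ^ 2) monoid" by (rule group_SL2)
    obtain l where l: "l \<noteq> 0" "l \<noteq> inverse l" "trace (diag2 l) = trace g" by (rule
        W.obtain_hyperbolic)
    have dl: "det (diag2 l) = 1" using l(1) by simp
    obtain Q where Q: "det Q = 1" "g = Q ** diag2 l ** adj2 Q"
      using conjugate_of_same_trace[OF dl dg] l(3) trace_neq_4[OF g(1,2)] by metis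
    have "l \<noteq> 1" using l(2) by auto
    then have "l * l * l = 1" using field_4_cube(3)[OF q4 l(1)] by simp
    then have "diag2 l ** diag2 l ** diag2 l = mat 1" by (simp add: diag2_mult) (simp add:
        diag2_def mat_1_eq)
    then have "diag2 l [^]\<^bsub>SL\<^esub> (3::nat) = \<one>\<^bsub>SL\<^esub>" using dl by (simp
        add: numeral_3_eq_3 SL_simps)
    then have "g [^]\<^bsub>SL\<^esub> (3::nat) = \<one>\<^bsub>SL\<^esub>"
      using pow_conj_SL2[OF Q(1) dl, of 3] Q by (simp add: SL_simps adj2_inverse)
    moreover have gS: "g \<in> carrier SL" using dg by (simp add: SL_simps)
    ultimately have "S.ord g dvd 3" using S.pow_eq_id[OF gS] by blast
    moreover have "g [^]\<^bsub>SL\<^esub> card (pre R) = \<one>\<^bsub>SL\<^esub>"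
      using S.pow_card_subgroup[OF p_subgroup_pre(2)[OF sylow_R] g(1)] .
    then have "S.ord g dvd r ^ multiplicity r (order G)"
      using S.pow_eq_id[OF gS] p_subgroup_pre(3)[OF sylow_R] by simp
    moreover have "coprime (3::nat) (r ^ multiplicity r (order G))"
      using \<open>r \<noteq> 3\<close> prime_r by (intro coprime_power_right_iff[THEN iffD2]
          disjI1 primes_coprime) simp_all
    ultimately have "is_unit (S.ord g)" by (metis coprime_common_divisor)
    then have "g = \<one>\<^bsub>SL\<^esub>" using S.ord_eq_1[OF gS] by simp
    then show False using g(2) by (simp add: SL_simps)
  qed
  obtain f where f: "f \<in> iso V (vec_group :: (bit ^ 4) monoid)"
    "\<And>v. v \<in> carrier V \<Longrightarrow> v \<in> W.W2 \<longleftrightarrow> f v \<in>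
        singular_vectors"
    using W.iso_vec_group[OF no_fixed_act] by blast
  have irr: "irreducible_action G V \<phi>"
    unfolding irreducible_action_def
  proof (intro conjI allI impI)
    show "carrier V \<noteq> {\<one>\<^bsub>V\<^esub>}" using W.card_carrier_eq by auto
    fix W assume W: "subgroup W V" "\<forall>g\<in>carrier G. \<phi> g ` W \<subseteq> W"
    show "W = {\<one>\<^bsub>V\<^esub>} \<or> W = carrier V"
    proof (rule W.invariant_subgroup[OF W(1)])
      fix A :: "'f ^ 2 ^ 2" and w assume "det A = 1" "w \<in> W"
      then show "act A w \<in> W" using W(2) \<eta>_closed unfolding act_def by blast
    qed
  qed
  have Om: "Omega4_minus_standard_module G V \<phi>"
  proof (rule Omega4_minus_standard_moduleI[OF G.is_group V.is_group hom_\<phi> _ f(1)])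
    show "card (carrier G) = 60" using order_G q4 by (simp add: order_def)
    have f_bij: "inj_on f (carrier V)" using f(1) by (simp add: iso_def bij_betw_def)
    have f1: "f \<one>\<^bsub>V\<^esub> = 0"
    proof -
      have "\<forall>u\<in>carrier V. \<forall>v\<in>carrier V. f (u \<otimes>\<^bsub>V\<^esub> v)
          = f u + f v"
        using f(1) by (auto simp: iso_def hom_def vec_group_def)
      then have "f (\<one>\<^bsub>V\<^esub> \<otimes>\<^bsub>V\<^esub> \<one>\<^bsub>V\<^esub>) = f
          \<one>\<^bsub>V\<^esub> + f \<one>\<^bsub>V\<^esub>"
        using V.one_closed by blast
      then show ?thesis by simp
    qed
    \<comment> \<open>Over the field with two elements a form is determined by its zeros, and these
      correspond to the identity and \<open>W2\<close>, an invariant set.\<close>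
    have Q0: "Q_minus (f v) = 0 \<longleftrightarrow> v = \<one>\<^bsub>V\<^esub> \<or> v \<in>
        W.W2" if "v \<in> carrier V" for v
    proof -
      have "f v = 0 \<longleftrightarrow> v = \<one>\<^bsub>V\<^esub>" using f_bij f1 that by
          (metis V.one_closed inj_onD)
      moreover have "Q_minus 0 = 0" by (simp add: Q_minus_def)
      ultimately show ?thesis using f(2)[OF that] by (auto simp: singular_vectors_def)
    qed
    show "Q_minus (f (\<phi> g v)) = Q_minus (f v)" if gv: "g \<in> carrier G" "v \<in> carrier V"
        for g v
    proof -
      obtain A where A: "det A = 1" "g = \<eta> A" using \<eta>_surj[OF gv(1)] by blast
      have "Q_minus (f (act A v)) = 0 \<longleftrightarrow> Q_minus (f v) = 0"
        using Q0[OF gv(2)] Q0[of "act A v"] W.W2_act_iff[OF A(1) gv(2)] W.act_eq_one_iff[OF A(1)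
            gv(2)]
          act_closed[OF A(1) gv(2)] by simp
      then show ?thesis
        unfolding act_def A(2) by (cases "Q_minus (f (\<phi> (\<eta> A) v))"; cases "Q_minus (f
            v)") simp_all
    qed
    show "g = \<one>\<^bsub>G\<^esub>" if g: "g \<in> carrier G" "\<forall>v\<in>carrier V. \<phi>
        g v = v" for g
    proof -
      obtain A where A: "det A = 1" "g = \<eta> A" using \<eta>_surj[OF g(1)] by blast
      have "A = mat 1" using W.faithful[OF A(1)] g(2) W.W2_carrier by (simp add: act_def A(2))
      then show ?thesis using A(2) by simp
    qed
    show "D = carrier G" if D: "subgroup D G"
      "\<And>g h. g \<in> carrier G \<Longrightarrow> h \<in> carrier G \<Longrightarrow> g
          \<otimes>\<^bsub>G\<^esub> h \<otimes>\<^bsub>G\<^esub> inv\<^bsub>G\<^esub> g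
          \<otimes>\<^bsub>G\<^esub> inv\<^bsub>G\<^esub> h \<in> D" for D
    proof -
      obtain l where l: "l \<noteq> 0" "l \<noteq> inverse l" "trace (diag2 l) = trace g"
        by (rule W.obtain_hyperbolic)
      have l2: "l * l \<noteq> 1"
      proof
        assume "l * l = 1"
        then have "inverse l = l" by (rule inverse_unique)
        then show False using l(2) by simp
      qed
      have gen: "A \<in> pre D" if A: "det A = 1" for A
      proof (rule sl2_generated_by_commutators[OF l(1) l2 _ _ A])
        show "A ** B \<in> pre D" if "A \<in> pre D" "B \<in> pre D" for A B
          using that subgroup.m_closed[OF D(1)] by (simp add: pre_def det_mul \<eta>_mult)
        show "A ** B ** adj2 A ** adj2 B \<in> pre D" if "det A = 1" "det B = 1" for A B
          using that D(2)[of "\<eta> A" "\<eta> B"] by (simp add: pre_def det_mul \<eta>_mult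
              \<eta>_adj2)
      qed
      have "carrier G \<subseteq> D"
      proof
        fix g assume "g \<in> carrier G"
        then obtain A where A: "det A = 1" "g = \<eta> A" using \<eta>_surj by blast
        have "A \<in> pre D" by (rule gen[OF A(1)])
        then show "g \<in> D" by (simp add: pre_def A(2))
      qed
      then show ?thesis using subgroup.subset[OF D(1)] by blast
    qed
  qed
  have "V \<cong> (vec_group :: (bit ^ 4) monoid)" using f(1) by (auto simp: is_iso_def)
  then show ?thesis using q4 r3 irr Om by (simp add: irreducible_F2_module_dim4_def)
qed

end

section \<open>Singular and nonsingular vectors\<close>

lemma Q_minus_add: "Q_minus (x + y) = polar_minus x y + Q_minus x + Q_minus y"
  unfolding polar_minus_def
  by (cases "Q_minus (x + y)"; cases "Q_minus x"; cases "Q_minus y") simp_all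

text \<open>The sum of two orthogonal singular vectors has value zero under the form, which Witt
  index one forbids for distinct ones.\<close>

lemma polar_minus_singular:
  assumes "a \<in> singular_vectors" "b \<in> singular_vectors"
  shows "polar_minus a b = (if a = b then 0 else 1)"
proof (cases "a = b")
  case True
  have "a + a = 0" by (simp add: vec_eq_iff)
  then show ?thesis using True assms by (simp add: polar_minus_def singular_vectors_def Q_minus_def)
next
  case False
  then have "Q_minus (a + b) \<noteq> 0" using Q_minus_Witt_index(2) assms by (auto simp:
      singular_vectors_def)
  moreover have "Q_minus (a + b) = polar_minus a b"
    using assms by (simp add: Q_minus_add singular_vectors_def)
  ultimately show ?thesis using False by simp
qed

lemma polar_minus_add_right: "polar_minus x (y + z) = polar_minus x y + polar_minus x z"
  by (simp only: polar_minus_eq vector_add_component distrib_left ac_simps)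

text \<open>The singular vectors span, so some singular \<open>a\<close> is not orthogonal to
  \<open>w\<close>. Then \<open>Q_minus (a + w) = 1 + 0 + 1 = 0\<close>, and \<open>w\<close> is the
  sum of \<open>a\<close> and \<open>a + w\<close>.\<close>

lemma nonsingular_as_sum:
  assumes "w \<noteq> 0" "w \<notin> singular_vectors"
  obtains a b where "a \<in> singular_vectors" "b \<in> singular_vectors" "a \<noteq> b" "w = a + b"
proof -
  have "\<exists>a. a \<in> singular_vectors \<and> polar_minus a w \<noteq> 0"
  proof (rule ccontr)
    assume "\<nexists>a. a \<in> singular_vectors \<and> polar_minus a w \<noteq> 0"
    then have "polar_minus (vec4 1 0 0 0) w = 0" "polar_minus (vec4 0 1 0 0) w = 0"
      "polar_minus (vec4 1 1 1 0) w = 0" "polar_minus (vec4 1 1 0 1) w = 0"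
      by (auto simp: singular_vectors_eq)
    then have "w $ 2 = 0" "w $ 1 = 0" "w $ 2 + w $ 1 + w $ 4 = 0" "w $ 2 + w $ 1 + w $ 3 = 0"
      by (simp_all add: polar_minus_eq)
    then show False using assms(1) by (simp add: vec4_eq_iff)
  qed
  then obtain a where a: "a \<in> singular_vectors" "polar_minus a w \<noteq> 0" by blast
  have dbl: "x + x = 0" for x :: "bit ^ 4" by (simp add: vec_eq_iff)
  have w: "w = a + (a + w)" by (simp only: add.assoc[symmetric] dbl add_0)
  have "Q_minus w \<noteq> 0" using assms by (simp add: singular_vectors_def)
  then have "Q_minus w = 1" "polar_minus a w = 1" using a(2) by simp_all
  then have "Q_minus (a + w) = 0" using a(1) by (simp add: Q_minus_add singular_vectors_def)
  moreover have "a + w \<noteq> 0"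
  proof
    assume "a + w = 0"
    then have "w = a" using w by simp
    then show False using assms a(1) by simp
  qed
  ultimately have "a + w \<in> singular_vectors" by (simp add: singular_vectors_def)
  moreover have "a \<noteq> a + w" using assms(1) by simp
  ultimately show ?thesis using that a(1) w by blast
qed

text \<open>Pairing with \<open>a\<close> gives 1 on \<open>a + b\<close>, but
  \<open>1 + 1 = 0\<close> on \<open>c + d\<close> if \<open>a\<close> is neither summand.\<close>

lemma sum_of_singular_unique:
  assumes "a \<in> singular_vectors" "b \<in> singular_vectors" "c \<in> singular_vectors" "d \<in>
      singular_vectors"
    and "a \<noteq> b" "c \<noteq> d" "a + b = c + d"
  shows "a \<in> {c, d}"
proof (rule ccontr)
  assume "a \<notin> {c, d}"
  then have "polar_minus a (c + d) = 1 + 1"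
    using assms by (simp add: polar_minus_add_right polar_minus_singular)
  moreover have "polar_minus a (a + b) = 0 + 1"
    using assms(1,2,5) by (simp only: polar_minus_add_right polar_minus_singular if_True if_False
        simp_thms)
  ultimately show False using assms(7) by simp
qed

section \<open>The special linear group over the field with four elements acting on five
    points\<close>

text \<open>For independent \<open>e\<close> and \<open>e'\<close> this is the split torus attached
  to their two lines.\<close>

definition torus :: "'a::field ^ 2 \<Rightarrow> 'a ^ 2 \<Rightarrow> ('a ^ 2 ^ 2) set"
  where "torus e e' = {A. det A = 1 \<and> cross e (A *v e) = 0 \<and> cross e' (A *v e') = 0}"

lemma torus_mult_vec:
  assumes "det P = 1"
  shows "A \<in> torus (P *v e) (P *v e') \<longleftrightarrow> adj2 P ** A ** P \<in> torus e e'"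
proof -
  have "cross (P *v x) (A *v (P *v x)) = cross x ((adj2 P ** A ** P) *v x)" for x
  proof -
    have "cross (P *v x) (P *v ((adj2 P ** A ** P) *v x)) = cross x ((adj2 P ** A ** P) *v x)"
      by (simp add: cross_mult assms)
    then show ?thesis by (simp add: matrix_vector_mul_assoc[symmetric] adj2_mult_vec assms)
  qed
  then show ?thesis by (simp add: torus_def det_conj assms)
qed

lemma torus_smult: "c \<noteq> 0 \<Longrightarrow> torus e (c *s e') = torus e e'"
  by (simp add: torus_def vec.scale)

lemma torus_std: "torus (vec2 1 0) (vec2 0 1) = diag2 ` (UNIV - {0})"
proof -
  have "A \<in> torus (vec2 1 0) (vec2 0 1) \<longleftrightarrow> A \<in> diag2 ` (UNIV - {0})" for
      A :: "'a::field ^ 2 ^ 2"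
  proof (cases A rule: mat2_cases)
    case (1 a b c d)
    have "A \<in> torus (vec2 1 0) (vec2 0 1) \<longleftrightarrow> b = 0 \<and> c = 0 \<and> a * d
        = 1"
      by (auto simp: 1 torus_def)
    also have "\<dots> \<longleftrightarrow> A \<in> diag2 ` (UNIV - {0})"
      using inverse_unique by (fastforce simp: 1 diag2_def image_iff)
    finally show ?thesis .
  qed
  then show ?thesis by blast
qed

lemma obtain_frame:
  assumes "cross e e' \<noteq> 0"
  obtains P c where "det P = 1" "c \<noteq> 0" "P *v vec2 1 0 = e" "P *v vec2 0 1 = c *s e'"
  using obtain_basis_change[OF assms] assms by (metis inverse_nonzero_iff_nonzero)

lemma card_torus:
  fixes e e' :: "'f::{field,finite} ^ 2"
  assumes "cross e e' \<noteq> 0"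
  shows "card (torus e e') = CARD('f) - 1"
proof -
  obtain P c where P: "det P = 1" "c \<noteq> 0" "P *v vec2 1 0 = e" "P *v vec2 0 1 = c *s e'"
    using obtain_frame[OF assms] .
  have std: "A \<in> torus e (c *s e') \<longleftrightarrow> adj2 P ** A ** P \<in> torus (vec2 1
      0) (vec2 0 1)" for A
    using torus_mult_vec[OF P(1), of A "vec2 1 0" "vec2 0 1"] P(3,4) by simp
  have "bij_betw (\<lambda>A. adj2 P ** A ** P) (torus e (c *s e')) (torus (vec2 1 0) (vec2 0 1))"
    by (rule bij_betw_byWitness[where f' = "\<lambda>A. P ** A ** adj2 P"])
       (auto simp: conj_cancel[OF P(1)] std)
  then have "card (torus e e') = card (torus (vec2 1 0) (vec2 0 1 :: 'f ^ 2))"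
    unfolding torus_smult[OF P(2)] by (rule bij_betw_same_card)
  also have "\<dots> = card (UNIV - {0::'f})"
    unfolding torus_std by (rule card_image) (auto simp: inj_on_def diag2_def)
  finally show ?thesis by (simp add: card_Diff_singleton)
qed

text \<open>\<open>S\<close> will be the preimage of the singular vectors. Only a faithful action on
  five points is assumed; its agreement with the action on lines is derived.\<close>

locale sl2_five_points = sl2_action V act
  for V :: "('v, 'y) monoid_scheme" (structure)
    and act :: "'f::{field,finite} ^ 2 ^ 2 \<Rightarrow> 'v \<Rightarrow> 'v" +
  fixes S :: "'v set"
  assumes card_f: "CARD('f) = 4" and S_carrier: "S \<subseteq> carrier V" and card_S: "card S = 5"
    and act_S: "det A = 1 \<Longrightarrow> x \<in> S \<Longrightarrow> act A x \<in> S"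
    and faithful: "det A = 1 \<Longrightarrow> (\<And>x. x \<in> S \<Longrightarrow> act A x = x)
        \<Longrightarrow> A = mat 1"
begin

lemma finite_S: "finite S"
  using card_S by (metis card.infinite zero_neq_numeral)

lemma S_closed: "x \<in> S \<Longrightarrow> x \<in> carrier V"
  using S_carrier by blast

text \<open>A group of order four acting faithfully on five points fixes an odd number of them;
  three is impossible because the action on the remaining two points would be faithful.\<close>

lemma unip_fixes_one_point:
  assumes "e \<noteq> 0"
  shows "\<exists>!x. x \<in> S \<and> unip e \<subseteq> Stab x"
proof -
  let ?F = "{x \<in> S. \<forall>A \<in> unip e. act A x = x}"
  have card_e: "card (unip e) = 4" using card_unip[OF assms] card_f by simp
  have grp: "group (SL\<lparr>carrier := unip e\<rparr>)"
    using group.subgroup_imp_group[OF group_SL2 subgroup_unip] .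
  have ord: "order (SL\<lparr>carrier := unip e\<rparr>) = 2 ^ 2" using card_e by (simp add:
      order_def)
  have "card S mod 2 = card ?F mod 2"
    using p_group_fixed_points[OF grp two_is_prime_nat ord finite_S, of act] act_S S_closed
    by (simp add: SL_simps act_mult unip_det)
  then have odd: "odd (card ?F)" using card_S by (simp add: odd_iff_mod_2_eq_one)
  have le: "card ?F \<le> 5" using card_mono[OF finite_S, of ?F] card_S by auto
  have "card ?F \<noteq> 5"
  proof
    assume "card ?F = 5"
    then have "?F = S" using card_S finite_S by (intro card_subset_eq) auto
    then have "unip e \<subseteq> {mat 1}" using faithful unip_det by blast
    then have "card (unip e) \<le> 1" by (metis card.empty card_insert_disjoint card_mono empty_iff
        finite.emptyI finite.insertI One_nat_def)
    then show False using card_e by simp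
  qed
  moreover have "card ?F \<noteq> 3"
  proof
    assume F3: "card ?F = 3"
    have "card (S - ?F) = 2" using F3 card_S finite_S by (subst card_Diff_subset) auto
    then obtain x y where xy: "S - ?F = {x, y}" "x \<noteq> y" by (auto simp: card_2_iff)
    then have xS: "x \<in> S" "y \<in> S" by auto
    have stays: "act A z \<in> {x, y}" if A: "A \<in> unip e" and z: "z \<in> {x, y}" for A z
    proof -
      have zS: "z \<in> S" using z xS by auto
      have dA: "det A = 1" using A by (rule unip_det)
      have adj: "adj2 A \<in> unip e"
        using subgroup.m_inv_closed[OF subgroup_unip A] dA by (simp add: inv_SL2)
      have "act A z \<notin> ?F"
      proof
        assume "act A z \<in> ?F"
        then have "act (adj2 A) (act A z) = act A z" using adj by blast
        then have "z = act A z" using dA zS S_closed by simp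
        then have "z \<in> ?F" using \<open>act A z \<in> ?F\<close> by simp
        then show False using z xy(1) by blast
      qed
      moreover have "act A z \<in> S" using act_S[OF dA zS] .
      ultimately show ?thesis using xy(1) by blast
    qed
    have "inj_on (\<lambda>A. act A x) (unip e)"
    proof (rule inj_onI)
      fix A B assume AB: "A \<in> unip e" "B \<in> unip e" "act A x = act B x"
      have d: "det A = 1" "det B = 1" using AB unip_det by blast+
      let ?C = "adj2 A ** B"
      have adj: "adj2 A \<in> unip e"
        using subgroup.m_inv_closed[OF subgroup_unip AB(1)] d by (simp add: inv_SL2)
      have C: "?C \<in> unip e"
        using subgroup.m_closed[OF subgroup_unip adj AB(2)] by (simp add: SL_simps)
      have dC: "det ?C = 1" using C by (rule unip_det)
      have Cx: "act ?C x = x" using act_mult[of "adj2 A" B x] d AB(3)[symmetric] S_closed[OF xS(1)]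
          by simp
      have "act ?C y \<noteq> x"
        using act_inj[OF dC S_closed[OF xS(2)] S_closed[OF xS(1)]] Cx xy(2) by simp
      then have Cy: "act ?C y = y" using stays[OF C, of y] by blast
      have "?C = mat 1"
      proof (rule faithful[OF dC])
        fix z assume "z \<in> S"
        then have "z \<in> ?F \<or> z = x \<or> z = y" using xy(1) by blast
        then show "act ?C z = z" using C Cx Cy by blast
      qed
      then have "A ** (adj2 A ** B) = A" by simp
      then show "A = B" by (simp add: matrix_mul_assoc adj2_inverse d)
    qed
    then have "card (unip e) = card ((\<lambda>A. act A x) ` unip e)" by (simp add: card_image)
    also have "\<dots> \<le> card {x, y}" using stays by (intro card_mono) auto
    finally show False using card_e xy(2) by simp
  qed
  ultimately have "card ?F = 1" using odd le by presburger
  then obtain x where x: "?F = {x}" by (auto simp: card_1_singleton_iff)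
  have "y \<in> ?F \<longleftrightarrow> y \<in> S \<and> unip e \<subseteq> Stab y" for y by (auto
      simp: Stab_def unip_det)
  then have "y \<in> S \<and> unip e \<subseteq> Stab y \<longleftrightarrow> y = x" for y
      unfolding x by simp
  then show ?thesis by simp
qed

definition pt :: "'f ^ 2 \<Rightarrow> 'v"
  where "pt e = (THE x. x \<in> S \<and> unip e \<subseteq> Stab x)"

lemma pt:
  assumes "e \<noteq> 0"
  shows "pt e \<in> S" "unip e \<subseteq> Stab (pt e)"
  using theI'[OF unip_fixes_one_point[OF assms]] unfolding pt_def by blast+

lemma pt_eqI: "e \<noteq> 0 \<Longrightarrow> x \<in> S \<Longrightarrow> unip e \<subseteq> Stab x
    \<Longrightarrow> pt e = x"
  using unip_fixes_one_point pt by blast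

lemma pt_act:
  assumes P: "det P = 1" and e: "e \<noteq> 0"
  shows "pt (P *v e) = act P (pt e)"
proof (rule pt_eqI)
  show "P *v e \<noteq> 0" using e by (simp add: sl2_mult_vec_eq_0_iff P)
  show "act P (pt e) \<in> S" using act_S[OF P pt(1)[OF e]] .
  show "unip (P *v e) \<subseteq> Stab (act P (pt e))"
    using pt(2)[OF e] Stab_act[OF P S_closed[OF pt(1)[OF e]]] unip_mult_vec[OF P] by blast
qed

lemma pt_smult: "c \<noteq> 0 \<Longrightarrow> pt (c *s e) = pt e"
  by (simp add: pt_def unip_smult)

text \<open>If two lines gave the same point, all lines would, since \<open>unip e\<close> fixes
  that point and is transitive on the lines other than that of \<open>e\<close>. The whole group, of
  order 60, would then fix the point and embed into the symmetric group on the other four, of order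
  24.\<close>

lemma pt_inj:
  assumes ee: "cross e e' \<noteq> 0"
  shows "pt e \<noteq> pt e'"
proof
  assume eq: "pt e = pt e'"
  have e: "e \<noteq> 0" "e' \<noteq> 0" using ee by auto
  define x where "x = pt e"
  have x: "x \<in> S" using pt(1)[OF e(1)] by (simp add: x_def)
  obtain P c where P: "det P = 1" "c \<noteq> 0" "P *v vec2 1 0 = e" "P *v vec2 0 1 = c *s e'"
    using obtain_frame[OF ee] .
  have all: "pt f = x" if f: "f \<noteq> 0" for f
  proof (cases "cross e f = 0")
    case True
    then obtain k where "f = k *s e" using e(1) by (auto simp: cross_eq_0_iff)
    then show ?thesis using f pt_smult[of k e] by (cases "k = 0") (auto simp: x_def)
  next
    case False
    obtain \<alpha> \<beta> where ab: "adj2 P *v f = vec2 \<alpha> \<beta>" by (rule vec2_cases)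
    then have f_eq: "f = P *v vec2 \<alpha> \<beta>" using adj2_mult_vec(2)[OF P(1), of f] by simp
    have "cross e f = \<beta>" using cross_mult[of P "vec2 1 0" "vec2 \<alpha> \<beta>"] P(1,3)
        f_eq by simp
    then have b: "\<beta> \<noteq> 0" using False by simp
    \<comment> \<open>The element of \<open>unip (vec2 1 0)\<close> that carries
      \<open>vec2 0 \<beta>\<close> to \<open>vec2 \<alpha> \<beta>\<close>.\<close>
    let ?u = "mat2 1 (\<alpha> / \<beta>) 0 1"
    let ?A = "P ** ?u ** adj2 P"
    have "?u \<in> unip (vec2 1 0)" by (simp add: unip_std)
    then have A: "?A \<in> unip e" using unip_mult_vec[OF P(1), of ?A "vec2 1 0"] P(1,3) by (simp
        add: conj_cancel)
    have "P *v vec2 0 \<beta> = \<beta> *s (P *v vec2 0 1)" by (simp add: vec.scale[symmetric])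
    then have "(\<beta> * c) *s e' = P *v vec2 0 \<beta>" using P(4) by simp
    then have "?A *v ((\<beta> * c) *s e') = P *v (?u *v vec2 0 \<beta>)"
      by (simp add: matrix_vector_mul_assoc[symmetric] adj2_mult_vec P(1) del: mat2_vec2)
    also have "?u *v vec2 0 \<beta> = vec2 \<alpha> \<beta>" using b by simp
    finally have Af: "f = ?A *v ((\<beta> * c) *s e')" using f_eq by simp
    have "pt f = act ?A (pt ((\<beta> * c) *s e'))"
      unfolding Af using unip_det[OF A] e(2) b P(2) by (intro pt_act) auto
    also have "\<dots> = act ?A x" using pt_smult[of "\<beta> * c" e'] b P(2) eq by (simp add: x_def)
    also have "\<dots> = x" using pt(2)[OF e(1)] A by (auto simp: Stab_def x_def)
    finally show ?thesis .
  qed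
  have fix_x: "act A x = x" if A: "det A = 1" for A
    using pt_act[OF A e(1)] all[of "A *v e"] e(1) by (simp add: sl2_mult_vec_eq_0_iff A x_def)
  let ?T = "S - {x}"
  let ?r = "\<lambda>A y. if y \<in> ?T then act A y else y"
  have "?r A permutes ?T" if A: "det A = 1" for A
  proof (rule bij_imp_permutes)
    have "act A y \<in> ?T" if y: "y \<in> ?T" for y
    proof -
      have "act A y \<noteq> x"
      proof
        assume "act A y = x"
        then have "act A y = act A x" using fix_x[OF A] by simp
        then show False using y x S_closed act_inj[OF A] by auto
      qed
      then show ?thesis using act_S[OF A] y by blast
    qed
    moreover have "inj_on (act A) ?T" using act_inj[OF A] S_closed by (auto simp: inj_on_def)
    ultimately have "bij_betw (act A) ?T ?T"
      unfolding bij_betw_def using finite_S endo_inj_surj[of ?T "act A"] by blast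
    then show "bij_betw (?r A) ?T ?T" by (subst bij_betw_cong[of _ _ "act A"]) auto
  qed auto
  moreover have "inj_on ?r {A. det A = 1}"
  proof (rule inj_onI)
    fix A B :: "'f ^ 2 ^ 2" assume AB: "A \<in> {A. det A = 1}" "B \<in> {A. det A = 1}" "?r A = ?r B"
    then have d: "det A = 1" "det B = 1" by auto
    have "act A y = act B y" if "y \<in> S" for y
    proof (cases "y = x")
      case True
      then show ?thesis using fix_x d by simp
    next
      case False
      then show ?thesis using fun_cong[OF AB(3), of y] that by simp
    qed
    then have "act (adj2 A ** B) y = y" if "y \<in> S" for y
      using that d S_closed[OF that] by (simp add: act_mult flip: \<open>\<And>y. y \<in> S
          \<Longrightarrow> act A y = act B y\<close>)
    then have "adj2 A ** B = mat 1" using d by (intro faithful) (simp_all add: det_mul)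
    then have "A ** (adj2 A ** B) = A" by simp
    then show "A = B" by (simp add: matrix_mul_assoc adj2_inverse d)
  qed
  ultimately have "card {A :: 'f ^ 2 ^ 2. det A = 1} \<le> card {p. p permutes ?T}"
    using finite_S by (intro card_inj_on_le[of ?r]) (auto intro: finite_permutations)
  also have "\<dots> = fact 4"
    using card_S x finite_S by (intro card_permutations) (simp_all add: card_Diff_singleton)
  finally show False by (simp add: card_sl2 card_f fact_numeral)
qed

lemma Stab_pt:
  assumes e: "e \<noteq> 0"
  shows "A \<in> Stab (pt e) \<longleftrightarrow> det A = 1 \<and> cross e (A *v e) = 0"
proof
  assume A: "A \<in> Stab (pt e)"
  then have dA: "det A = 1" by (rule Stab_det)
  then have "pt e = pt (A *v e)" using pt_act[OF dA e] A by (simp add: Stab_def)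
  then show "det A = 1 \<and> cross e (A *v e) = 0" using pt_inj dA by blast
next
  assume A: "det A = 1 \<and> cross e (A *v e) = 0"
  then obtain c where c: "A *v e = c *s e" using e by (auto simp: cross_eq_0_iff)
  then have "c \<noteq> 0" using e A sl2_mult_vec_eq_0_iff[of A e] by auto
  then show "A \<in> Stab (pt e)" using pt_act[of A e] A e c pt_smult[of c e] by (simp add: Stab_def)
qed

text \<open>Of the 15 nonzero vectors at most three, those on one line, share a point, so all five
  points occur.\<close>

lemma pt_surj:
  assumes "x \<in> S"
  obtains e where "e \<noteq> 0" "pt e = x"
proof -
  let ?E = "{e :: 'f ^ 2. e \<noteq> 0}"
  have sub: "pt ` ?E \<subseteq> S" by (rule image_subsetI) (simp add: pt(1))
  have fin: "finite (pt ` ?E)" using sub finite_S by (rule finite_subset)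
  have fibre: "card {e \<in> ?E. pt e = x} \<le> 3" if x: "x \<in> pt ` ?E" for x
  proof -
    from x obtain e0 where e0: "e0 \<noteq> 0" "x = pt e0" by blast
    have "{e \<in> ?E. pt e = x} \<subseteq> (\<lambda>c. c *s e0) ` (UNIV - {0})"
    proof
      fix e assume "e \<in> {e \<in> ?E. pt e = x}"
      then have e: "e \<noteq> 0" "pt e0 = pt e" using e0 by auto
      then have "cross e0 e = 0" using pt_inj[of e0 e] by blast
      then obtain c where "e = c *s e0" unfolding cross_eq_0_iff[OF e0(1)] by blast
      then show "e \<in> (\<lambda>c. c *s e0) ` (UNIV - {0})" using e(1) by auto
    qed
    then have "card {e \<in> ?E. pt e = x} \<le> card ((\<lambda>c. c *s e0) ` (UNIV - {0}))" by
        (rule card_mono[rotated]) simp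
    also have "\<dots> \<le> card (UNIV - {0::'f})" by (rule card_image_le) simp
    also have "\<dots> = 3" using card_f by (simp add: card_Diff_singleton)
    finally show ?thesis .
  qed
  have "?E = (\<Union>x\<in>pt ` ?E. {e \<in> ?E. pt e = x})" by blast
  then have "card ?E = card (\<Union>x\<in>pt ` ?E. {e \<in> ?E. pt e = x})" by (rule arg_cong)
  also have "\<dots> \<le> (\<Sum>x\<in>pt ` ?E. card {e \<in> ?E. pt e = x})" by (rule
      card_UN_le[OF fin])
  also have "\<dots> \<le> (\<Sum>x\<in>pt ` ?E. 3)" by (rule sum_mono) (rule fibre)
  finally have "15 \<le> 3 * card (pt ` ?E)" by (simp add: card_nonzero_vectors card_f)
  then have "card S \<le> card (pt ` ?E)" using card_S by simp
  then have "pt ` ?E = S" using sub finite_S by (intro card_seteq) auto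
  then have "x \<in> pt ` ?E" using assms by simp
  then obtain e where e: "x = pt e" "e \<in> ?E" by (rule imageE)
  then show ?thesis using that[of e] by simp
qed

lemma Stab_two_points:
  assumes "e \<noteq> 0" "e' \<noteq> 0"
  shows "Stab (pt e) \<inter> Stab (pt e') = torus e e'"
  using Stab_pt[OF assms(1)] Stab_pt[OF assms(2)] by (auto simp: torus_def)

lemma pt_distinct_cross:
  assumes "e \<noteq> 0" "pt e \<noteq> pt e'" "e' \<noteq> 0"
  shows "cross e e' \<noteq> 0"
proof
  assume "cross e e' = 0"
  then obtain c where "e' = c *s e" using assms(1) by (auto simp: cross_eq_0_iff)
  then show False using assms pt_smult[of c e] by (cases "c = 0") auto
qed

lemma S_typeII:
  assumes "x \<in> S"
  shows "typeII x"
proof -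
  obtain e where e: "e \<noteq> 0" "pt e = x" using pt_surj[OF assms] .
  then show ?thesis using pt(2)[OF e(1)] Stab_pt[OF e(1)] S_closed[OF assms] by (auto simp:
      typeII_def)
qed

text \<open>The stabilizer of the identity is the whole group, where a conjugate of the Weyl element
  moves the line of \<open>e\<close>.\<close>

lemma one_not_typeII: "\<not> typeII \<one>"
proof
  assume "typeII \<one>"
  then obtain e where e: "e \<noteq> 0" "\<And>A. A \<in> Stab \<one> \<Longrightarrow> cross e (A
      *v e) = 0" by (auto simp: typeII_def)
  obtain P where P: "det P = 1" "P *v vec2 1 0 = e" using obtain_sl2_image[OF e(1)] .
  let ?A = "P ** mat2 0 (- 1) 1 0 ** adj2 P"
  have "det ?A = 1" using P(1) by (simp add: det_mul)
  then have "cross e (?A *v e) = 0" using e(2) by (simp add: Stab_def)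
  moreover have "?A *v e = P *v vec2 0 1"
    using adj2_mult_vec(1)[OF P(1), of "vec2 1 0"] P(2) by (simp add:
        matrix_vector_mul_assoc[symmetric])
  ultimately have "cross (P *v vec2 1 0) (P *v vec2 0 1) = 0" using P(2) by simp
  then show False by (simp add: cross_mult P(1))
qed

end

section \<open>The backward direction\<close>

context sl2_sylow_action
begin

lemma five_points_if_Omega4_minus:
  assumes q: "CARD('f) = 4" and Om: "Omega4_minus_standard_module G V \<phi>"
  obtains f where "sl2_five_points V act {v \<in> carrier V. f v \<in> singular_vectors}"
    "bij_betw f (carrier V) (UNIV :: (bit ^ 4) set)"
    "\<And>u v. u \<in> carrier V \<Longrightarrow> v \<in> carrier V \<Longrightarrow> f (u
        \<otimes>\<^bsub>V\<^esub> v) = f u + f v"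
proof -
  obtain \<psi> f where \<psi>: "\<psi> \<in> hom G (SL :: (bit ^ 4 ^ 4) monoid)" "inj_on \<psi>
      (carrier G)"
      "\<psi> ` carrier G = Omega4_minus"
    and f: "f \<in> iso V (vec_group :: (bit ^ 4) monoid)"
    and equiv: "\<forall>g\<in>carrier G. \<forall>v\<in>carrier V. f (\<phi> g v) = \<psi> g *v f v"
    using Om unfolding Omega4_minus_standard_module_def by blast
  have bij: "bij_betw f (carrier V) UNIV" using f by (simp add: iso_def vec_group_def)
  have add: "f (u \<otimes>\<^bsub>V\<^esub> v) = f u + f v" if "u \<in> carrier V" "v \<in>
      carrier V" for u v
    using f that by (auto simp: iso_def hom_def vec_group_def)
  interpret GL: group "GL :: (bit ^ 4 ^ 4) monoid" by (rule group_GL)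
  have OmO: "Omega4_minus \<subseteq> O4_minus"
    unfolding Omega4_minus_def by (rule GL.derived_incl[OF subset_refl subgroup_O4_minus])
  have f_act: "f (act A v) = \<psi> (\<eta> A) *v f v" if "det A = 1" "v \<in> carrier V" for A v
    using equiv that by (simp add: act_def)
  have O4: "\<psi> (\<eta> A) \<in> O4_minus" if "det A = 1" for A
    using \<psi>(3) OmO \<eta>_closed[OF that] by blast
  let ?S = "{v \<in> carrier V. f v \<in> singular_vectors}"
  have "sl2_five_points V act ?S"
  proof unfold_locales
    show "CARD('f) = 4" by (rule q)
    show "?S \<subseteq> carrier V" by blast
    have "f ` ?S = singular_vectors"
    proof
      show "singular_vectors \<subseteq> f ` ?S"
      proof
        fix w assume w: "w \<in> singular_vectors"
        have "w \<in> f ` carrier V" using bij by (simp add: bij_betw_def)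
        then show "w \<in> f ` ?S" using w by blast
      qed
    qed blast
    moreover have "inj_on f ?S" using bij by (auto simp: bij_betw_def inj_on_def)
    ultimately show "card ?S = 5" using card_image card_singular_vectors by metis
    show "act A x \<in> ?S" if A: "det A = 1" and x: "x \<in> ?S" for A x
    proof -
      have O: "invertible (\<psi> (\<eta> A))" "\<forall>w. Q_minus (\<psi> (\<eta> A) *v w) =
          Q_minus w"
        using O4[OF A] by (simp_all add: O4_minus_def)
      have "\<psi> (\<eta> A) *v f x \<noteq> 0"
        using matrix_inj_on_GL[OF O(1), of "f x" 0] x by (auto simp: singular_vectors_def)
      then show ?thesis using O(2) x A f_act[OF A, of x] by (simp add: singular_vectors_def)
    qed
    show "A = mat 1" if A: "det A = 1" and fixed: "\<And>x. x \<in> ?S \<Longrightarrow> act A x =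
        x" for A
    proof -
      have "\<psi> (\<eta> A) *v w = mat 1 *v w" if "w \<in> singular_vectors" for w
      proof -
        have "w \<in> f ` carrier V" using bij by (simp add: bij_betw_def)
        then obtain v where v: "v \<in> carrier V" "w = f v" by blast
        then show ?thesis using fixed[of v] f_act[OF A v(1)] that by simp
      qed
      then have "\<psi> (\<eta> A) = mat 1" by (rule singular_vectors_span)
      moreover have "\<psi> \<one>\<^bsub>G\<^esub> = mat 1"
      proof -
        have "mat 1 = \<psi> \<one>\<^bsub>G\<^esub>"
        proof (rule singular_vectors_span)
          fix w :: "bit ^ 4"
          have "w \<in> f ` carrier V" using bij by (simp add: bij_betw_def)
          then obtain v where v: "v \<in> carrier V" "w = f v" by blast
          then show "mat 1 *v w = \<psi> \<one>\<^bsub>G\<^esub> *v w"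
            using f_act[of "mat 1" v] by simp
        qed
        then show ?thesis ..
      qed
      ultimately have "\<eta> A = \<one>\<^bsub>G\<^esub>"
        using inj_onD[OF \<psi>(2), of "\<eta> A" "\<one>\<^bsub>G\<^esub>"] \<eta>_closed[OF A] by
            simp
      then have "\<eta> A = \<eta> (mat 1)" by simp
      then show ?thesis using \<eta>_inj[OF A, of "mat 1"] by simp
    qed
  qed
  then show ?thesis using that bij add by blast
qed

theorem all_points_of_two_types_if_structure:
  assumes q: "CARD('f) = 4" and r3: "r = 3" and Om: "Omega4_minus_standard_module G V \<phi>"
  shows "pts_with_normal_conjugate G V \<phi> R \<noteq> {}" "pts_with_normal_conjugate G V \<phi>
      T \<noteq> {}"
    and "carrier V - {\<one>\<^bsub>V\<^esub>} = pts_with_normal_conjugate G V \<phi> R \<union>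
        pts_with_normal_conjugate G V \<phi> T"
proof -
  obtain f where five: "sl2_five_points V act {v \<in> carrier V. f v \<in> singular_vectors}"
    and bij: "bij_betw f (carrier V) (UNIV :: (bit ^ 4) set)"
    and add: "\<And>u v. u \<in> carrier V \<Longrightarrow> v \<in> carrier V \<Longrightarrow> f
        (u \<otimes>\<^bsub>V\<^esub> v) = f u + f v"
    using five_points_if_Omega4_minus[OF q Om] by blast
  define S where "S = {v \<in> carrier V. f v \<in> singular_vectors}"
  interpret F: sl2_five_points V act S using five unfolding S_def .
  obtain e0 where e0: "e0 \<noteq> 0" "pre T = unip e0"
    using sylow_t_eq_unip[OF prime_t card_f exponent_pos sylow_T] .
  note II = V_II_iff_typeII[OF sylow_T e0]
  note subR = p_subgroup_pre(1)[OF sylow_R]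
  have inj: "u = v" if "u \<in> carrier V" "v \<in> carrier V" "f u = f v" for u v
    using bij that by (auto simp: bij_betw_def inj_on_def)
  have surj: "\<exists>v\<in>carrier V. f v = w" for w
  proof -
    have "w \<in> f ` carrier V" using bij by (simp add: bij_betw_def)
    then show ?thesis by blast
  qed
  have f1: "f \<one>\<^bsub>V\<^esub> = 0" using add[OF V.one_closed V.one_closed] by simp

  \<comment> \<open>The Sylow subgroup has order 3, so the number of its fixed points among five is
    2 modulo 3. Two fixed points place it in the torus of two lines, which also has order 3.\<close>
  have "multiplicity 3 (60::nat) = 1" by (rule multiplicity_eqI) simp_all
  then have cardR: "card (pre R) = 3"
    using p_subgroup_pre(3)[OF sylow_R] order_G by (simp add: r3 q)
  let ?FR = "{x \<in> S. \<forall>A \<in> pre R. act A x = x}"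
  have "card S mod r = card ?FR mod r"
    by (rule pre_fixed_points[OF sylow_R prime_r F.finite_S])
       (simp_all add: F.act_S F.S_closed act_mult pre_det)
  then have "card ?FR mod 3 = 2" using F.card_S by (simp add: r3)
  moreover have "card ?FR mod 3 \<le> card ?FR" by (rule mod_less_eq_dividend)
  ultimately have "2 \<le> card ?FR" by simp
  then obtain D where D: "D \<subseteq> ?FR" "card D = 2" by (rule obtain_subset_with_card_n)
  then obtain z1 z2 where z: "D = {z1, z2}" "z1 \<noteq> z2" by (auto simp: card_2_iff)
  then have zF: "z1 \<in> ?FR" "z2 \<in> ?FR" using D(1) by blast+
  then have zS: "z1 \<in> S" "z2 \<in> S" by blast+
  obtain k1 where k1: "k1 \<noteq> 0" "F.pt k1 = z1" using zS(1) by (rule F.pt_surj)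
  obtain k2 where k2: "k2 \<noteq> 0" "F.pt k2 = z2" using zS(2) by (rule F.pt_surj)
  have kk: "cross k1 k2 \<noteq> 0" using F.pt_distinct_cross[OF k1(1) _ k2(1)] k1(2) k2(2) z(2) by
      simp
  have "pre R \<subseteq> torus k1 k2"
    using zF unfolding F.Stab_two_points[OF k1(1) k2(1), symmetric] k1(2) k2(2)
    by (auto simp: Stab_def pre_det)
  moreover have "card (torus k1 k2) = 3" using card_torus[OF kk] q by simp
  ultimately have R: "pre R = torus k1 k2" using cardR by (intro card_subset_eq) auto

  have conjR: "(\<lambda>A. adj2 Z ** A ** Z) ` pre R = torus (adj2 Z *v k1) (adj2 Z *v k2)" if Z:
      "det Z = 1" for Z
  proof -
    have "B \<in> torus (adj2 Z *v k1) (adj2 Z *v k2) \<longleftrightarrow> Z ** B ** adj2 Z \<in>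
        torus k1 k2" for B
      using torus_mult_vec[of "adj2 Z" B k1 k2] Z by simp
    then have "B \<in> torus (adj2 Z *v k1) (adj2 Z *v k2) \<longleftrightarrow> B \<in>
        (\<lambda>A. adj2 Z ** A ** Z) ` torus k1 k2" for B
      using conj_cancel[OF Z] by (metis (no_types, lifting) image_iff)
    then show ?thesis unfolding R by blast
  qed

  have S_II: "x \<in> pts_with_normal_conjugate G V \<phi> T" if "x \<in> S" for x
    using II F.S_typeII[OF that] by blast

  \<comment> \<open>The stabilizer of a nonsingular \<open>y\<close> permutes the unique pair of
    singular summands, so it normalizes the pointwise stabilizer of the pair, a torus conjugate to
    \<open>pre R\<close>.\<close>
  have N_I: "y \<in> pts_with_normal_conjugate G V \<phi> R" if y: "y \<in> carrier V" "y \<noteq>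
      \<one>\<^bsub>V\<^esub>" "y \<notin> S" for y
  proof -
    have "f y \<noteq> 0" using inj[OF y(1) V.one_closed] f1 y(2) by auto
    moreover have "f y \<notin> singular_vectors" using y by (simp add: S_def)
    ultimately obtain a b where ab: "a \<in> singular_vectors" "b \<in> singular_vectors" "a
        \<noteq> b" "f y = a + b"
      by (rule nonsingular_as_sum)
    obtain x1 where x1: "x1 \<in> carrier V" "f x1 = a" using surj by blast
    obtain x2 where x2: "x2 \<in> carrier V" "f x2 = b" using surj by blast
    have xS: "x1 \<in> S" "x2 \<in> S" using x1 x2 ab by (auto simp: S_def)
    have x12: "x1 \<noteq> x2" using x1 x2 ab(3) by auto
    have y_eq: "y = x1 \<otimes>\<^bsub>V\<^esub> x2" using inj[OF y(1)] add x1 x2 ab(4) by simp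
    obtain e1 where e1: "e1 \<noteq> 0" "F.pt e1 = x1" using F.pt_surj[OF xS(1)] .
    obtain e2 where e2: "e2 \<noteq> 0" "F.pt e2 = x2" using F.pt_surj[OF xS(2)] .
    have ee: "cross e1 e2 \<noteq> 0" using F.pt_distinct_cross[OF e1(1) _ e2(1)] e1(2) e2(2) x12
        by simp
    have tor: "torus e1 e2 = Stab x1 \<inter> Stab x2"
      using F.Stab_two_points[OF e1(1) e2(1)] e1(2) e2(2) by simp
    have perm: "act A x \<in> {x1, x2}" if A: "A \<in> Stab y" and x: "x \<in> {x1, x2}" for A x
    proof -
      have dA: "det A = 1" using Stab_det[OF A] .
      have S': "act A x1 \<in> S" "act A x2 \<in> S" using F.act_S[OF dA] xS by blast+
      then have c: "act A x1 \<in> carrier V" "act A x2 \<in> carrier V" using F.S_closed by blast+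
      have "y = act A x1 \<otimes>\<^bsub>V\<^esub> act A x2"
        using A act_hom[OF dA x1(1) x2(1)] y_eq by (simp add: Stab_def)
      then have sum: "f (act A x1) + f (act A x2) = f x1 + f x2"
        using add[OF c] add[OF x1(1) x2(1)] y_eq by metis
      have sing: "f (act A x1) \<in> singular_vectors" "f (act A x2) \<in> singular_vectors"
        "f x1 \<in> singular_vectors" "f x2 \<in> singular_vectors" using S' xS by (auto simp: S_def)
      have ne: "f (act A x1) \<noteq> f (act A x2)" "f x1 \<noteq> f x2"
        using inj c x1 x2 x12 act_inj[OF dA x1(1) x2(1)] by metis+
      have "f (act A x1) \<in> {f x1, f x2}"
        using sum_of_singular_unique[OF sing ne sum] .
      moreover have "f (act A x2) \<in> {f x1, f x2}"
        using sum_of_singular_unique[OF sing(2,1,3,4) ne(1)[symmetric] ne(2)] sum by (simp add: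
            add.commute)
      ultimately show ?thesis using x inj[OF c(1) x1(1)] inj[OF c(1) x2(1)] inj[OF c(2) x1(1)]
          inj[OF c(2) x2(1)] by auto
    qed
    obtain P c where P: "det P = 1" "c \<noteq> 0" "P *v vec2 1 0 = e1" "P *v vec2 0 1 = c *s e2"
      using obtain_frame[OF ee] .
    obtain P' c' where P': "det P' = 1" "c' \<noteq> 0" "P' *v vec2 1 0 = k1" "P' *v vec2 0 1 = c'
        *s k2"
      using obtain_frame[OF kk] .
    \<comment> \<open>Built from two frames: its inverse carries the lines of \<open>k1\<close> and
      \<open>k2\<close> to those of \<open>e1\<close> and \<open>e2\<close>;
      \<open>torus_smult\<close> absorbs the scalars.\<close>
    let ?Z = "P' ** adj2 P"
    have Z: "det ?Z = 1" using P P' by (simp add: det_mul)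
    have adjP: "adj2 P' *v k1 = vec2 1 0" using adj2_mult_vec(1)[OF P'(1), of "vec2 1 0"] P'(3) by
        simp
    have "adj2 P' *v (c' *s k2) = vec2 0 1" using adj2_mult_vec(1)[OF P'(1), of "vec2 0 1"] P'(4)
        by simp
    then have "c' *s (adj2 P' *v k2) = vec2 0 1" by (simp add: vec.scale)
    then have "P *v (c' *s (adj2 P' *v k2)) = c *s e2" using P(4) by simp
    then have "c' *s (adj2 ?Z *v k2) = c *s e2"
      by (simp add: adj2_mult matrix_vector_mul_assoc[symmetric] vec.scale)
    moreover have "adj2 ?Z *v k1 = e1" using adjP P(3) by (simp add: adj2_mult
        matrix_vector_mul_assoc[symmetric])
    ultimately have "torus (adj2 ?Z *v k1) (adj2 ?Z *v k2) = torus e1 e2"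
      using torus_smult[OF P'(2), of e1 "adj2 ?Z *v k2"] torus_smult[OF P(2), of e1 e2] by metis
    then have im: "(\<lambda>A. adj2 ?Z ** A ** ?Z) ` pre R = Stab x1 \<inter> Stab x2"
      using conjR[OF Z] tor by simp
    have "Stab x1 \<inter> Stab x2 \<subseteq> Stab y"
      using act_hom x1(1) x2(1) y_eq by (auto simp: Stab_def)
    moreover have "B ** C ** adj2 B \<in> Stab x1 \<inter> Stab x2" if B: "B \<in> Stab y" and C:
        "C \<in> Stab x1 \<inter> Stab x2" for B C
    proof -
      have d: "det B = 1" "det C = 1" using B C Stab_det by blast+
      have "act (B ** C ** adj2 B) x = x" if x: "x \<in> {x1, x2}" for x
      proof -
        have xc: "x \<in> carrier V" using x x1 x2 by auto
        have "act (adj2 B) x \<in> {x1, x2}" using perm[OF Stab_subgroup(2)[OF y(1) B B] x] .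
        then have "act C (act (adj2 B) x) = act (adj2 B) x" using C by (auto simp: Stab_def)
        then show ?thesis using d xc by (simp add: act_mult det_mul)
      qed
      then show ?thesis using d by (simp add: Stab_def det_mul)
    qed
    ultimately show ?thesis
      unfolding pts_iff[OF subR] using y(1) Z im by (intro conjI exI[of _ ?Z]) simp_all
  qed

  \<comment> \<open>A torus normal in the whole group would, by transitivity on lines, fix all five
    points and so be trivial, against its order 3.\<close>
  have one_I: "\<one>\<^bsub>V\<^esub> \<notin> pts_with_normal_conjugate G V \<phi> R"
  proof
    assume "\<one>\<^bsub>V\<^esub> \<in> pts_with_normal_conjugate G V \<phi> R"
    then obtain Z where Z: "det Z = 1" and norm: "\<forall>B\<in>Stab \<one>\<^bsub>V\<^esub>.
        \<forall>C\<in>(\<lambda>A. adj2 Z ** A ** Z) ` pre R.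
        B ** C ** adj2 B \<in> (\<lambda>A. adj2 Z ** A ** Z) ` pre R"
      unfolding pts_iff[OF subR] by blast
    let ?T = "torus (adj2 Z *v k1) (adj2 Z *v k2)"
    have m: "adj2 Z *v k1 \<noteq> 0" "adj2 Z *v k2 \<noteq> 0" using k1(1) k2(1) Z by (simp_all
        add: sl2_mult_vec_eq_0_iff)
    have cr: "cross (adj2 Z *v k1) (adj2 Z *v k2) \<noteq> 0" using kk Z by (simp add: cross_mult)
    have "?T \<subseteq> {mat 1}"
    proof
      fix C assume C: "C \<in> ?T"
      have dC: "det C = 1" using C by (simp add: torus_def)
      have "C = mat 1"
      proof (rule F.faithful[OF dC])
        fix x assume "x \<in> S"
        then obtain e where e: "e \<noteq> 0" "F.pt e = x" by (rule F.pt_surj)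
        obtain P1 where P1: "det P1 = 1" "P1 *v vec2 1 0 = e" using obtain_sl2_image[OF e(1)] .
        obtain P2 where P2: "det P2 = 1" "P2 *v vec2 1 0 = adj2 Z *v k1" using obtain_sl2_image[OF
            m(1)] .
        let ?B = "P1 ** adj2 P2"
        have B: "det ?B = 1" using P1 P2 by (simp add: det_mul)
        have "adj2 P2 *v (adj2 Z *v k1) = vec2 1 0" using adj2_mult_vec(1)[OF P2(1), of "vec2 1 0"]
            P2(2) by simp
        then have "?B *v (adj2 Z *v k1) = e" using P1(2) by (simp add:
            matrix_vector_mul_assoc[symmetric])
        then have xB: "x = act ?B (F.pt (adj2 Z *v k1))" using F.pt_act[OF B m(1)] e(2) by simp
        have "adj2 ?B \<in> Stab \<one>\<^bsub>V\<^esub>" using B by (simp add: Stab_def)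
        then have "adj2 ?B ** C ** adj2 (adj2 ?B) \<in> ?T" using norm C unfolding conjR[OF Z] by
            blast
        then have "adj2 ?B ** C ** ?B \<in> Stab (F.pt (adj2 Z *v k1))"
          using F.Stab_two_points[OF m] by auto
        then have "C \<in> Stab x" unfolding xB using Stab_act[OF B F.S_closed[OF F.pt(1)[OF
            m(1)]]] by simp
        then show "act C x = x" by (simp add: Stab_def)
      qed
      then show "C \<in> {mat 1}" by simp
    qed
    then have "card ?T \<le> card {mat 1 :: 'f ^ 2 ^ 2}" by (intro card_mono) auto
    then show False using card_torus[OF cr] q by simp
  qed

  have one_II: "\<one>\<^bsub>V\<^esub> \<notin> pts_with_normal_conjugate G V \<phi> T"
    using II F.one_not_typeII by blast

  have "S \<noteq> {}" using F.card_S by auto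
  then show "pts_with_normal_conjugate G V \<phi> T \<noteq> {}" using S_II by blast
  \<comment> \<open>A vector of value 1 under the form, to witness that nonsingular points
    exist.\<close>
  obtain y where y: "y \<in> carrier V" "f y = vec4 0 0 1 0" using surj by blast
  have "Q_minus (vec4 0 0 1 0) = 1" by (simp add: Q_minus_def)
  then have "y \<notin> S" using y by (simp add: S_def singular_vectors_def)
  moreover have "y \<noteq> \<one>\<^bsub>V\<^esub>" using y(2) f1 by (auto simp: vec4_eq_iff)
  ultimately have "y \<in> pts_with_normal_conjugate G V \<phi> R" using N_I[OF y(1)] by blast
  then show "pts_with_normal_conjugate G V \<phi> R \<noteq> {}" by blast
  have "pts_with_normal_conjugate G V \<phi> P \<subseteq> carrier V" for P
    by (auto simp: pts_with_normal_conjugate_def)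
  then show "carrier V - {\<one>\<^bsub>V\<^esub>} = pts_with_normal_conjugate G V \<phi> R
      \<union> pts_with_normal_conjugate G V \<phi> T"
    using N_I S_II one_I one_II by blast
qed

end

text \<open>The conjunct \<open>r = 3\<close> separates the two odd primes dividing 15. On the
  standard module the nonzero vectors have stabilizers of order 12 or 6, and for
  \<open>r = 5\<close> no conjugate of \<open>R\<close> fits into one of these; as \<open>R\<close>
  is not normal in \<open>G\<close> either, V_I would be empty.\<close>

theorem theorem3p4:
  fixes G :: "('g, 'x) monoid_scheme" and V :: "('v, 'y) monoid_scheme"
    and \<phi> :: "'g \<Rightarrow> 'v \<Rightarrow> 'v" and t a r :: nat and T R :: "'g set"
    and V_I V_II :: "'v set"
  assumes "Factorial_Ring.prime t" and "t ^ a \<ge> 4" and "CARD('f::{field,finite}) = t ^ a"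
    and "group G" and "G \<cong> (SL :: ('f ^ 2 ^ 2) monoid)"
    and "sylow_subgroup G t T"
    and "Factorial_Ring.prime r" and "odd r" and "r dvd t ^ (2 * a) - 1"
    and "sylow_subgroup G r R"
    and "group V" and "finite (carrier V)" and "\<exists>n. Coset.order V = t ^ n"
    and "\<phi> \<in> hom G (AutoGroup V)"
    and "fixed_points G V \<phi> = {\<one>\<^bsub>V\<^esub>}"
  defines "V_I \<equiv> pts_with_normal_conjugate G V \<phi> R"
    and "V_II \<equiv> pts_with_normal_conjugate G V \<phi> T"
  shows "(V_I \<noteq> {} \<and> V_II \<noteq> {} \<and> carrier V - {\<one>\<^bsub>V\<^esub>} = V_I \<union> V_II)
    \<longleftrightarrow>
    (G \<cong> (SL :: (gf4 ^ 2 ^ 2) monoid) \<and> irreducible_F2_module_dim4 G V \<phi> \<and>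
      Omega4_minus_standard_module G V \<phi>) \<and> r = 3"
proof -
  have "(SL :: ('f ^ 2 ^ 2) monoid) \<cong> G" using group.iso_sym[OF assms(4,5)] .
  then obtain \<eta> where \<eta>: "\<eta> \<in> iso (SL :: ('f ^ 2 ^ 2) monoid) G" by (auto simp:
      is_iso_def)
  obtain n where n: "Coset.order V = t ^ n" using assms(13) by blast
  interpret S: sl2_sylow_action G V \<phi> \<eta> t a r n T R
    using assms \<eta> n
    by (simp add: sl2_sylow_action_def sl2_group_action_def sl2_group_action_axioms_def
        sl2_sylow_action_axioms_def order_def)
  show ?thesis
  proof
    assume *: "V_I \<noteq> {} \<and> V_II \<noteq> {} \<and> carrier V - {\<one>\<^bsub>V\<^esub>}
        = V_I \<union> V_II"
    then have c: "CARD('f) = 4 \<and> r = 3 \<and> irreducible_F2_module_dim4 G V \<phi> \<and>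
        Omega4_minus_standard_module G V \<phi>"
      unfolding V_I_def V_II_def by (intro S.structure_if_all_points_of_two_types) blast+
    then have "(SL :: ('f ^ 2 ^ 2) monoid) \<cong> (SL :: (gf4 ^ 2 ^ 2) monoid)" by (intro
        SL2_iso_gf4) simp
    then have "G \<cong> (SL :: (gf4 ^ 2 ^ 2) monoid)" using assms(5) iso_trans by blast
    then show "(G \<cong> (SL :: (gf4 ^ 2 ^ 2) monoid) \<and> irreducible_F2_module_dim4 G V \<phi>
        \<and>
      Omega4_minus_standard_module G V \<phi>) \<and> r = 3" using c by simp
  next
    assume *: "(G \<cong> (SL :: (gf4 ^ 2 ^ 2) monoid) \<and> irreducible_F2_module_dim4 G V \<phi>
        \<and>
      Omega4_minus_standard_module G V \<phi>) \<and> r = 3"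
    have "(SL :: ('f ^ 2 ^ 2) monoid) \<cong> (SL :: (gf4 ^ 2 ^ 2) monoid)"
      using * \<open>SL \<cong> G\<close> iso_trans by blast
    then have "card {A :: 'f ^ 2 ^ 2. det A = 1} = card {A :: gf4 ^ 2 ^ 2. det A = 1}"
      using iso_same_card by (fastforce simp: SL_simps)
    also have "\<dots> = 60" by (simp add: card_sl2 card_gf4)
    finally have q: "CARD('f) = 4" by (rule card_field_of_card_sl2)
    show "V_I \<noteq> {} \<and> V_II \<noteq> {} \<and> carrier V - {\<one>\<^bsub>V\<^esub>} =
        V_I \<union> V_II"
      unfolding V_I_def V_II_def
      using S.all_points_of_two_types_if_structure[OF q] * by blast
  qed
qed

end
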